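(* Let $0<s_0<s<s_1<1$ and $1<p<\infty$. Then $H^{s_1,p}(\mathbb{R}^n)\hookrightarrow W^{s,p}(\mathbb{R}^n)\hookrightarrow H^{s_0,p}(\mathbb{R}^n)$.
   Context: $X\hookrightarrow Y$ means that $X\subset Y$ with continuous inclusion. $\mathfrak{F}$ is the Fourier transform on tempered distributions $\mathcal{S}'(\mathbb{R}^n)$, normalized by $\mathfrak{F}f(\xi)=\int_{\mathbb{R}^n}f(x)e^{-2\pi i x\cdot\xi}\,dx$. For $s\in\mathbb{C}$ the Bessel potential is $\Lambda_s f=\mathfrak{F}^{-1}\big((1+4\pi^2|\xi|^2)^{-s/2}\mathfrak{F}f(\xi)\big)$, $f\in\mathcal{S}'(\mathbb{R}^n)$. For $s\in\mathbb{R}$ and $1<p<\infty$, the Bessel potential space is $H^{s,p}(\mathbb{R}^n)=\{f\in\mathcal{S}'(\mathbb{R}^n):\Lambda_{-s}f\in L^p(\mathbb{R}^n)\}$ with norm $\|f\|_{H^{s,p}}=\|\Lambda_{-s}f\|_{L^p}$ (considered up to equivalence of norms). For $s\in(0,1)$, $1\le p<\infty$, the Gagliardo space $W^{s,p}(\mathbb{R}^n)$ is the set of $u\in L^p(\mathbb{R}^n)$ with $[u]_{W^{s,p}}:=\left(\int_{\mathbb{R}^n}\int_{\mathbb{R}^n}\frac{|u(x)-u(y)|^p}{|x-y|^{n+sp}}\,dx\,dy\right)^{1/p}<\infty$, with norm $\|u\|_{L^p}+[u]_{W^{s,p}}$. *)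

theory Defs
  imports "HOL-Analysis.Analysis"
begin

section \<open>Schwartz functions\<close>

definition partial_deriv :: "'n::finite \<Rightarrow> (real^'n \<Rightarrow> complex) \<Rightarrow> real^'n \<Rightarrow> complex" where
  "partial_deriv i f x = frechet_derivative f (at x) (axis i 1)"

(* A list of coordinates plays the role of a multi-index: the entry i occurs alpha_i times.
   For smooth functions the order of the entries is irrelevant. *)
fun iter_partial :: "'n::finite list \<Rightarrow> (real^'n \<Rightarrow> complex) \<Rightarrow> real^'n \<Rightarrow> complex" where
  "iter_partial [] f = f"
| "iter_partial (i # is) f = partial_deriv i (iter_partial is f)"

(* Differentiability of all iterated partials also makes them all continuous, so this is
   C^infinity; it also ensures that frechet_derivative above is never applied outside its domain. *)
definition smooth :: "(real^'n::finite \<Rightarrow> complex) \<Rightarrow> bool" where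
  "smooth f \<longleftrightarrow> (\<forall>is x. iter_partial is f differentiable (at x))"

definition schwartz :: "(real^'n::finite \<Rightarrow> complex) set" where
  "schwartz = {f. smooth f \<and>
     (\<forall>k is. bdd_above (range (\<lambda>x. norm x ^ k * norm (iter_partial is f x))))}"

definition schwartz_seminorm :: "nat \<Rightarrow> 'n::finite list \<Rightarrow> (real^'n \<Rightarrow> complex) \<Rightarrow> real" where
  "schwartz_seminorm k is f = (SUP x. norm x ^ k * norm (iter_partial is f x))"

definition schwartz_topology :: "(real^'n::finite \<Rightarrow> complex) topology" where
  "schwartz_topology = topology_generated_by
     {{g \<in> schwartz. schwartz_seminorm k is (g - f) < \<epsilon>} | k is f \<epsilon>. f \<in> schwartz \<and> \<epsilon> > 0}"

section \<open>Tempered distributions\<close>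

type_synonym 'n distr = "(real^'n \<Rightarrow> complex) \<Rightarrow> complex"

(* Functionals are normalized to vanish off the Schwartz space, so that equality of
   distributions is equality of HOL functions. *)
definition tempered :: "('n::finite) distr set" where
  "tempered = {T.
     (\<forall>\<phi>\<in>schwartz. \<forall>\<psi>\<in>schwartz. T (\<lambda>x. \<phi> x + \<psi> x) = T \<phi> + T \<psi>) \<and>
     (\<forall>c. \<forall>\<phi>\<in>schwartz. T (\<lambda>x. c * \<phi> x) = c * T \<phi>) \<and>
     continuous_map schwartz_topology euclidean T \<and>
     (\<forall>\<phi>. \<phi> \<notin> schwartz \<longrightarrow> T \<phi> = 0)}"

definition fourier_fun :: "(real^'n::finite \<Rightarrow> complex) \<Rightarrow> real^'n \<Rightarrow> complex" where
  "fourier_fun f \<xi> = (LINT x|lborel. f x * exp (- 2 * of_real pi * \<i> * of_real (x \<bullet> \<xi>)))"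

definition inv_fourier_fun :: "(real^'n::finite \<Rightarrow> complex) \<Rightarrow> real^'n \<Rightarrow> complex" where
  "inv_fourier_fun f x = (LINT \<xi>|lborel. f \<xi> * exp (2 * of_real pi * \<i> * of_real (x \<bullet> \<xi>)))"

definition fourier :: "('n::finite) distr \<Rightarrow> 'n distr" where
  "fourier T = (\<lambda>\<phi>. if \<phi> \<in> schwartz then T (fourier_fun \<phi>) else 0)"

definition inv_fourier :: "('n::finite) distr \<Rightarrow> 'n distr" where
  "inv_fourier T = (\<lambda>\<phi>. if \<phi> \<in> schwartz then T (inv_fourier_fun \<phi>) else 0)"

(* Meaningful for multipliers m that map the Schwartz space into itself, such as the
   Bessel symbols below. *)
definition mult_distr :: "(real^'n::finite \<Rightarrow> complex) \<Rightarrow> 'n distr \<Rightarrow> 'n distr" where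
  "mult_distr m T = (\<lambda>\<phi>. if \<phi> \<in> schwartz then T (\<lambda>x. m x * \<phi> x) else 0)"

definition bessel_potential :: "complex \<Rightarrow> ('n::finite) distr \<Rightarrow> 'n distr" where
  "bessel_potential s T =
     inv_fourier (mult_distr (\<lambda>\<xi>. of_real (1 + 4 * pi\<^sup>2 * (norm \<xi>)\<^sup>2) powr (- s / 2)) (fourier T))"

section \<open>Lebesgue spaces inside the tempered distributions\<close>

(* Borel rather than Lebesgue measurable representatives: every Lebesgue measurable function
   agrees almost everywhere with a Borel one, so the same classes are obtained. *)
definition Lp :: "real \<Rightarrow> (real^'n::finite \<Rightarrow> complex) set" where
  "Lp p = {u \<in> borel_measurable lborel. integrable lborel (\<lambda>x. norm (u x) powr p)}"

definition Lp_norm :: "real \<Rightarrow> (real^'n::finite \<Rightarrow> complex) \<Rightarrow> real" where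
  "Lp_norm p u = (LINT x|lborel. norm (u x) powr p) powr (1 / p)"

definition distr_of :: "(real^'n::finite \<Rightarrow> complex) \<Rightarrow> 'n distr" where
  "distr_of u = (\<lambda>\<phi>. if \<phi> \<in> schwartz then (LINT x|lborel. u x * \<phi> x) else 0)"

(* The representative is unique up to null sets, so the norms below do not depend on the
   choice. *)
definition Lp_rep :: "real \<Rightarrow> ('n::finite) distr \<Rightarrow> real^'n \<Rightarrow> complex" where
  "Lp_rep p T = (SOME u. u \<in> Lp p \<and> distr_of u = T)"

section \<open>Bessel potential spaces and Gagliardo spaces\<close>

definition bessel_space :: "real \<Rightarrow> real \<Rightarrow> ('n::finite) distr set" where
  "bessel_space s p = {T \<in> tempered. bessel_potential (- of_real s) T \<in> distr_of ` Lp p}"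

definition bessel_norm :: "real \<Rightarrow> real \<Rightarrow> ('n::finite) distr \<Rightarrow> real" where
  "bessel_norm s p T = Lp_norm p (Lp_rep p (bessel_potential (- of_real s) T))"

definition gagliardo_integral :: "real \<Rightarrow> real \<Rightarrow> (real^'n::finite \<Rightarrow> complex) \<Rightarrow> ennreal" where
  "gagliardo_integral s p u =
     (\<integral>\<^sup>+x. \<integral>\<^sup>+y. ennreal (norm (u x - u y) powr p / norm (x - y) powr (real CARD('n) + s * p))
        \<partial>lborel \<partial>lborel)"

definition gagliardo_seminorm :: "real \<Rightarrow> real \<Rightarrow> (real^'n::finite \<Rightarrow> complex) \<Rightarrow> real" where
  "gagliardo_seminorm s p u = enn2real (gagliardo_integral s p u) powr (1 / p)"

(* Elements of L^p are identified with the tempered distributions they induce, so that both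
   scales of spaces consist of the same kind of objects. *)
definition gagliardo_space :: "real \<Rightarrow> real \<Rightarrow> ('n::finite) distr set" where
  "gagliardo_space s p = distr_of ` {u \<in> Lp p. gagliardo_integral s p u < \<infinity>}"

definition gagliardo_norm :: "real \<Rightarrow> real \<Rightarrow> ('n::finite) distr \<Rightarrow> real" where
  "gagliardo_norm s p T = Lp_norm p (Lp_rep p T) + gagliardo_seminorm s p (Lp_rep p T)"

section \<open>Continuous inclusion of normed spaces\<close>

definition continuously_included ::
  "('n::finite) distr set \<Rightarrow> ('n distr \<Rightarrow> real) \<Rightarrow> 'n distr set \<Rightarrow> ('n distr \<Rightarrow> real) \<Rightarrow> bool" where
  "continuously_included X NX Y NY \<longleftrightarrow> X \<subseteq> Y \<and>
     (\<forall>f\<in>X. \<forall>\<epsilon>>0. \<exists>\<delta>>0. \<forall>g\<in>X. NX (g - f) < \<delta> \<longrightarrow> NY (g - f) < \<epsilon>)"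

end

theory Submission
  imports Defs "HOL-Probability.Probability"
begin

text \<open>
  Both inclusions rest on one family of kernels, obtained by integrating the heat kernel
  \<open>p\<^sub>t\<close> in time: \<open>K\<^sub>s(h) = \<integral> t\<^bsup>s/2-1\<^esup> e\<^bsup>-t\<^esup> p\<^sub>t(h) dt\<close> over \<open>t > 0\<close>, for every real \<open>s\<close> and \<open>h \<noteq> 0\<close>
  (\<open>bessel_kernel\<close>).

  For \<open>s > 0\<close> the kernel is integrable, and by the Gamma integral its Fourier transform is
  \<open>\<Gamma>(s/2)\<close> times the symbol of the Bessel potential of order \<open>s\<close>. Hence an element of the Bessel
  space of order \<open>s\<^sub>1\<close> is \<open>u = c K * g\<close> with \<open>g \<in> L\<^sup>p\<close>. Two heat kernels at distance \<open>|h|\<close> differ by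
  at most \<open>3|h|/\<surd>t\<close> in \<open>L\<^sup>1\<close>, so \<open>K(\<sqdot> + h) - K\<close> has \<open>L\<^sup>1\<close> norm \<open>O(|h|\<^bsup>\<sigma>\<^esup>)\<close> for each
  \<open>0 \<le> \<sigma> < s\<^sub>1\<close>. Young's inequality carries this over to the \<open>L\<^sup>p\<close> norm of \<open>u(\<sqdot> + h) - u\<close>. Taking
  \<open>\<sigma> > s\<close> for small \<open>h\<close> and \<open>\<sigma> = 0\<close> for large \<open>h\<close> makes the Gagliardo integral of order \<open>s\<close>
  converge (\<open>bessel_potential_gagliardo\<close>).

  In orders between \<open>-1\<close> and \<open>0\<close> the kernel is a Levy density, and the symbol of positive order has the
  Levy-Khintchine form \<open>(1 + 4\<pi>\<^sup>2|\<xi>|\<^sup>2)\<^bsup>a\<^esup> = 1 + c \<integral> K(h) (1 - e\<^bsup>2\<pi>ih\<sqdot>\<xi>\<^esup>) dh\<close>, where \<open>K\<close> has order \<open>-2a\<close>.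
  So the Bessel potential of order \<open>-s\<^sub>0\<close> of \<open>u\<close> is \<open>u + c \<integral> K(h) (u - u(\<sqdot> + h)) dh\<close>. Since
  \<open>K(h) = O(|h|\<^bsup>-n-s\<^esup>)\<close> while \<open>K(h)|h|\<^bsup>s\<^esup>\<close> is integrable for \<open>s > s\<^sub>0\<close>, Jensen's inequality for the
  measure \<open>K(h)|h|\<^bsup>s\<^esup> dh\<close> bounds the \<open>L\<^sup>p\<close> norm of the integral by the Gagliardo seminorm of order
  \<open>s\<close> (\<open>Lp_int_hypersingular_le\<close>).

  Both representations are first computed on Schwartz functions and then moved to \<open>u\<close> by duality
  (\<open>conv_pairing\<close>, \<open>hypersingular_symmetric\<close>). This requires that the Fourier transform and
  powers of the symbol preserve the Schwartz space, the inversion formula, and that a function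
  in \<open>L\<^sup>p\<close> is determined almost everywhere by its distribution. The last fact also makes the two
  norms independent of the chosen representative. All estimates are linear, so boundedness
  gives continuity.
\<close>

section \<open>Schwartz functions\<close>

definition decays :: "(real^'n::finite \<Rightarrow> complex) \<Rightarrow> bool" where
  "decays f \<longleftrightarrow> (\<forall>k. \<exists>C. \<forall>x. norm x ^ k * norm (f x) \<le> C)"

lemma decays_add:
  assumes "decays f" "decays g" shows "decays (\<lambda>x. f x + g x)"
  unfolding decays_def
proof
  fix k
  obtain C D where C: "\<And>x. norm x ^ k * norm (f x) \<le> C" and D: "\<And>x. norm x ^ k * norm (g x) \<le> D"
    using assms unfolding decays_def by meson
  have "norm x ^ k * norm (f x + g x) \<le> C + D" for x
  proof -
    have "norm x ^ k * norm (f x + g x) \<le> norm x ^ k * (norm (f x) + norm (g x))"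
      by (intro mult_left_mono norm_triangle_ineq) auto
    with C[of x] D[of x] show ?thesis by (simp add: distrib_left)
  qed
  then show "\<exists>C. \<forall>x. norm x ^ k * norm (f x + g x) \<le> C" by blast
qed

lemma one_plus_power_mult_le:
  fixes a b :: real
  assumes "0 \<le> a" "0 \<le> b"
  shows "(1 + a) ^ k * b \<le> 2 ^ k * (a ^ 0 * b + a ^ k * b)"
proof -
  have "(1 + a) ^ k \<le> (2 * max 1 a) ^ k" using assms by (intro power_mono) auto
  also have "\<dots> \<le> 2 ^ k * (1 + a ^ k)" using assms by (auto simp: power_mult_distrib max_def)
  finally have "(1 + a) ^ k * b \<le> 2 ^ k * (1 + a ^ k) * b" using assms by (intro mult_right_mono)
  then show ?thesis by (simp add: algebra_simps)
qed

lemma decays_weighted: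
  assumes "decays f"
  obtains C where "C \<ge> 0" "\<And>x. (1 + norm x) ^ k * norm (f x) \<le> C"
proof -
  obtain C D where C: "\<And>x. norm x ^ k * norm (f x) \<le> C" and D: "\<And>x. norm x ^ 0 * norm (f x) \<le> D"
    using assms unfolding decays_def by meson
  have "(1 + norm x) ^ k * norm (f x) \<le> 2 ^ k * (D + C)" for x
  proof -
    have "(1 + norm x) ^ k * norm (f x) \<le> 2 ^ k * (norm x ^ 0 * norm (f x) + norm x ^ k * norm (f x))"
      by (rule one_plus_power_mult_le) auto
    also have "\<dots> \<le> 2 ^ k * (D + C)" using C[of x] D[of x] by (intro mult_left_mono add_mono) auto
    finally show ?thesis .
  qed
  moreover have "0 \<le> 2 ^ k * (D + C)"
    by (rule order_trans[OF _ calculation[of 0]]) simp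
  ultimately show ?thesis by (intro that)
qed

lemma decays_polynomial_growth:
  assumes f: "decays f" and g: "\<And>x. norm (g x) \<le> C * (1 + norm x) ^ m * norm (f x)"
  shows "decays g"
  unfolding decays_def
proof
  fix k
  obtain D where D: "\<And>x. (1 + norm x) ^ (k + m) * norm (f x) \<le> D"
    using decays_weighted[OF f] by metis
  have "norm x ^ k * norm (g x) \<le> \<bar>C\<bar> * D" for x
  proof -
    have "norm x ^ k * norm (g x) \<le> (1 + norm x) ^ k * (\<bar>C\<bar> * (1 + norm x) ^ m * norm (f x))"
    proof (intro mult_mono power_mono)
      show "norm (g x) \<le> \<bar>C\<bar> * (1 + norm x) ^ m * norm (f x)"
        using g[of x] by (rule order_trans) (intro mult_right_mono, auto)
    qed auto
    also have "\<dots> = \<bar>C\<bar> * ((1 + norm x) ^ (k + m) * norm (f x))"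
      by (simp add: power_add algebra_simps)
    also have "\<dots> \<le> \<bar>C\<bar> * D" using D by (intro mult_left_mono) auto
    finally show ?thesis .
  qed
  then show "\<exists>C. \<forall>x. norm x ^ k * norm (g x) \<le> C" by blast
qed

lemma decays_iff_bdd_above:
  "decays f \<longleftrightarrow> (\<forall>k. bdd_above (range (\<lambda>x. norm x ^ k * norm (f x))))"
  unfolding decays_def bdd_above_def by auto

lemma partial_derivI:
  "(f has_derivative D) (at x) \<Longrightarrow> partial_deriv i f x = D (axis i 1)"
  unfolding partial_deriv_def by (simp add: frechet_derivative_at[symmetric])

lemma iter_partial_append: "iter_partial (is @ js) f = iter_partial is (iter_partial js f)"
  by (induction "is") auto

lemma schwartz_has_derivative:
  assumes "f \<in> schwartz"
  shows "(f has_derivative frechet_derivative f (at x)) (at x)"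
  using assms frechet_derivative_works unfolding schwartz_def smooth_def
  by (metis (mono_tags, lifting) iter_partial.simps(1) mem_Collect_eq)

lemma schwartz_decays: "f \<in> schwartz \<Longrightarrow> decays f"
  unfolding decays_iff_bdd_above schwartz_def mem_Collect_eq
  by (metis iter_partial.simps(1))

lemma schwartz_bounded:
  assumes "f \<in> schwartz" obtains B where "0 \<le> B" "\<And>x. norm (f x) \<le> B"
  using decays_weighted[OF schwartz_decays[OF assms], of 0] by auto

lemma schwartz_partial_deriv: 
  assumes "f \<in> schwartz" shows "partial_deriv i f \<in> schwartz"
proof -
  have "iter_partial is (partial_deriv i f) = iter_partial (is @ [i]) f" for "is"
    by (simp add: iter_partial_append)
  then show ?thesis using assms unfolding schwartz_def smooth_def by auto
qed

lemma schwartz_continuous: "f \<in> schwartz \<Longrightarrow> continuous_on UNIV f"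
  by (meson continuous_at_imp_continuous_on has_derivative_continuous schwartz_has_derivative)

lemma schwartz_measurable [measurable_dest]: "f \<in> schwartz \<Longrightarrow> f \<in> borel_measurable borel"
  using borel_measurable_continuous_onI schwartz_continuous by blast

lemma schwartz_has_partial_deriv:
  assumes "f \<in> schwartz"
  shows "((\<lambda>t. f (x + t *\<^sub>R axis i 1)) has_vector_derivative partial_deriv i f (x + t *\<^sub>R axis i 1)) (at t)"
proof -
  have D: "(f has_derivative frechet_derivative f (at (x + t *\<^sub>R axis i 1))) (at (x + t *\<^sub>R axis i 1))"
    by (rule schwartz_has_derivative[OF assms])
  have "((\<lambda>t. f (x + t *\<^sub>R axis i 1)) has_derivative 
     (\<lambda>h. frechet_derivative f (at (x + t *\<^sub>R axis i 1)) (h *\<^sub>R axis i 1))) (at t)"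
    by (rule has_derivative_compose[of "\<lambda>t. x + t *\<^sub>R axis i 1" "\<lambda>h. h *\<^sub>R axis i 1" t UNIV f, OF _ D])
       (auto intro!: derivative_eq_intros)
  then show ?thesis
    using D unfolding has_vector_derivative_def partial_deriv_def
    by (simp add: linear_cmul has_derivative_linear)
qed

text \<open>Membership in the Schwartz space by coinduction. By the product rule a partial derivative of a
product is a sum of products, so a set of products is closed under derivatives only up to finite
sums. Those sums, represented by lists, form the invariant.\<close>

lemma schwartz_coinduct_sums:
  assumes diff: "\<And>g x. g \<in> A \<Longrightarrow> g differentiable (at x)"
    and dec: "\<And>g. g \<in> A \<Longrightarrow> decays g"
    and pd: "\<And>g i. g \<in> A \<Longrightarrow> \<exists>gs\<in>lists A. partial_deriv i g = (\<lambda>x. \<Sum>g\<leftarrow>gs. g x)"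
    and gs: "gs \<in> lists A"
  shows "(\<lambda>x. \<Sum>g\<leftarrow>gs. g x) \<in> schwartz"
proof -
  let ?S = "\<lambda>gs x. \<Sum>g\<leftarrow>gs. (g x :: complex)"
  have diffS: "?S gs differentiable (at x)" if "gs \<in> lists A" for gs x
    using that
  proof (induction gs)
    case (Cons a gs)
    then show ?case using diff[of a x] by (auto intro: differentiable_add)
  qed auto
  have decS: "decays (?S gs)" if "gs \<in> lists A" for gs
    using that
  proof (induction gs)
    case Nil
    then show ?case by (auto simp: decays_def)
  next
    case (Cons a gs)
    then show ?case using decays_add[of a "?S gs"] dec by simp
  qed
  have pdS: "\<exists>hs\<in>lists A. partial_deriv i (?S gs) = ?S hs" if "gs \<in> lists A" for gs i
    using that
  proof (induction gs)
    case Nil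
    have "partial_deriv i (?S []) = ?S []"
      by (auto intro!: ext partial_derivI)
    then show ?case by blast
  next
    case (Cons a gs)
    then obtain hs where hs: "hs \<in> lists A" "partial_deriv i (?S gs) = ?S hs" by auto
    obtain ks where ks: "ks \<in> lists A" "partial_deriv i a = ?S ks" using pd Cons by blast
    have "partial_deriv i (?S (a # gs)) = ?S (ks @ hs)"
    proof
      fix x
      have "(?S (a # gs) has_derivative (\<lambda>h. frechet_derivative a (at x) h + frechet_derivative (?S gs) (at x) h)) (at x)"
        using diff[of a x] diffS[of gs x] Cons.hyps Cons.prems
        by (auto intro!: has_derivative_add simp: frechet_derivative_works)
      from partial_derivI[OF this]
      have "partial_deriv i (?S (a # gs)) x = partial_deriv i a x + partial_deriv i (?S gs) x"
        by (simp add: partial_deriv_def)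
      then show "partial_deriv i (?S (a # gs)) x = ?S (ks @ hs) x" by (simp add: hs ks)
    qed
    then show ?case using hs ks by (metis append_in_lists_conv)
  qed
  have iter: "\<exists>hs\<in>lists A. iter_partial is (?S gs) = ?S hs" for "is"
  proof (induction "is")
    case Nil
    then show ?case using gs by auto
  next
    case (Cons a "is")
    then obtain hs where hs: "hs \<in> lists A" "iter_partial is (?S gs) = ?S hs" by blast
    then show ?case using pdS[OF hs(1)] by simp
  qed
  show ?thesis
    unfolding schwartz_def smooth_def
  proof (intro CollectI conjI allI)
    fix k "is" x
    obtain hs where hs: "hs \<in> lists A" "iter_partial is (?S gs) = ?S hs" using iter by blast
    show "iter_partial is (?S gs) differentiable (at x)" unfolding hs(2) by (rule diffS[OF hs(1)])
    show "bdd_above (range (\<lambda>x. norm x ^ k * norm (iter_partial is (?S gs) x)))"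
      using decS[OF hs(1)] unfolding hs(2) decays_iff_bdd_above by (rule spec)
  qed
qed

lemma schwartz_coinduct:
  assumes "f \<in> A" 
    and "\<And>g x. g \<in> A \<Longrightarrow> g differentiable (at x)"
    and "\<And>g. g \<in> A \<Longrightarrow> decays g"
    and "\<And>g i. g \<in> A \<Longrightarrow> \<exists>gs\<in>lists A. partial_deriv i g = (\<lambda>x. \<Sum>g\<leftarrow>gs. g x)"
  shows "f \<in> schwartz"
  using schwartz_coinduct_sums[of A "[f]"] assms by auto

lemma schwartz_differentiable: "f \<in> schwartz \<Longrightarrow> f differentiable (at x)"
  using schwartz_has_derivative differentiable_def by blast

lemma schwartz_add: 
  assumes "f \<in> schwartz" "g \<in> schwartz" shows "(\<lambda>x. f x + g x) \<in> schwartz"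
proof -
  have "(\<lambda>x. \<Sum>g\<leftarrow>[f, g]. g x) \<in> schwartz"
  proof (rule schwartz_coinduct_sums[of schwartz])
    fix g i assume "g \<in> (schwartz :: (real^'a \<Rightarrow> complex) set)"
    then show "\<exists>gs\<in>lists schwartz. partial_deriv i g = (\<lambda>x. \<Sum>g\<leftarrow>gs. g x)"
      by (intro bexI[of _ "[partial_deriv i g]"]) (simp_all add: schwartz_partial_deriv)
  qed (use assms in \<open>simp_all add: schwartz_differentiable schwartz_decays\<close>)
  then show ?thesis by simp
qed

lemma schwartz_cmult:
  assumes "f \<in> schwartz" shows "(\<lambda>x. c * f x) \<in> schwartz"
proof (rule schwartz_coinduct[of _ "{\<lambda>x. c * f x | f. f \<in> schwartz}"])
  show "(\<lambda>x. c * f x) \<in> {\<lambda>x. c * f x | f. f \<in> schwartz}" using assms by blast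
next
  fix g x assume "g \<in> {\<lambda>x::real^'a. c * f x | f. f \<in> schwartz}"
  then obtain f where f: "f \<in> schwartz" "g = (\<lambda>x. c * f x)" by auto
  show "g differentiable (at x)"
    unfolding f using has_derivative_mult_right[OF schwartz_has_derivative[OF f(1)]] differentiable_def by blast
next
  fix g assume "g \<in> {\<lambda>x::real^'a. c * f x | f. f \<in> schwartz}"
  then obtain f where f: "f \<in> schwartz" "g = (\<lambda>x. c * f x)" by auto
  show "decays g"
    by (rule decays_polynomial_growth[OF schwartz_decays[OF f(1)], of _ "norm c" 0])
       (simp add: f(2) norm_mult)
next
  fix g i assume "g \<in> {\<lambda>x::real^'a. c * f x | f. f \<in> schwartz}"
  then obtain f where f: "f \<in> schwartz" "g = (\<lambda>x. c * f x)" by auto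
  have "partial_deriv i g = (\<lambda>x. c * partial_deriv i f x)"
    unfolding f(2)
  proof
    fix x show "partial_deriv i (\<lambda>x. c * f x) x = c * partial_deriv i f x"
      using partial_derivI[OF has_derivative_mult_right[OF schwartz_has_derivative[OF f(1)]]]
      by (simp add: partial_deriv_def)
  qed
  moreover have "(\<lambda>x. c * partial_deriv i f x) \<in> {\<lambda>x. c * f x |f. f \<in> schwartz}"
    using schwartz_partial_deriv[OF f(1)] by blast
  ultimately show "\<exists>gs\<in>lists {\<lambda>x. c * f x |f. f \<in> schwartz}. partial_deriv i g = (\<lambda>x. \<Sum>g\<leftarrow>gs. g x)"
    by (intro bexI[of _ "[\<lambda>x. c * partial_deriv i f x]"]) simp_all
qed

lemma real_polynomial_has_derivative:
  assumes "real_polynomial_function (p :: real^'n \<Rightarrow> real)"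
  obtains D where "\<And>x. (p has_derivative D x) (at x)" 
    "\<And>h. real_polynomial_function (\<lambda>x. D x h)"
proof -
  have "\<exists>D. (\<forall>x. (p has_derivative D x) (at x)) \<and> (\<forall>h. real_polynomial_function (\<lambda>x. D x h))"
    using assms
  proof induction
    case (linear f)
    then show ?case
      by (intro exI[of _ "\<lambda>x. f"]) (auto intro: bounded_linear_imp_has_derivative)
  next
    case (const c)
    then show ?case by (intro exI[of _ "\<lambda>x h. 0"]) auto
  next
    case (add f g)
    then obtain D E where "\<forall>x. (f has_derivative D x) (at x)" "\<forall>h. real_polynomial_function (\<lambda>x. D x h)"
      "\<forall>x. (g has_derivative E x) (at x)" "\<forall>h. real_polynomial_function (\<lambda>x. E x h)" by auto
    then show ?case
      by (intro exI[of _ "\<lambda>x h. D x h + E x h"]) (intro conjI allI has_derivative_add real_polynomial_function.intros(3); simp)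
  next
    case (mult f g)
    then obtain D E where "\<forall>x. (f has_derivative D x) (at x)" "\<forall>h. real_polynomial_function (\<lambda>x. D x h)"
      "\<forall>x. (g has_derivative E x) (at x)" "\<forall>h. real_polynomial_function (\<lambda>x. E x h)" by auto
    then show ?case using mult.hyps
      by (intro exI[of _ "\<lambda>x h. f x * E x h + D x h * g x"]) (intro conjI allI has_derivative_mult real_polynomial_function.intros(3,4); simp del: mult_eq_0_iff)
  qed
  then show ?thesis using that by blast
qed

lemma real_polynomial_growth:
  assumes "real_polynomial_function (p :: 'a::real_normed_vector \<Rightarrow> real)"
  obtains C m where "\<And>x. \<bar>p x\<bar> \<le> C * (1 + norm x) ^ m"
proof -
  have "\<exists>C m. 0 \<le> C \<and> (\<forall>x. \<bar>p x\<bar> \<le> C * (1 + norm x) ^ m)"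
    using assms
  proof induction
    case (linear f)
    then obtain K where "K > 0" "\<And>x. norm (f x) \<le> norm x * K" using bounded_linear.pos_bounded by blast
    then show ?case 
      by (intro exI[of _ K] exI[of _ 1]) (simp add: distrib_left add_increasing mult.commute)
  next
    case (const c)
    then show ?case by (intro exI[of _ "\<bar>c\<bar>"] exI[of _ 0]) auto
  next
    case (add f g)
    then obtain C m D n where C: "0 \<le> C" "\<And>x. \<bar>f x\<bar> \<le> C * (1 + norm x) ^ m"
       "0 \<le> D" "\<And>x. \<bar>g x\<bar> \<le> D * (1 + norm x) ^ n" by metis
    have "\<bar>f x + g x\<bar> \<le> (C + D) * (1 + norm x) ^ (m + n)" for x
    proof -
      have "C * (1 + norm x) ^ m \<le> C * (1 + norm x) ^ (m + n)" "D * (1 + norm x) ^ n \<le> D * (1 + norm x) ^ (m + n)"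
        using C by (intro mult_left_mono power_increasing; simp)+
      with C(2)[of x] C(4)[of x] show ?thesis by (simp add: algebra_simps)
    qed
    then show ?case using C by (meson add_nonneg_nonneg)
  next
    case (mult f g)
    then obtain C m D n where C: "0 \<le> C" "\<And>x. \<bar>f x\<bar> \<le> C * (1 + norm x) ^ m"
       "0 \<le> D" "\<And>x. \<bar>g x\<bar> \<le> D * (1 + norm x) ^ n" by metis
    have "\<bar>f x * g x\<bar> \<le> (C * D) * (1 + norm x) ^ (m + n)" for x
    proof -
      have "\<bar>f x\<bar> * \<bar>g x\<bar> \<le> (C * (1 + norm x) ^ m) * (D * (1 + norm x) ^ n)"
        using C by (intro mult_mono) auto
      then show ?thesis by (simp add: algebra_simps power_add abs_mult)
    qed
    then show ?case using C by (meson mult_nonneg_nonneg)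
  qed
  then show ?thesis using that by blast
qed

lemma has_derivative_of_real_mult:
  fixes p :: "'a::real_normed_vector \<Rightarrow> real" and f :: "'a \<Rightarrow> complex"
  assumes "(p has_derivative D) (at x)" "(f has_derivative E) (at x)"
  shows "((\<lambda>x. of_real (p x) * f x) has_derivative (\<lambda>h. of_real (p x) * E h + of_real (D h) * f x)) (at x)"
  by (intro has_derivative_mult has_derivative_of_real assms)

text \<open>The pattern shared by multiplication with polynomials and with powers of the Bessel symbol: the
derivative of a multiplier is again a multiplier, up to a factor that the second component
absorbs.\<close>

lemma schwartz_mult_closed:
  fixes P :: "(real^'n::finite \<Rightarrow> real) set"
  assumes diff: "\<And>p. p \<in> P \<Longrightarrow> \<exists>D. (\<forall>x. (p has_derivative D x) (at x)) \<and> 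
       (\<forall>h. \<exists>q\<in>P. \<exists>r. (\<forall>f\<in>B. (\<lambda>x. of_real (r x) * f x) \<in> B) \<and> (\<forall>x. D x h = r x * q x))"
    and growth: "\<And>p. p \<in> P \<Longrightarrow> \<exists>C m. \<forall>x. \<bar>p x\<bar> \<le> C * (1 + norm x) ^ m"
    and B: "\<And>f i. f \<in> B \<Longrightarrow> \<exists>fs\<in>lists B. partial_deriv i f = (\<lambda>x. \<Sum>g\<leftarrow>fs. g x)"
     "\<And>f. f \<in> B \<Longrightarrow> decays f"
     "\<And>f x. f \<in> B \<Longrightarrow> f differentiable (at x)"
    and p: "p \<in> P" and f: "f \<in> B"
  shows "(\<lambda>x. of_real (p x) * f x) \<in> schwartz"
proof (rule schwartz_coinduct[of _ "{\<lambda>x. of_real (p x) * f x | p f. p \<in> P \<and> f \<in> B}"])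
  let ?A = "{\<lambda>x. of_real (p x) * f x | p f. p \<in> P \<and> f \<in> B}"
  show "(\<lambda>x. of_real (p x) * f x) \<in> ?A" using p f by blast
  fix g assume "g \<in> ?A"
  then obtain p f where g: "g = (\<lambda>x. of_real (p x) * f x)" and p: "p \<in> P" and f: "f \<in> B" by auto
  obtain D where D: "\<And>x. (p has_derivative D x) (at x)" 
    "\<And>h. \<exists>q\<in>P. \<exists>r. (\<forall>f\<in>B. (\<lambda>x. of_real (r x) * f x) \<in> B) \<and> (\<forall>x. D x h = r x * q x)" using diff[OF p] by blast
  have f': "(f has_derivative frechet_derivative f (at x)) (at x)" for x
    using B(3)[OF f] by (simp add: frechet_derivative_works)
  have gD: "(g has_derivative (\<lambda>h. of_real (p x) * frechet_derivative f (at x) h + of_real (D x h) * f x)) (at x)" for x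
    unfolding g by (intro has_derivative_of_real_mult D f')
  show "g differentiable (at x)" for x using gD differentiable_def by blast
  obtain C m where C: "\<And>x. \<bar>p x\<bar> \<le> C * (1 + norm x) ^ m" using growth[OF p] by metis
  show "decays g"
    by (rule decays_polynomial_growth[OF B(2)[OF f], of _ C m])
       (auto simp: g norm_mult intro!: mult_right_mono C)
  fix i
  obtain q r where q: "q \<in> P" "\<And>f. f \<in> B \<Longrightarrow> (\<lambda>x. of_real (r x) * f x) \<in> B" "\<And>x. D x (axis i 1) = r x * q x"
    using D(2)[of "axis i 1"] by blast
  obtain fs where fs: "fs \<in> lists B" "partial_deriv i f = (\<lambda>x. \<Sum>g\<leftarrow>fs. g x)" using B(1)[OF f] by blast
  let ?gs = "(\<lambda>x. of_real (q x) * (of_real (r x) * f x)) # map (\<lambda>f x. of_real (p x) * f x) fs"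
  have "partial_deriv i g = (\<lambda>x. \<Sum>g\<leftarrow>?gs. g x)"
  proof
    fix x
    have "partial_deriv i g x = of_real (p x) * partial_deriv i f x + of_real (r x * q x) * f x"
      using partial_derivI[OF gD[of x]] q(3) by (simp add: partial_deriv_def)
    then show "partial_deriv i g x = (\<Sum>g\<leftarrow>?gs. g x)"
      by (simp add: fs(2) sum_list_const_mult[symmetric] o_def algebra_simps)
  qed
  moreover have "?gs \<in> lists ?A"
  proof -
    have "(\<lambda>x. of_real (q x) * (of_real (r x) * f x)) \<in> ?A"
      by (rule CollectI, rule exI[of _ q], rule exI[of _ "\<lambda>x. of_real (r x) * f x"], intro conjI q(1) q(2)[OF f] refl)
    moreover have "(\<lambda>x. of_real (p x) * f x) \<in> ?A" if "f \<in> set fs" for f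
      using fs(1) p that by (intro CollectI exI[of _ p] exI[of _ f]) auto
    ultimately show ?thesis unfolding in_lists_conv_set by (simp only: list.set set_map) blast
  qed
  ultimately show "\<exists>gs\<in>lists ?A. partial_deriv i g = (\<lambda>x. \<Sum>g\<leftarrow>gs. g x)" by blast
qed

lemma schwartz_real_polynomial_mult:
  assumes "real_polynomial_function p" "f \<in> schwartz"
  shows "(\<lambda>x. of_real (p x) * f x) \<in> schwartz"
proof (rule schwartz_mult_closed[of "Collect real_polynomial_function" schwartz])
  fix p :: "real^'a \<Rightarrow> real" assume "p \<in> Collect real_polynomial_function"
  then have p: "real_polynomial_function p" by simp
  obtain D where D: "\<And>x. (p has_derivative D x) (at x)" "\<And>h. real_polynomial_function (\<lambda>x. D x h)"
    using real_polynomial_has_derivative[OF p] by metis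
  show "\<exists>D. (\<forall>x. (p has_derivative D x) (at x)) \<and> 
       (\<forall>h. \<exists>q\<in>Collect real_polynomial_function. \<exists>r. (\<forall>f\<in>schwartz. (\<lambda>x. of_real (r x) * f x) \<in> schwartz) \<and> (\<forall>x. D x h = r x * q x))"
  proof (intro exI[of _ D] conjI allI)
    fix h
    show "\<exists>q\<in>Collect real_polynomial_function. \<exists>r. (\<forall>f\<in>schwartz. (\<lambda>x. of_real (r x) * f x) \<in> schwartz) \<and> (\<forall>x. D x h = r x * q x)"
      using D(2)[of h] by (intro bexI[of _ "\<lambda>x. D x h"] exI[of _ "\<lambda>x. 1"]) auto
  qed (rule D(1))
  show "\<exists>C m. \<forall>x. \<bar>p x\<bar> \<le> C * (1 + norm x) ^ m"
    using real_polynomial_growth[OF p] by metis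
next
  fix f :: "real^'a \<Rightarrow> complex" and i assume "f \<in> schwartz"
  then show "\<exists>fs\<in>lists schwartz. partial_deriv i f = (\<lambda>x. \<Sum>g\<leftarrow>fs. g x)"
    by (intro bexI[of _ "[partial_deriv i f]"]) (simp_all add: schwartz_partial_deriv)
qed (use assms in \<open>simp_all add: schwartz_differentiable schwartz_decays\<close>)

lemma real_polynomial_function_nth: "real_polynomial_function (\<lambda>x::real^'n. x $ i)"
  by (intro real_polynomial_function.intros(1) bounded_linear_vec_nth)

lemma real_polynomial_function_inner: "real_polynomial_function (\<lambda>x::real^'n. b \<bullet> x)"
  by (intro real_polynomial_function.intros(1) bounded_linear_inner_right)

lemma schwartz_nth_mult: "f \<in> schwartz \<Longrightarrow> (\<lambda>x. of_real (x $ i) * f x) \<in> schwartz"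
  by (rule schwartz_real_polynomial_mult[OF real_polynomial_function_nth])

text \<open>The square of the Japanese bracket of \<open>2\<pi>\<xi>\<close>. The Bessel potential of order \<open>s\<close> is the Fourier
multiplier with its power \<open>-s/2\<close>.\<close>

definition bracket_sq :: "real^'n::finite \<Rightarrow> real" where
  "bracket_sq \<xi> = 1 + 4 * pi\<^sup>2 * (norm \<xi>)\<^sup>2"

lemma bracket_sq_ge_1: "1 \<le> bracket_sq \<xi>" and bracket_sq_pos: "0 < bracket_sq \<xi>"
  unfolding bracket_sq_def by (simp_all add: add_pos_nonneg)

lemma bracket_sq_powr_has_derivative:
  "((\<lambda>x. bracket_sq x powr r) has_derivative (\<lambda>h. (8 * pi\<^sup>2 * r * (x \<bullet> h)) * bracket_sq x powr (r - 1))) (at x)"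
proof -
  have "(bracket_sq has_derivative (\<lambda>h. 8 * pi\<^sup>2 * (x \<bullet> h))) (at x)"
    unfolding bracket_sq_def power2_norm_eq_inner
    by (auto intro!: derivative_eq_intros simp: inner_commute fun_eq_iff)
  from has_derivative_powr[OF this has_derivative_const[of r]] bracket_sq_pos[of x] show ?thesis
    by (rule_tac has_derivative_eq_rhs) (auto simp: fun_eq_iff powr_diff field_simps)
qed

lemma bracket_sq_powr_growth:
  obtains C m where "\<And>x. bracket_sq x powr r \<le> C * (1 + norm x) ^ m"
proof -
  obtain m where m: "r \<le> real m" using real_arch_simple by blast
  have "bracket_sq x powr r \<le> (1 + 4 * pi\<^sup>2) ^ m * (1 + norm x) ^ (2 * m)" for x
  proof -
    have "bracket_sq x \<le> (1 + 4 * pi\<^sup>2) * (1 + norm x)\<^sup>2"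
      unfolding bracket_sq_def by (simp add: power2_eq_square algebra_simps add_nonneg_nonneg)
    then have "bracket_sq x ^ m \<le> ((1 + 4 * pi\<^sup>2) * (1 + norm x)\<^sup>2) ^ m"
      using bracket_sq_pos[of x] by (intro power_mono) auto
    moreover have "bracket_sq x powr r \<le> bracket_sq x ^ m"
      using powr_mono[OF m bracket_sq_ge_1[of x]] bracket_sq_pos[of x] by (simp add: powr_realpow)
    ultimately show ?thesis by (simp add: power_mult_distrib power_mult)
  qed
  then show ?thesis by (rule that)
qed

lemma schwartz_bracket_sq_mult:
  assumes "f \<in> schwartz"
  shows "(\<lambda>x. of_real (bracket_sq x powr r) * f x) \<in> schwartz"
proof (rule schwartz_mult_closed[of "range (\<lambda>r x. bracket_sq x powr r)" schwartz])
  fix p :: "real^'a \<Rightarrow> real" assume "p \<in> range (\<lambda>r x. bracket_sq x powr r)"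
  then obtain r where p: "p = (\<lambda>x. bracket_sq x powr r)" by auto
  let ?D = "\<lambda>x h. (8 * pi\<^sup>2 * r * (x \<bullet> h)) * bracket_sq x powr (r - 1)"
  show "\<exists>D. (\<forall>x. (p has_derivative D x) (at x)) \<and> 
       (\<forall>h. \<exists>q\<in>range (\<lambda>r x. bracket_sq x powr r). \<exists>r. (\<forall>f\<in>schwartz. (\<lambda>x. of_real (r x) * f x) \<in> schwartz) \<and> (\<forall>x. D x h = r x * q x))"
  proof (intro exI[of _ ?D] conjI allI)
    fix h :: "real^'a"
    have "real_polynomial_function (\<lambda>x. 8 * pi\<^sup>2 * r * (x \<bullet> h))"
      using real_polynomial_function.intros(4)[OF real_polynomial_function.intros(2) real_polynomial_function_inner[of h]]
      by (simp add: inner_commute)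
    from schwartz_real_polynomial_mult[OF this]
    show "\<exists>q\<in>range (\<lambda>r x. bracket_sq x powr r). \<exists>r. (\<forall>f\<in>schwartz. (\<lambda>x. of_real (r x) * f x) \<in> schwartz) \<and> (\<forall>x. ?D x h = r x * q x)"
      by (intro bexI[of _ "\<lambda>x. bracket_sq x powr (r - 1)"] exI[of _ "\<lambda>x. 8 * pi\<^sup>2 * r * (x \<bullet> h)"]) auto
  qed (unfold p, rule bracket_sq_powr_has_derivative)
  show "\<exists>C m. \<forall>x. \<bar>p x\<bar> \<le> C * (1 + norm x) ^ m"
    using bracket_sq_powr_growth[of r] unfolding p by (metis abs_of_nonneg powr_ge_zero)
next
  fix f :: "real^'a \<Rightarrow> complex" and i assume "f \<in> schwartz"
  then show "\<exists>fs\<in>lists schwartz. partial_deriv i f = (\<lambda>x. \<Sum>g\<leftarrow>fs. g x)"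
    by (intro bexI[of _ "[partial_deriv i f]"]) (simp_all add: schwartz_partial_deriv)
qed (use assms in \<open>simp_all add: schwartz_differentiable schwartz_decays\<close>)

text \<open>With a linear term, the family contains the translates of every Gaussian, up to constants, and
is closed under products.\<close>

definition gauss_exp :: "real \<Rightarrow> real^'n \<Rightarrow> real^'n::finite \<Rightarrow> real" where
  "gauss_exp a b x = exp (b \<bullet> x - a * (norm x)\<^sup>2)"

lemma gauss_exp_has_derivative:
  "(gauss_exp a b has_derivative (\<lambda>h. (b \<bullet> h - 2 * a * (x \<bullet> h)) * gauss_exp a b x)) (at x)"
  unfolding gauss_exp_def power2_norm_eq_inner
  by (auto intro!: derivative_eq_intros simp: inner_commute fun_eq_iff)

lemma exp_ge_power_div_fact:
  fixes x :: real assumes "0 \<le> x" shows "x ^ k / fact k \<le> exp x"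
proof -
  have "(\<Sum>i\<in>{k}. x ^ i /\<^sub>R fact i) \<le> (\<Sum>i. x ^ i /\<^sub>R fact i)"
    by (intro sum_le_suminf summable_exp_generic) (use assms in auto)
  then show ?thesis by (simp add: exp_def divide_inverse_commute)
qed

lemma decays_gauss_exp:
  assumes "a > 0" shows "decays (\<lambda>x. of_real (gauss_exp a b x))"
  unfolding decays_def
proof
  fix k
  define c where "c = a / 2"
  have c: "c > 0" "a = 2 * c" using assms by (auto simp: c_def)
  have "norm x ^ k * norm (complex_of_real (gauss_exp a b x)) \<le> (1 + fact k / c ^ k) * exp ((norm b)\<^sup>2 / (4 * c))" for x
  proof -
    let ?r = "norm x" and ?n = "norm b"
    define A E X where "A = 1 + fact k / c ^ k" and "E = exp (c * ?r\<^sup>2)" and "X = exp (?n\<^sup>2 / (4 * c))"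
    \<comment> \<open>Half of the quadratic term absorbs the linear one; the other half gives the decay.\<close>
    have "0 \<le> (?n / (2 * sqrt c) - sqrt c * ?r)\<^sup>2" by simp
    also have "\<dots> = ?n\<^sup>2 / (4 * c) - ?n * ?r + c * ?r\<^sup>2"
      using c by (simp add: power2_diff power_mult_distrib power_divide)
    finally have "b \<bullet> x - a * ?r\<^sup>2 \<le> ?n\<^sup>2 / (4 * c) - c * ?r\<^sup>2"
      using norm_cauchy_schwarz[of b x] c by simp
    then have g: "gauss_exp a b x \<le> exp (?n\<^sup>2 / (4 * c)) / exp (c * ?r\<^sup>2)"
      unfolding gauss_exp_def exp_diff[symmetric] by simp
    have "(c * ?r\<^sup>2) ^ k / fact k \<le> exp (c * ?r\<^sup>2)"
      using c by (intro exp_ge_power_div_fact) auto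
    then have r2k: "?r ^ (2 * k) \<le> fact k / c ^ k * exp (c * ?r\<^sup>2)"
    proof -
      have "(c * ?r\<^sup>2) ^ k = c ^ k * ?r ^ (2 * k)" by (simp only: power_mult_distrib power_mult)
      then have "c ^ k * ?r ^ (2 * k) / fact k \<le> exp (c * ?r\<^sup>2)"
        using \<open>(c * ?r\<^sup>2) ^ k / fact k \<le> exp (c * ?r\<^sup>2)\<close> by (simp only:)
      then have "c ^ k * ?r ^ (2 * k) \<le> exp (c * ?r\<^sup>2) * fact k"
        by (simp only: pos_divide_le_eq[OF fact_gt_zero])
      then have "?r ^ (2 * k) \<le> (exp (c * ?r\<^sup>2) * fact k) / c ^ k"
        unfolding pos_le_divide_eq[OF zero_less_power[OF c(1)]] by (simp only: mult.commute)
      then show ?thesis by (simp only: mult.commute times_divide_eq_left)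
    qed
    have "?r ^ k \<le> 1 + ?r ^ (2 * k)"
    proof (cases "?r \<le> 1")
      case True then show ?thesis using power_le_one[of ?r k] by (simp add: add_increasing2)
    next
      case False
      then have "?r ^ k \<le> ?r ^ (2 * k)" by (intro power_increasing) auto
      then show ?thesis by linarith
    qed
    moreover have "1 \<le> E" using c(1) unfolding E_def by simp
    ultimately have "?r ^ k \<le> A * E"
      using r2k unfolding A_def E_def distrib_right by linarith
    moreover have "gauss_exp a b x \<le> X / E" using g by (simp add: E_def X_def)
    moreover have A: "0 \<le> A" unfolding A_def using c(1) by simp
    moreover have E: "0 < E" unfolding E_def by simp
    ultimately have "?r ^ k * gauss_exp a b x \<le> (A * E) * (X / E)"
      by (rule_tac mult_mono) (simp_all add: gauss_exp_def del: abs_exp_cancel)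
    also have "\<dots> = A * X" using E by simp
    finally show ?thesis by (simp add: A_def X_def gauss_exp_def)
  qed
  then show "\<exists>C. \<forall>x. norm x ^ k * norm (complex_of_real (gauss_exp a b x)) \<le> C" by blast
qed

lemma schwartz_gauss_exp:
  assumes a: "a > 0" shows "(\<lambda>x. of_real (gauss_exp a b x)) \<in> schwartz"
proof (rule schwartz_coinduct[of _ "{\<lambda>x. of_real (p x * gauss_exp a b x) | p. real_polynomial_function p}"])
  let ?A = "{\<lambda>x. complex_of_real (p x * gauss_exp a b x) | p. real_polynomial_function p}"
  show "(\<lambda>x. of_real (gauss_exp a b x)) \<in> ?A"
    by (auto intro!: exI[of _ "\<lambda>x. 1"] real_polynomial_function.intros(2))
  fix g assume "g \<in> ?A"
  then obtain p where p: "real_polynomial_function p" and g: "g = (\<lambda>x. of_real (p x * gauss_exp a b x))" by auto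
  obtain D where D: "\<And>x. (p has_derivative D x) (at x)" "\<And>h. real_polynomial_function (\<lambda>x. D x h)"
    using real_polynomial_has_derivative[OF p] by metis
  let ?P = "\<lambda>h x. p x * (b \<bullet> h - 2 * a * (x \<bullet> h)) + D x h"
  have gD: "(g has_derivative (\<lambda>h. of_real (?P h x * gauss_exp a b x))) (at x)" for x
    unfolding g 
    by (intro has_derivative_of_real has_derivative_eq_rhs[OF has_derivative_mult[OF D(1) gauss_exp_has_derivative]])
       (simp add: fun_eq_iff algebra_simps)
  show "g differentiable (at x)" for x using gD differentiable_def by blast
  obtain C m where C: "\<And>x. \<bar>p x\<bar> \<le> C * (1 + norm x) ^ m" using real_polynomial_growth[OF p] by metis
  show "decays g"
    by (rule decays_polynomial_growth[OF decays_gauss_exp[OF a], of _ C m b])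
       (auto simp: g norm_mult abs_mult intro!: mult_right_mono C)
  fix i
  have "real_polynomial_function (?P (axis i 1))"
  proof -
    have "real_polynomial_function (\<lambda>x. p x * (b \<bullet> axis i 1 + (- 2 * a) * (axis i 1 \<bullet> x)) + D x (axis i 1))"
      by (rule real_polynomial_function.intros(3)[OF real_polynomial_function.intros(4)[OF p
            real_polynomial_function.intros(3)[OF real_polynomial_function.intros(2)
            real_polynomial_function.intros(4)[OF real_polynomial_function.intros(2) real_polynomial_function_inner]]] D(2)])
    then show ?thesis by (simp add: inner_commute)
  qed
  then have "(\<lambda>x. of_real (?P (axis i 1) x * gauss_exp a b x)) \<in> ?A"
    by (intro CollectI exI[of _ "?P (axis i 1)"] conjI refl)
  moreover have "partial_deriv i g = (\<lambda>x. of_real (?P (axis i 1) x * gauss_exp a b x))"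
    by (rule ext) (rule partial_derivI[OF gD])
  ultimately show "\<exists>gs\<in>lists ?A. partial_deriv i g = (\<lambda>x. \<Sum>g\<leftarrow>gs. g x)"
    by (intro bexI[of _ "[\<lambda>x. of_real (?P (axis i 1) x * gauss_exp a b x)]"]) simp_all
qed

section \<open>Translation and integrability\<close>

lemma nn_integral_shift:
  fixes a :: "'a::euclidean_space"
  assumes [measurable]: "f \<in> borel_measurable borel"
  shows "(\<integral>\<^sup>+x. f (x + a) \<partial>lborel) = (\<integral>\<^sup>+x. f x \<partial>lborel)"
  by (subst (2) lborel_distr_plus[symmetric, of a]) (simp add: nn_integral_distr add.commute)

lemma integral_shift:
  fixes a :: "'a::euclidean_space" and f :: "_ \<Rightarrow> 'b::{banach, second_countable_topology}"
  assumes [measurable]: "f \<in> borel_measurable borel"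
  shows "(LINT x|lborel. f (x + a)) = (LINT x|lborel. f x)"
  by (subst (2) lborel_distr_plus[symmetric, of a]) (simp add: integral_distr add.commute)

lemma integrable_shift:
  fixes a :: "'a::euclidean_space" and f :: "_ \<Rightarrow> 'b::{banach, second_countable_topology}"
  assumes "integrable lborel f"
  shows "integrable lborel (\<lambda>x. f (x + a))"
proof -
  have [measurable]: "f \<in> borel_measurable borel" using assms by auto
  have "integrable (distr lborel borel ((+) a)) f" using assms by (simp add: lborel_distr_plus)
  then show ?thesis by (subst (asm) integrable_distr_eq) (simp_all add: add.commute)
qed

lemma lborel_distr_uminus_euclidean:
  "distr lborel borel uminus = (lborel :: 'a::euclidean_space measure)"
proof -
  have "(lborel :: 'a measure) = density (distr lborel borel (\<lambda>x. 0 + (-1) *\<^sub>R x)) (\<lambda>_. ennreal (\<bar>-1\<bar> ^ DIM('a)))"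
    using lborel_affine[of "-1" "0 :: 'a"] by simp
  also have "\<dots> = distr lborel borel uminus" by (simp add: density_1)
  finally show ?thesis by simp
qed

lemma integrable_dominated:
  fixes f :: "'a \<Rightarrow> 'b::{banach, second_countable_topology}" and g :: "'a \<Rightarrow> real"
  assumes "integrable M g" "f \<in> borel_measurable M" "\<And>x. norm (f x) \<le> g x"
  shows "integrable M f"
  by (rule Bochner_Integration.integrable_bound[OF assms(1,2)])
     (auto intro: order_trans[OF assms(3) abs_ge_self])

lemma integrable_pair_dominated:
  fixes f :: "'a \<Rightarrow> 'c \<Rightarrow> 'b::{banach, second_countable_topology}" and g :: "'a \<Rightarrow> 'c \<Rightarrow> real"
  assumes "integrable (M \<Otimes>\<^sub>M N) (\<lambda>(x, y). g x y)" "(\<lambda>(x, y). f x y) \<in> borel_measurable (M \<Otimes>\<^sub>M N)"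
    and "\<And>x y. norm (f x y) \<le> g x y"
  shows "integrable (M \<Otimes>\<^sub>M N) (\<lambda>(x, y). f x y)"
  by (rule integrable_dominated[OF assms(1,2)]) (simp add: split_beta assms(3))

lemma norm_integral_le:
  fixes f :: "'a \<Rightarrow> 'b::{banach, second_countable_topology}"
  assumes "integrable M g" "f \<in> borel_measurable M" "\<And>x. norm (f x) \<le> g x"
  shows "norm (LINT x|M. f x) \<le> (LINT x|M. g x)"
proof -
  have "(LINT x|M. norm (f x)) \<le> (LINT x|M. g x)"
    by (intro integral_mono integrable_norm assms integrable_dominated[OF assms])
  then show ?thesis using integral_norm_bound[of M f] by linarith
qed

text \<open>The form in which a derivative at 0 is passed under an integral.\<close>

lemma has_vector_derivative_quotient:
  fixes f :: "real \<Rightarrow> 'b::real_normed_vector"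
  assumes "(f has_vector_derivative D) (at 0)"
  shows "((\<lambda>t. (1 / t) *\<^sub>R (f t - f 0)) \<longlongrightarrow> D) (at 0)"
proof -
  have "((\<lambda>h. norm (f h - f 0 - h *\<^sub>R D) / norm h) \<longlongrightarrow> 0) (at 0)"
    using assms by (simp add: has_vector_derivative_def has_derivative_at)
  moreover have "norm (f h - f 0 - h *\<^sub>R D) / norm h = norm ((1 / h) *\<^sub>R (f h - f 0) - D)" if "h \<noteq> 0" for h
  proof -
    have "(1 / h) *\<^sub>R (f h - f 0) - D = (1 / h) *\<^sub>R (f h - f 0 - h *\<^sub>R D)"
      using that by (simp add: scaleR_diff_right)
    then show ?thesis by (simp add: divide_inverse_commute)
  qed
  then have "\<forall>\<^sub>F h in at 0. norm (f h - f 0 - h *\<^sub>R D) / norm h = norm ((1 / h) *\<^sub>R (f h - f 0) - D)"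
    by (simp only: eventually_at_filter) simp
  ultimately have "((\<lambda>h. norm ((1 / h) *\<^sub>R (f h - f 0) - D)) \<longlongrightarrow> 0) (at 0)"
    by (rule Lim_transform_eventually)
  then show ?thesis by (simp only: tendsto_norm_zero_iff LIM_zero_iff)
qed

lemma nn_integral_reflect:
  fixes f :: "'a::euclidean_space \<Rightarrow> ennreal"
  assumes [measurable]: "f \<in> borel_measurable borel"
  shows "(\<integral>\<^sup>+x. f (- x) \<partial>lborel) = (\<integral>\<^sup>+x. f x \<partial>lborel)"
  by (subst (2) lborel_distr_uminus_euclidean[symmetric]) (simp add: nn_integral_distr)

lemma integral_reflect_euclidean:
  fixes f :: "'a::euclidean_space \<Rightarrow> 'b::{banach, second_countable_topology}"
  assumes [measurable]: "f \<in> borel_measurable borel"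
  shows "(LINT x|lborel. f (- x)) = (LINT x|lborel. f x)"
  by (subst (2) lborel_distr_uminus_euclidean[symmetric]) (simp add: integral_distr)

lemma nn_integral_decay_line:
  assumes g: "0 < g"
  shows "(\<integral>\<^sup>+x. ennreal ((1 + \<bar>x\<bar>) powr (- 1 - g)) \<partial>(lborel :: real measure)) < \<infinity>"
proof -
  have half: "(\<integral>\<^sup>+x. ennreal ((1 + x) powr (- 1 - g)) * indicator {0..} x \<partial>lborel) = ennreal (1 / g)"
  proof -
    have "(\<integral>\<^sup>+x. ennreal ((1 + x) powr (- 1 - g)) * indicator {0..} x \<partial>lborel) = 0 - (- ((1 + 0) powr (- g) / g))"
    proof (rule nn_integral_FTC_atLeast)
      show "((\<lambda>x. - ((1 + x) powr (- g) / g)) has_real_derivative (1 + x) powr (- 1 - g)) (at x)" if "0 \<le> x" for x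
      proof -
        have "((\<lambda>x. 1 + x) has_real_derivative 1) (at x)" by (auto intro!: derivative_eq_intros)
        moreover have e: "- g - of_nat 1 = - 1 - g" by simp
        ultimately have "((\<lambda>x. (1 + x) powr (- g)) has_real_derivative (- g) * (1 + x) powr (- 1 - g) * 1) (at x)"
          unfolding e[symmetric] using that by (intro DERIV_fun_powr) auto
        then have "((\<lambda>x. - ((1 + x) powr (- g) / g)) has_real_derivative - ((- g) * (1 + x) powr (- 1 - g) * 1 / g)) (at x)"
          by (intro DERIV_minus DERIV_cdivide)
        then show ?thesis using g by simp
      qed
      have "filterlim (\<lambda>x::real. 1 + x) at_top at_top"
        by (rule filterlim_tendsto_add_at_top[OF tendsto_const filterlim_ident])
      then have "((\<lambda>x. (1 + x) powr (- g)) \<longlongrightarrow> 0) at_top" using g by (intro tendsto_neg_powr) auto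
      then show "((\<lambda>x. - ((1 + x) powr (- g) / g)) \<longlongrightarrow> 0) at_top" using tendsto_minus[OF tendsto_divide_zero] by fastforce
    qed auto
    then show ?thesis by simp
  qed
  have "(\<integral>\<^sup>+x. ennreal ((1 + \<bar>x\<bar>) powr (- 1 - g)) \<partial>(lborel :: real measure))
     \<le> (\<integral>\<^sup>+x. ennreal ((1 + x) powr (- 1 - g)) * indicator {0..} x + ennreal ((1 + (- x)) powr (- 1 - g)) * indicator {0..} (- x) \<partial>(lborel :: real measure))"
    by (intro nn_integral_mono) (auto simp: indicator_def)
  also have "\<dots> = (\<integral>\<^sup>+x. ennreal ((1 + x) powr (- 1 - g)) * indicator {0..} x \<partial>(lborel :: real measure)) 
     + (\<integral>\<^sup>+x. ennreal ((1 + (- x)) powr (- 1 - g)) * indicator {0..} (- x) \<partial>(lborel :: real measure))"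
    by (rule nn_integral_add) measurable
  also have "(\<integral>\<^sup>+x. ennreal ((1 + (- x)) powr (- 1 - g)) * indicator {0..} (- x) \<partial>(lborel :: real measure)) 
     = (\<integral>\<^sup>+x. ennreal ((1 + x) powr (- 1 - g)) * indicator {0..} x \<partial>lborel)"
    by (rule nn_integral_reflect) measurable
  finally show ?thesis unfolding half by (auto simp: le_less_trans)
qed

text \<open>The exponent is distributed evenly over the coordinates: as each coordinate is at most the norm,
the weight is dominated by a product of integrable weights on the line.\<close>

lemma integrable_decay_weight_powr:
  assumes \<alpha>: "0 < \<alpha>"
  shows "integrable lborel (\<lambda>x::real^'n. (1 + norm x) powr (- real CARD('n) - \<alpha>))"
proof (rule integrableI_bounded)
  define g where "g = \<alpha> / real CARD('n)"
  have g: "0 < g" using \<alpha> by (simp add: g_def)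
  have ng: "real CARD('n) * (- 1 - g) = - real CARD('n) - \<alpha>" by (simp add: g_def right_diff_distrib)
  let ?w = "\<lambda>t::real. (1 + \<bar>t\<bar>) powr (- 1 - g)"
  have "(\<integral>\<^sup>+x. ennreal (norm ((1 + norm x) powr (- real CARD('n) - \<alpha>))) \<partial>(lborel :: (real^'n) measure))
      \<le> (\<integral>\<^sup>+x. (\<Prod>b\<in>Basis. ennreal (?w (x \<bullet> b))) \<partial>(lborel :: (real^'n) measure))"
  proof (rule nn_integral_mono)
    fix x :: "real^'n"
    have "(\<Prod>b\<in>(Basis::(real^'n) set). (1 + norm x) powr (- 1 - g)) \<le> (\<Prod>b\<in>(Basis::(real^'n) set). ?w (x \<bullet> b))"
    proof (rule prod_mono)
      fix b :: "real^'n" assume b: "b \<in> Basis"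
      have "?w (x \<bullet> b) \<ge> (1 + norm x) powr (- 1 - g)"
        using Basis_le_norm[OF b, of x] g by (intro powr_mono2') auto
      then show "0 \<le> (1 + norm x) powr (- 1 - g) \<and> (1 + norm x) powr (- 1 - g) \<le> ?w (x \<bullet> b)" by simp
    qed
    also have "(\<Prod>b\<in>(Basis::(real^'n) set). (1 + norm x) powr (- 1 - g)) = ((1 + norm x) powr (- 1 - g)) powr real CARD('n)"
    proof -
      have "1 + norm x \<noteq> 0" using norm_ge_zero[of x] by linarith
      then show ?thesis by (subst powr_realpow) simp_all
    qed
    also have "\<dots> = (1 + norm x) powr (- real CARD('n) - \<alpha>)"
      unfolding powr_powr ng[symmetric] by (simp only: mult.commute)
    finally show "ennreal (norm ((1 + norm x) powr (- real CARD('n) - \<alpha>))) \<le> (\<Prod>b\<in>(Basis::(real^'n) set). ennreal (?w (x \<bullet> b)))"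
      by (subst prod_ennreal) (auto intro: ennreal_leI)
  qed
  also have "\<dots> = (\<Prod>b\<in>(Basis::(real^'n) set). \<integral>\<^sup>+t. ennreal (?w t) \<partial>lborel)"
    by (rule nn_integral_lborel_prod) auto
  also have "\<dots> < \<infinity>"
    using nn_integral_decay_line[OF g] by (auto simp: ennreal_prod_eq_top less_top[symmetric] power_eq_top_ennreal)
  finally show "(\<integral>\<^sup>+x. ennreal (norm ((1 + norm x) powr (- real CARD('n) - \<alpha>))) \<partial>(lborel :: (real^'n) measure)) < \<infinity>" .
qed simp

lemma integrable_decay_weight:
  "integrable lborel (\<lambda>x::real^'n. 1 / (1 + norm x) ^ (2 * CARD('n)))"
proof -
  have "(1 + norm x) powr (- real CARD('n) - real CARD('n)) = 1 / (1 + norm x) ^ (2 * CARD('n))" for x :: "real^'n"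
  proof -
    have "0 < 1 + norm x" using norm_ge_zero[of x] by linarith
    then have "(1 + norm x) powr real (2 * CARD('n)) = (1 + norm x) ^ (2 * CARD('n))" by (rule powr_realpow)
    moreover have "- real CARD('n) - real CARD('n) = - real (2 * CARD('n))" by simp
    ultimately show ?thesis by (simp only: powr_minus inverse_eq_divide)
  qed
  then show ?thesis using integrable_decay_weight_powr[of "real CARD('n)", where 'n = 'n] by simp
qed

lemma decays_integrable:
  fixes f :: "real^'n::finite \<Rightarrow> complex"
  assumes f: "decays f" and [measurable]: "f \<in> borel_measurable borel"
  shows "integrable lborel (\<lambda>x. (1 + norm x) ^ k * norm (f x))"
proof -
  obtain C where C: "C \<ge> 0" "\<And>x. (1 + norm x) ^ (k + 2 * CARD('n)) * norm (f x) \<le> C"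
    using decays_weighted[OF f] by metis
  show ?thesis
  proof (rule integrable_dominated[OF integrable_mult_right[OF integrable_decay_weight, of C]])
    fix x
    have "(1 + norm x) ^ k * norm (f x) * (1 + norm x) ^ (2 * CARD('n)) \<le> C"
      using C(2)[of x] by (simp add: power_add mult_ac)
    then show "norm ((1 + norm x) ^ k * norm (f x)) \<le> C * (1 / (1 + norm x) ^ (2 * CARD('n)))"
      by (simp add: pos_le_divide_eq add_pos_nonneg)
  qed measurable
qed

lemma schwartz_integrable_weighted:
  assumes "f \<in> schwartz" shows "integrable lborel (\<lambda>x. (1 + norm x) ^ k * norm (f x))"
  using decays_integrable[OF schwartz_decays schwartz_measurable] assms by blast

lemma schwartz_integrable:
  assumes "f \<in> schwartz" shows "integrable lborel f"
proof -
  have [measurable]: "f \<in> borel_measurable borel" using assms by (rule schwartz_measurable)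
  show ?thesis
    by (rule integrable_dominated[OF schwartz_integrable_weighted[OF assms, of 0]]) auto
qed

section \<open>The Fourier integral on Schwartz functions\<close>

text \<open>The constant \<open>c\<close> in the phase covers the Fourier transform, its inverse and the
characteristic function at once.\<close>

definition ft :: "real \<Rightarrow> (real^'n::finite \<Rightarrow> complex) \<Rightarrow> real^'n \<Rightarrow> complex" where
  "ft c f \<xi> = (LINT x|lborel. f x * exp (\<i> * of_real (c * (x \<bullet> \<xi>))))"

lemma fourier_fun_eq_ft: "fourier_fun f = ft (- 2 * pi) f"
  by (simp add: fun_eq_iff fourier_fun_def ft_def mult_ac)

lemma inv_fourier_fun_eq_ft: "inv_fourier_fun f = ft (2 * pi) f"
  by (simp add: fun_eq_iff inv_fourier_fun_def ft_def mult_ac inner_commute)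

lemma iexp_inner_measurable [measurable]:
  "(\<lambda>x::real^'n. exp (\<i> * of_real (c * (x \<bullet> \<xi>)))) \<in> borel_measurable borel"
  by (intro borel_measurable_continuous_onI continuous_intros)

lemma integrable_times_iexp:
  assumes "integrable lborel f"
  shows "integrable lborel (\<lambda>x::real^'n. f x * exp (\<i> * of_real (c * (x \<bullet> \<xi>))))"
proof -
  have [measurable]: "f \<in> borel_measurable borel" using assms by auto
  show ?thesis by (rule Bochner_Integration.integrable_bound[OF assms]) (auto simp: norm_mult)
qed

lemma norm_ft_le:
  assumes "integrable lborel f" shows "norm (ft c f \<xi>) \<le> (LINT x|lborel. norm (f x))"
proof -
  have "norm (ft c f \<xi>) \<le> (LINT x|lborel. norm (f x * exp (\<i> * of_real (c * (x \<bullet> \<xi>)))))"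
    unfolding ft_def by (rule integral_norm_bound)
  also have "\<dots> = (LINT x|lborel. norm (f x))" by (simp add: norm_mult)
  finally show ?thesis .
qed

text \<open>The Taylor remainder of the exponential is quadratic in the increment, so integrability of
\<open>|x|\<^sup>2|f(x)|\<close> already gives a Frechet derivative.\<close>

lemma ft_has_derivative:
  assumes f: "f \<in> schwartz"
  shows "(ft c f has_derivative (\<lambda>h. LINT x|lborel. (\<i> * of_real (c * (x \<bullet> h)) * f x) * exp (\<i> * of_real (c * (x \<bullet> \<xi>))))) (at \<xi>)"
proof -
  have [measurable]: "f \<in> borel_measurable borel" using f by (rule schwartz_measurable)
  let ?e = "\<lambda>x \<xi>. exp (\<i> * complex_of_real (c * (x \<bullet> \<xi>)))"
  let ?g = "\<lambda>h x. (\<i> * of_real (c * (x \<bullet> h)) * f x) * ?e x \<xi>"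
  have g_le: "norm (?g h x) \<le> (\<bar>c\<bar> * norm h) * ((1 + norm x) ^ 1 * norm (f x))" for h x
  proof -
    have "norm (?g h x) = \<bar>c\<bar> * \<bar>x \<bullet> h\<bar> * norm (f x)" by (simp add: norm_mult abs_mult)
    also have "\<dots> \<le> \<bar>c\<bar> * (norm x * norm h) * norm (f x)"
      by (intro mult_right_mono mult_left_mono Cauchy_Schwarz_ineq2) auto
    also have "\<dots> \<le> \<bar>c\<bar> * ((1 + norm x) * norm h) * norm (f x)"
      by (intro mult_right_mono mult_left_mono) auto
    finally show ?thesis by (simp add: mult_ac)
  qed
  note w1 = schwartz_integrable_weighted[OF f, of 1]
  have int_g: "integrable lborel (?g h)" for h
    by (rule integrable_dominated[OF integrable_mult_right[OF w1] _ g_le]) measurable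
  define M where "M = (LINT x|lborel. (1 + norm x) ^ 2 * norm (f x))"
  show ?thesis
  proof (rule has_derivativeI_sandwich[where e = 1 and H = "\<lambda>\<eta>. c\<^sup>2 * M * norm (\<eta> - \<xi>)"])
    show "bounded_linear (\<lambda>h. LINT x|lborel. ?g h x)"
    proof (rule bounded_linear_intro[where K = "\<bar>c\<bar> * (LINT x|lborel. (1 + norm x) ^ 1 * norm (f x))"])
      fix h k :: "real^'a" and r :: real
      have "(\<lambda>x. ?g (h + k) x) = (\<lambda>x. ?g h x + ?g k x)"
        by (simp add: fun_eq_iff inner_add_right algebra_simps)
      then show "(LINT x|lborel. ?g (h + k) x) = (LINT x|lborel. ?g h x) + (LINT x|lborel. ?g k x)"
        by (simp only: Bochner_Integration.integral_add[OF int_g int_g])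
      have "(\<lambda>x. ?g (r *\<^sub>R h) x) = (\<lambda>x. r *\<^sub>R ?g h x)"
        by (simp add: fun_eq_iff scaleR_conv_of_real[where 'a = complex] mult_ac)
      then show "(LINT x|lborel. ?g (r *\<^sub>R h) x) = r *\<^sub>R (LINT x|lborel. ?g h x)"
        by (simp only: integral_scaleR_right)
      have "norm (LINT x|lborel. ?g h x) \<le> (LINT x|lborel. (\<bar>c\<bar> * norm h) * ((1 + norm x) ^ 1 * norm (f x)))"
        by (rule norm_integral_le[OF integrable_mult_right[OF w1] _ g_le]) measurable
      then show "norm (LINT x|lborel. ?g h x) \<le> norm h * (\<bar>c\<bar> * (LINT x|lborel. (1 + norm x) ^ 1 * norm (f x)))"
        by (simp add: mult_ac)
    qed
    show "((\<lambda>\<eta>. c\<^sup>2 * M * norm (\<eta> - \<xi>)) \<longlongrightarrow> 0) (at \<xi>)"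
      by (auto intro!: tendsto_eq_intros)
    fix \<eta> assume "\<eta> \<noteq> \<xi>"
    let ?h = "\<eta> - \<xi>"
    let ?r = "\<lambda>x. f x * ?e x \<eta> - f x * ?e x \<xi> - ?g ?h x"
    have r_le: "norm (?r x) \<le> (c\<^sup>2 * (norm ?h)\<^sup>2) * ((1 + norm x) ^ 2 * norm (f x))" for x
    proof -
      let ?t = "c * (x \<bullet> ?h)"
      have "?e x \<eta> = ?e x \<xi> * exp (\<i> * of_real ?t)"
        by (simp add: exp_add[symmetric] inner_diff_right algebra_simps)
      then have "?r x = f x * ?e x \<xi> * (exp (\<i> * of_real ?t) - (\<Sum>k\<le>1. (\<i> * of_real ?t) ^ k / fact k))"
        by (simp add: algebra_simps)
      then have "norm (?r x) = norm (f x) * norm (exp (\<i> * of_real ?t) - (\<Sum>k\<le>1. (\<i> * of_real ?t) ^ k / fact k))"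
        by (simp add: norm_mult)
      also have "\<dots> \<le> norm (f x) * (\<bar>?t\<bar> ^ Suc 1 / fact (Suc 1))"
        by (intro mult_left_mono iexp_approx1) auto
      also have "\<dots> \<le> norm (f x) * (c\<^sup>2 * (norm ?h)\<^sup>2 * (1 + norm x)\<^sup>2)"
      proof (intro mult_left_mono)
        have "\<bar>x \<bullet> ?h\<bar> \<le> (1 + norm x) * norm ?h"
          using Cauchy_Schwarz_ineq2[of x ?h] by (simp add: distrib_right add_increasing)
        then have "\<bar>x \<bullet> ?h\<bar> ^ 2 \<le> ((1 + norm x) * norm ?h) ^ 2"
          by (intro power_mono) auto
        then have "c\<^sup>2 * \<bar>x \<bullet> ?h\<bar> ^ 2 \<le> c\<^sup>2 * ((1 + norm x) * norm ?h) ^ 2"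
          by (intro mult_left_mono) auto
        moreover have "\<bar>?t\<bar> ^ Suc 1 / fact (Suc 1) \<le> c\<^sup>2 * \<bar>x \<bullet> ?h\<bar> ^ 2"
          by (simp add: power2_eq_square[symmetric] abs_mult power_mult_distrib)
        ultimately show "\<bar>?t\<bar> ^ Suc 1 / fact (Suc 1) \<le> c\<^sup>2 * (norm ?h)\<^sup>2 * (1 + norm x)\<^sup>2"
          by (simp add: power_mult_distrib mult_ac)
      qed simp
      finally show ?thesis by (simp add: mult_ac)
    qed
    note w2 = schwartz_integrable_weighted[OF f, of 2]
    note int_e = integrable_times_iexp[OF schwartz_integrable[OF f], of c]
    have "ft c f \<eta> - ft c f \<xi> - (LINT x|lborel. ?g ?h x) = (LINT x|lborel. ?r x)"
      unfolding ft_def using int_e int_g by simp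
    also have "norm \<dots> \<le> (LINT x|lborel. (c\<^sup>2 * (norm ?h)\<^sup>2) * ((1 + norm x) ^ 2 * norm (f x)))"
      by (rule norm_integral_le[OF integrable_mult_right[OF w2] _ r_le]) measurable
    also have "\<dots> = c\<^sup>2 * M * (norm ?h)\<^sup>2" unfolding M_def by (subst integral_mult_right_zero) (simp add: mult_ac)
    finally show "norm (ft c f \<eta> - ft c f \<xi> - (LINT x|lborel. ?g ?h x)) / norm (\<eta> - \<xi>) \<le> c\<^sup>2 * M * norm (\<eta> - \<xi>)"
      using \<open>\<eta> \<noteq> \<xi>\<close> by (simp add: divide_le_eq power2_eq_square mult.assoc)
  qed auto
qed

lemma partial_deriv_ft:
  assumes "f \<in> schwartz"
  shows "partial_deriv i (ft c f) = ft c (\<lambda>x. \<i> * of_real c * (of_real (x $ i) * f x))"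
  by (rule ext, subst partial_derivI[OF ft_has_derivative[OF assms]])
     (simp add: ft_def inner_axis mult_ac)

text \<open>An integrable majorant for the difference quotients: a translation by a vector of length at most
1 changes \<open>1 + |x|\<close> by a factor of at most 2.\<close>

lemma schwartz_difference_bound:
  fixes f :: "real^'n::finite \<Rightarrow> complex"
  assumes f: "f \<in> schwartz"
  obtains C where "\<And>x t. 0 < t \<Longrightarrow> t \<le> 1 \<Longrightarrow> 
     norm (f (x + t *\<^sub>R axis i 1) - f x) \<le> t * (C * (1 / (1 + norm x) ^ (2 * CARD('n))))"
proof -
  let ?N = "2 * CARD('n)" and ?e = "axis i 1 :: real^'n"
  obtain C where C: "C \<ge> 0" "\<And>x. (1 + norm x) ^ ?N * norm (partial_deriv i f x) \<le> C"
    using decays_weighted[OF schwartz_decays[OF schwartz_partial_deriv[OF f]]] by metis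
  have "norm (f (x + t *\<^sub>R ?e) - f x) \<le> t * ((2 ^ ?N * C) * (1 / (1 + norm x) ^ ?N))" if t: "0 < t" "t \<le> 1" for x t
  proof -
    let ?g = "\<lambda>s. f (x + s *\<^sub>R ?e)"
    have D: "(?g has_derivative (\<lambda>h. h *\<^sub>R partial_deriv i f (x + s *\<^sub>R ?e))) (at s)" for s
      using schwartz_has_partial_deriv[OF f] by (simp add: has_vector_derivative_def)
    have "continuous_on {0..t} ?g"
      using has_derivative_continuous[OF D] by (intro continuous_at_imp_continuous_on) blast
    then obtain s where s: "s \<in> {0<..<t}" "norm (?g t - ?g 0) \<le> norm ((t - 0) *\<^sub>R partial_deriv i f (x + s *\<^sub>R ?e))"
      using mvt_general[OF t(1), of ?g "\<lambda>s h. h *\<^sub>R partial_deriv i f (x + s *\<^sub>R ?e)"] D by blast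
    let ?y = "x + s *\<^sub>R ?e"
    have "norm (partial_deriv i f ?y) \<le> 2 ^ ?N * C / (1 + norm x) ^ ?N"
    proof -
      have "norm x \<le> norm ?y + norm (s *\<^sub>R ?e)" using norm_triangle_ineq4[of ?y "s *\<^sub>R ?e"] by simp
      then have "1 + norm x \<le> 2 * (1 + norm ?y)" using s(1) t(2) norm_ge_zero[of ?y] by (simp add: norm_axis_1 del: norm_ge_zero)
      then have "(1 + norm x) ^ ?N \<le> 2 ^ ?N * (1 + norm ?y) ^ ?N"
        unfolding power_mult_distrib[symmetric] by (intro power_mono) auto
      then have "(1 + norm x) ^ ?N * norm (partial_deriv i f ?y) \<le> 2 ^ ?N * (1 + norm ?y) ^ ?N * norm (partial_deriv i f ?y)"
        by (intro mult_right_mono) auto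
      also have "\<dots> \<le> 2 ^ ?N * C" using C(2)[of ?y] by (simp only: mult.assoc) (intro mult_left_mono, auto)
      finally show ?thesis by (subst pos_le_divide_eq) (simp_all add: add_pos_nonneg mult.commute)
    qed
    then have "t * norm (partial_deriv i f ?y) \<le> t * (2 ^ ?N * C / (1 + norm x) ^ ?N)"
      using t by (intro mult_left_mono) auto
    with s(2) t(1) show ?thesis by simp
  qed
  then show ?thesis by (rule that)
qed

text \<open>Integration by parts without iterated integrals: a translation of \<open>f\<close> multiplies its transform by
a character, and both sides are differentiated with respect to the translation.\<close>

lemma ft_partial_deriv:
  fixes f :: "real^'n::finite \<Rightarrow> complex"
  assumes f: "f \<in> schwartz"
  shows "ft c (partial_deriv i f) \<xi> = - \<i> * of_real (c * \<xi> $ i) * ft c f \<xi>"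
proof -
  let ?e = "axis i 1 :: real^'n"
  let ?E = "\<lambda>x. exp (\<i> * complex_of_real (c * (x \<bullet> \<xi>)))"
  define h where "h n = inverse (real (Suc n))" for n
  have h: "0 < h n" "h n \<le> 1" for n by (simp_all add: h_def field_simps)
  have h0: "h \<longlonglongrightarrow> 0" unfolding h_def by (rule LIMSEQ_inverse_real_of_nat)
  have [measurable]: "f \<in> borel_measurable borel" "partial_deriv i f \<in> borel_measurable borel"
    using f schwartz_partial_deriv schwartz_measurable by blast+
  let ?s = "\<lambda>n x. (1 / h n) *\<^sub>R (f (x + h n *\<^sub>R ?e) - f x) * ?E x"
  obtain C where C: "\<And>x t. 0 < t \<Longrightarrow> t \<le> 1 \<Longrightarrow> 
     norm (f (x + t *\<^sub>R ?e) - f x) \<le> t * (C * (1 / (1 + norm x) ^ (2 * CARD('n))))"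
    using schwartz_difference_bound[OF f] by metis
  have lim1: "(\<lambda>n. LINT x|lborel. ?s n x) \<longlonglongrightarrow> (LINT x|lborel. partial_deriv i f x * ?E x)"
  proof (rule integral_dominated_convergence[where w = "\<lambda>x. C * (1 / (1 + norm x) ^ (2 * CARD('n)))"])
    show "AE x in lborel. (\<lambda>n. ?s n x) \<longlonglongrightarrow> partial_deriv i f x * ?E x"
    proof (rule AE_I2)
      fix x
      have "((\<lambda>t. (1 / t) *\<^sub>R (f (x + t *\<^sub>R ?e) - f x)) \<longlongrightarrow> partial_deriv i f x) (at 0)"
        using has_vector_derivative_quotient[OF schwartz_has_partial_deriv[OF f, of x i 0, simplified]] by simp
      then have "(\<lambda>n. (1 / h n) *\<^sub>R (f (x + h n *\<^sub>R ?e) - f x)) \<longlonglongrightarrow> partial_deriv i f x"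
        by (rule filterlim_compose) (use h h0 in \<open>auto simp: filterlim_at less_imp_neq[symmetric]\<close>)
      then show "(\<lambda>n. ?s n x) \<longlonglongrightarrow> partial_deriv i f x * ?E x" by (intro tendsto_mult tendsto_const)
    qed
    show "AE x in lborel. norm (?s n x) \<le> C * (1 / (1 + norm x) ^ (2 * CARD('n)))" for n
    proof (rule AE_I2)
      fix x
      have "norm (?s n x) = norm (f (x + h n *\<^sub>R ?e) - f x) / h n"
        unfolding norm_mult norm_exp_i_times norm_scaleR using h(1)[of n] by simp
      also have "\<dots> \<le> C * (1 / (1 + norm x) ^ (2 * CARD('n)))"
        using C[OF h, of x n] h(1)[of n] by (simp add: pos_divide_le_eq mult.commute)
      finally show "norm (?s n x) \<le> C * (1 / (1 + norm x) ^ (2 * CARD('n)))" .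
    qed
    show "integrable lborel (\<lambda>x::real^'n. C * (1 / (1 + norm x) ^ (2 * CARD('n))))"
      by (rule integrable_mult_right[OF integrable_decay_weight])
  qed measurable
  have eq: "(LINT x|lborel. ?s n x) = (1 / h n) *\<^sub>R (exp (- \<i> * of_real (c * (h n * \<xi> $ i))) - 1) * ft c f \<xi>" for n
  proof -
    let ?g = "\<lambda>x. f x * ?E x"
    have int: "integrable lborel ?g" by (rule integrable_times_iexp[OF schwartz_integrable[OF f]])
    let ?k = "exp (- \<i> * of_real (c * (h n * \<xi> $ i)))"
    have s: "?s n x = (1 / h n) *\<^sub>R (?k * ?g (x + h n *\<^sub>R ?e) - ?g x)" for x
    proof -
      have "?k * ?E (x + h n *\<^sub>R ?e) = ?E x"
        by (simp add: exp_add[symmetric] inner_add_left inner_axis' algebra_simps)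
      then have "?k * ?g (x + h n *\<^sub>R ?e) = f (x + h n *\<^sub>R ?e) * ?E x" by (simp add: mult_ac)
      then show ?thesis by (simp only: left_diff_distrib scaleR_diff_right mult_scaleR_left)
    qed
    have "(LINT x|lborel. ?s n x) = (1 / h n) *\<^sub>R (?k * (LINT x|lborel. ?g (x + h n *\<^sub>R ?e)) - (LINT x|lborel. ?g x))"
      unfolding s by (subst integral_scaleR_right, subst Bochner_Integration.integral_diff)
         (intro int integrable_mult_right integrable_shift[OF int] | simp)+
    also have "(LINT x|lborel. ?g (x + h n *\<^sub>R ?e)) = (LINT x|lborel. ?g x)"
      by (rule integral_shift) measurable
    finally show ?thesis unfolding ft_def by (simp add: algebra_simps)
  qed
  have "((\<lambda>t. (1 / t) *\<^sub>R (exp (- \<i> * of_real (c * (t * \<xi> $ i))) - 1)) \<longlongrightarrow> (- \<i> * of_real (c * \<xi> $ i))) (at 0)"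
    using has_vector_derivative_quotient[OF exp_scaleR_has_vector_derivative_right[of "- \<i> * of_real (c * \<xi> $ i)" 0 UNIV, simplified]]
    by (simp add: scaleR_conv_of_real mult_ac)
  then have "(\<lambda>n. (1 / h n) *\<^sub>R (exp (- \<i> * of_real (c * (h n * \<xi> $ i))) - 1)) \<longlonglongrightarrow> (- \<i> * of_real (c * \<xi> $ i))"
    by (rule filterlim_compose) (use h h0 in \<open>auto simp: filterlim_at less_imp_neq[symmetric]\<close>)
  then have lim2: "(\<lambda>n. LINT x|lborel. ?s n x) \<longlonglongrightarrow> - \<i> * of_real (c * \<xi> $ i) * ft c f \<xi>"
    unfolding eq by (intro tendsto_mult tendsto_const)
  show ?thesis using LIMSEQ_unique[OF lim1 lim2] by (simp add: ft_def)
qed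

text \<open>One power of \<open>|\<xi>|\<close> is bounded by the sum of the coordinates, and each coordinate is traded for a
partial derivative of \<open>f\<close>.\<close>

lemma decays_ft:
  fixes f :: "real^'n::finite \<Rightarrow> complex"
  assumes "f \<in> schwartz" "c \<noteq> 0"
  shows "decays (ft c f)"
proof -
  have "\<exists>C. \<forall>\<xi>. norm \<xi> ^ k * norm (ft c f \<xi>) \<le> C" for k
    using assms(1)
  proof (induction k arbitrary: f)
    case 0
    then show ?case using norm_ft_le[OF schwartz_integrable] by auto
  next
    case (Suc k)
    have "\<exists>C. \<forall>i \<xi>. norm \<xi> ^ k * norm (ft c (partial_deriv i f) \<xi>) \<le> C i"
      using Suc.IH[OF schwartz_partial_deriv[OF Suc.prems]] by metis
    then obtain C where C: "\<And>i \<xi>. norm \<xi> ^ k * norm (ft c (partial_deriv i f) \<xi>) \<le> C i" by metis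
    have "norm \<xi> ^ Suc k * norm (ft c f \<xi>) \<le> (\<Sum>i\<in>UNIV. C i / \<bar>c\<bar>)" for \<xi>
    proof -
      have "norm \<xi> ^ Suc k * norm (ft c f \<xi>) = norm \<xi> * (norm \<xi> ^ k * norm (ft c f \<xi>))" by simp
      also have "\<dots> \<le> (\<Sum>i\<in>UNIV. \<bar>\<xi> $ i\<bar>) * (norm \<xi> ^ k * norm (ft c f \<xi>))"
        by (intro mult_right_mono norm_le_l1_cart) auto
      also have "\<dots> = (\<Sum>i\<in>UNIV. \<bar>\<xi> $ i\<bar> * (norm \<xi> ^ k * norm (ft c f \<xi>)))"
        by (rule sum_distrib_right)
      also have "\<dots> \<le> (\<Sum>i\<in>UNIV. C i / \<bar>c\<bar>)"
      proof (rule sum_mono)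
        fix i
        have "norm \<xi> ^ k * (\<bar>c\<bar> * \<bar>\<xi> $ i\<bar> * norm (ft c f \<xi>)) \<le> C i"
          using C[of \<xi> i] by (simp add: ft_partial_deriv[OF Suc.prems] norm_mult abs_mult)
        then show "\<bar>\<xi> $ i\<bar> * (norm \<xi> ^ k * norm (ft c f \<xi>)) \<le> C i / \<bar>c\<bar>"
          using assms(2) by (simp add: pos_le_divide_eq mult_ac)
      qed
      finally show ?thesis .
    qed
    then show ?case by blast
  qed
  then show ?thesis unfolding decays_def by blast
qed

theorem schwartz_ft:
  assumes "f \<in> schwartz" "c \<noteq> 0" shows "ft c f \<in> schwartz"
proof (rule schwartz_coinduct[of _ "ft c ` schwartz"])
  fix g assume "g \<in> ft c ` (schwartz :: (real^'a \<Rightarrow> complex) set)"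
  then obtain f where f: "f \<in> schwartz" "g = ft c f" by auto
  show "g differentiable (at x)" for x
    using ft_has_derivative[OF f(1)] unfolding f(2) differentiable_def by blast
  show "decays g" unfolding f(2) by (rule decays_ft[OF f(1) assms(2)])
  fix i
  have "partial_deriv i g \<in> ft c ` schwartz"
    unfolding f(2) partial_deriv_ft[OF f(1)] by (intro imageI schwartz_cmult schwartz_nth_mult f(1))
  then show "\<exists>gs\<in>lists (ft c ` schwartz). partial_deriv i g = (\<lambda>x. \<Sum>g\<leftarrow>gs. g x)"
    by (intro bexI[of _ "[partial_deriv i g]"]) simp_all
qed (rule imageI[OF assms(1)])

section \<open>The heat kernel and Fourier inversion\<close>

lemma std_normal_fourier:
  "(LINT x|lborel. std_normal_density x *\<^sub>R iexp (s * x)) = complex_of_real (exp (- (s\<^sup>2) / 2))"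
proof -
  have "char std_normal_distribution s = (LINT x|lborel. std_normal_density x *\<^sub>R iexp (s * x))"
    unfolding char_def by (subst integral_density) auto
  then show ?thesis by (simp add: char_std_normal_distribution)
qed

definition heat1 :: "real \<Rightarrow> real \<Rightarrow> real" where
  "heat1 t x = exp (- x\<^sup>2 / (4 * t)) / sqrt (4 * pi * t)"

text \<open>The heat kernel at time \<open>t\<close> is the centred normal density of variance \<open>2t\<close>.\<close>

lemma heat1_eq: "t > 0 \<Longrightarrow> heat1 t x = \<bar>1 / sqrt (2 * t)\<bar> * std_normal_density (0 + 1 / sqrt (2 * t) * x)"
  unfolding heat1_def normal_density_def by (simp add: power_divide real_sqrt_mult field_simps)

lemma heat1_integrable: assumes "t > 0" shows "integrable lborel (heat1 t)"
proof -
  have "integrable lborel (\<lambda>x. \<bar>1 / sqrt (2 * t)\<bar> * std_normal_density (0 + 1 / sqrt (2 * t) * x))"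
    using assms by (intro integrable_mult_right lborel_integrable_real_affine) auto
  moreover have "(\<lambda>x. \<bar>1 / sqrt (2 * t)\<bar> * std_normal_density (0 + 1 / sqrt (2 * t) * x)) = heat1 t"
    by (rule ext) (rule heat1_eq[OF assms, symmetric])
  ultimately show ?thesis by (simp only:)
qed

lemma heat1_fourier:
  assumes t: "t > 0"
  shows "(LINT x|lborel. of_real (heat1 t x) * iexp (s * x)) = complex_of_real (exp (- t * s\<^sup>2))"
proof -
  let ?c = "1 / sqrt (2 * t)" and ?s = "sqrt (2 * t) * s"
  have "(LINT x|lborel. std_normal_density x *\<^sub>R iexp (?s * x))
     = \<bar>?c\<bar> *\<^sub>R (LINT x|lborel. std_normal_density (0 + ?c * x) *\<^sub>R iexp (?s * (0 + ?c * x)))"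
    by (rule lborel_integral_real_affine) (use t in auto)
  also have "\<dots> = (LINT x|lborel. of_real (heat1 t x) * iexp (s * x))"
    unfolding heat1_eq[OF t] integral_scaleR_right[symmetric]
    by (intro Bochner_Integration.integral_cong refl) (use t in \<open>simp add: scaleR_conv_of_real\<close>)
  finally show ?thesis unfolding std_normal_fourier using t by (simp add: power_mult_distrib)
qed

lemma integral_lborel_prod:
  fixes f :: "'a::euclidean_space \<Rightarrow> real \<Rightarrow> complex"
  assumes "\<And>b. b \<in> Basis \<Longrightarrow> integrable lborel (f b)"
  shows "(LINT x|lborel. (\<Prod>b\<in>Basis. f b (x \<bullet> b))) = (\<Prod>b\<in>Basis. LINT x|lborel. f b x)"
proof -
  interpret product_sigma_finite "\<lambda>b::'a. lborel :: real measure" ..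
  have [measurable]: "\<And>b. b \<in> Basis \<Longrightarrow> f b \<in> borel_measurable borel" using assms by auto
  have "(LINT x|lborel. (\<Prod>b\<in>Basis. f b (x \<bullet> b))) 
      = (LINT y|(\<Pi>\<^sub>M b\<in>Basis. lborel). (\<Prod>b\<in>Basis. f b ((\<Sum>b'\<in>Basis. y b' *\<^sub>R b') \<bullet> b)))"
    by (subst lborel_eq, subst integral_distr) auto
  also have "\<dots> = (LINT y|(\<Pi>\<^sub>M b\<in>Basis. lborel). (\<Prod>b\<in>Basis. f b (y b)))"
    by (intro Bochner_Integration.integral_cong refl prod.cong) (simp add: inner_sum_left inner_Basis if_distrib cong: if_cong)
  also have "\<dots> = (\<Prod>b\<in>Basis. LINT x|lborel. f b x)"
    by (rule product_integral_prod) (auto intro: assms)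
  finally show ?thesis .
qed

definition heat :: "real \<Rightarrow> real^'n::finite \<Rightarrow> real" where
  "heat t h = (4 * pi * t) powr (- real CARD('n) / 2) * exp (- (norm h)\<^sup>2 / (4 * t))"

lemma heat_nonneg [simp]: "0 \<le> heat t h" unfolding heat_def by simp

lemma heat_minus [simp]: "heat t (- h) = heat t h" unfolding heat_def by simp

lemma heat_measurable [measurable]: "(\<lambda>x. heat (f x) (g x)) \<in> borel_measurable M"
  if [measurable]: "f \<in> borel_measurable M" "g \<in> borel_measurable M"
  unfolding heat_def by measurable

lemma heat_eq_gauss_exp: "heat t h = (4 * pi * t) powr (- real CARD('n) / 2) * gauss_exp (1 / (4 * t)) 0 (h :: real^'n)"
  unfolding heat_def gauss_exp_def by simp

lemma schwartz_heat:
  assumes "t > 0" shows "(\<lambda>h. of_real (heat t h)) \<in> schwartz"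
  unfolding heat_eq_gauss_exp of_real_mult using assms by (intro schwartz_cmult schwartz_gauss_exp) simp

lemma heat_integrable:
  assumes "t > 0" shows "integrable lborel (heat t :: real^'n \<Rightarrow> real)"
proof -
  have "integrable lborel (\<lambda>h::real^'n. Re (of_real (heat t h)))"
    by (intro integrable_Re schwartz_integrable schwartz_heat assms)
  then show ?thesis by simp
qed

lemma heat_prod:
  assumes t: "t > 0" shows "heat t (h :: real^'n) = (\<Prod>b\<in>Basis. heat1 t (h \<bullet> b))"
proof -
  have "(\<Prod>b\<in>Basis. heat1 t (h \<bullet> b)) = exp (\<Sum>b\<in>Basis. - (h \<bullet> b)\<^sup>2 / (4 * t)) / sqrt (4 * pi * t) ^ CARD('n)"
    unfolding heat1_def by (simp add: prod_dividef exp_sum)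
  also have "(\<Sum>b\<in>Basis. - (h \<bullet> b)\<^sup>2 / (4 * t)) = - (norm h)\<^sup>2 / (4 * t)"
    unfolding norm_eq_sqrt_inner euclidean_inner[of h h]
    by (simp add: sum_negf sum_divide_distrib[symmetric] sum_nonneg power2_eq_square)
  also have "sqrt (4 * pi * t) ^ CARD('n) = (4 * pi * t) powr (real CARD('n) / 2)"
    using t by (simp add: powr_half_sqrt[symmetric] powr_realpow[symmetric] powr_powr)
  finally show ?thesis unfolding heat_def minus_divide_left[symmetric] powr_minus
    by (simp only: divide_inverse mult.commute)
qed

text \<open>The kernel and the character factor over the coordinates, and each factor is the characteristic
function of a normal distribution.\<close>

lemma ft_heat:
  assumes t: "t > 0"
  shows "ft c (\<lambda>h. of_real (heat t h)) \<xi> = of_real (exp (- t * c\<^sup>2 * (norm (\<xi> :: real^'n))\<^sup>2))"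
proof -
  let ?f = "\<lambda>b x. of_real (heat1 t x) * iexp ((c * (\<xi> \<bullet> b)) * x)"
  have "of_real (heat t h) * iexp (c * (h \<bullet> \<xi>)) = (\<Prod>b\<in>Basis. ?f b (h \<bullet> b))" for h :: "real^'n"
  proof -
    have "iexp (c * (h \<bullet> \<xi>)) = (\<Prod>b\<in>(Basis::(real^'n) set). iexp ((c * (\<xi> \<bullet> b)) * (h \<bullet> b)))"
      unfolding exp_sum[OF finite_Basis, symmetric] euclidean_inner[of h \<xi>]
      by (simp add: sum_distrib_left mult_ac)
    then show ?thesis by (simp add: heat_prod[OF t] prod.distrib)
  qed
  then have "ft c (\<lambda>h. of_real (heat t h)) \<xi> = (LINT h|lborel. (\<Prod>b\<in>Basis. ?f b (h \<bullet> b)))"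
    unfolding ft_def by simp
  also have "\<dots> = (\<Prod>b\<in>(Basis::(real^'n) set). LINT x|lborel. ?f b x)"
  proof (rule integral_lborel_prod)
    fix b :: "real^'n"
    have n: "norm (?f b x) \<le> heat1 t x" for x
      using t by (simp only: norm_mult norm_exp_i_times norm_of_real) (simp add: heat1_def)
    have "?f b \<in> borel_measurable lborel"
      unfolding heat1_def measurable_lborel2
      by (intro borel_measurable_times borel_measurable_continuous_onI continuous_intros) (use t in auto)
    then show "integrable lborel (?f b)"
      by (rule integrable_dominated[OF heat1_integrable[OF t] _ n])
  qed
  also have "\<dots> = (\<Prod>b\<in>(Basis::(real^'n) set). of_real (exp (- t * (c * (\<xi> \<bullet> b))\<^sup>2)))"
    by (intro prod.cong refl heat1_fourier t)
  also have "\<dots> = of_real (exp (\<Sum>b\<in>(Basis::(real^'n) set). - t * (c * (\<xi> \<bullet> b))\<^sup>2))"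
    by (simp add: exp_sum)
  also have "(\<Sum>b\<in>(Basis::(real^'n) set). - t * (c * (\<xi> \<bullet> b))\<^sup>2) = - t * c\<^sup>2 * (norm \<xi>)\<^sup>2"
    unfolding norm_eq_sqrt_inner euclidean_inner[of \<xi> \<xi>]
    by (simp add: sum_distrib_left sum_nonneg power2_eq_square sum_negf mult_ac)
  finally show ?thesis .
qed

lemma integral_heat: 
  assumes "t > 0" shows "(LINT h|lborel. heat t (h :: real^'n)) = 1"
proof -
  have "(LINT h|lborel. complex_of_real (heat t (h :: real^'n))) = 1"
    using ft_heat[OF assms, of 0 "0 :: real^'n"] by (simp add: ft_def)
  then show ?thesis by (simp only: integral_complex_of_real of_real_eq_1_iff)
qed

lemma nn_integral_heat: 
  assumes "t > 0" shows "(\<integral>\<^sup>+h. ennreal (heat t (h :: real^'n)) \<partial>lborel) = 1"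
  by (subst nn_integral_eq_integral[OF heat_integrable]) (use assms integral_heat in auto)

lemma integral_lborel_scale:
  fixes f :: "real^'n \<Rightarrow> 'b::{banach, second_countable_topology}"
  assumes r: "r > 0" and [measurable]: "f \<in> borel_measurable borel"
  shows "(LINT x|lborel. f x) = r ^ CARD('n) *\<^sub>R (LINT x|lborel. f (r *\<^sub>R x))"
  by (subst lborel_affine[of r 0]) (use r in \<open>simp_all add: integral_density integral_distr\<close>)

lemma heat_scale: 
  assumes t: "t > 0" shows "sqrt t ^ CARD('n) * heat t (sqrt t *\<^sub>R h) = heat 1 (h :: real^'n)"
proof -
  have "sqrt t ^ CARD('n) = t powr (real CARD('n) / 2)"
    using t by (simp add: powr_half_sqrt[symmetric] powr_realpow[symmetric] powr_powr)
  then have "sqrt t ^ CARD('n) * (4 * pi * t) powr (- real CARD('n) / 2) = (4 * pi) powr (- real CARD('n) / 2)"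
    using t by (simp add: powr_mult powr_minus)
  then show ?thesis unfolding heat_def using t by (simp add: power_mult_distrib)
qed

text \<open>After rescaling, the kernel is fixed and only the argument of \<open>g\<close> moves, so that dominated
convergence applies. Continuity at the one point \<open>x\<close> suffices.\<close>

lemma heat_approximate_identity:
  fixes g :: "real^'n \<Rightarrow> complex"
  assumes [measurable]: "g \<in> borel_measurable borel" and B: "\<And>x. norm (g x) \<le> B" and cont: "isCont g x"
  shows "(\<lambda>n. LINT y|lborel. g (x + y) * of_real (heat (1 / Suc n) y)) \<longlonglongrightarrow> g x"
proof -
  let ?r = "\<lambda>n. sqrt (1 / Suc n)"
  have eq: "(LINT y|lborel. g (x + y) * of_real (heat (1 / Suc n) y)) 
     = (LINT z|lborel. g (x + ?r n *\<^sub>R z) * of_real (heat 1 z))" for n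
  proof -
    have "(LINT y|lborel. g (x + y) * of_real (heat (1 / Suc n) y)) 
        = ?r n ^ CARD('n) *\<^sub>R (LINT z|lborel. g (x + ?r n *\<^sub>R z) * of_real (heat (1 / Suc n) (?r n *\<^sub>R z)))"
      by (rule integral_lborel_scale) auto
    also have "\<dots> = (LINT z|lborel. g (x + ?r n *\<^sub>R z) * of_real (?r n ^ CARD('n) * heat (1 / Suc n) (?r n *\<^sub>R z)))"
      by (subst integral_scaleR_right[symmetric]) (simp add: scaleR_conv_of_real mult_ac)
    finally show ?thesis by (subst (asm) heat_scale) simp_all
  qed
  have r0: "?r \<longlonglongrightarrow> 0"
    using tendsto_real_sqrt[OF LIMSEQ_inverse_real_of_nat] by (simp add: inverse_eq_divide)
  have "(\<lambda>n. LINT z|lborel. g (x + ?r n *\<^sub>R z) * of_real (heat 1 z)) \<longlonglongrightarrow> (LINT z|lborel. g x * of_real (heat 1 (z :: real^'n)))"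
  proof (rule integral_dominated_convergence[where w = "\<lambda>z. B * heat 1 z"])
    show "integrable lborel (\<lambda>z::real^'n. B * heat 1 z)"
      by (intro integrable_mult_right heat_integrable) simp
    show "AE z in lborel. (\<lambda>n. g (x + ?r n *\<^sub>R z) * of_real (heat 1 z)) \<longlonglongrightarrow> g x * of_real (heat 1 z)"
    proof (rule AE_I2)
      fix z :: "real^'n"
      have "(\<lambda>n. x + ?r n *\<^sub>R z) \<longlonglongrightarrow> x + 0 *\<^sub>R z" by (intro tendsto_intros r0)
      then have "(\<lambda>n. g (x + ?r n *\<^sub>R z)) \<longlonglongrightarrow> g x"
        using isCont_tendsto_compose[OF cont] by simp
      then show "(\<lambda>n. g (x + ?r n *\<^sub>R z) * of_real (heat 1 z)) \<longlonglongrightarrow> g x * of_real (heat 1 z)"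
        by (intro tendsto_intros)
    qed
    show "AE z in lborel. norm (g (x + ?r n *\<^sub>R z) * of_real (heat 1 z)) \<le> B * heat 1 z" for n
      using B by (auto simp: norm_mult intro!: mult_right_mono)
  qed measurable
  also have "(LINT z|lborel. g x * of_real (heat 1 (z :: real^'n))) = g x"
    by (simp add: integral_heat)
  finally show ?thesis unfolding eq .
qed

lemma integrable_pair_mult:
  fixes f :: "'a::euclidean_space \<Rightarrow> 'c::{real_normed_field, banach, second_countable_topology}" 
    and g :: "'b::euclidean_space \<Rightarrow> 'c"
  assumes "integrable lborel f" "integrable lborel g"
  shows "integrable (lborel \<Otimes>\<^sub>M lborel) (\<lambda>(x, y). f x * g y)"
proof -
  have [measurable]: "f \<in> borel_measurable borel" "g \<in> borel_measurable borel" using assms by auto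
  show ?thesis
  proof (rule lborel_pair.Fubini_integrable)
    show "integrable lborel (\<lambda>x. LINT y|lborel. norm (case (x, y) of (x, y) \<Rightarrow> f x * g y))"
      using integrable_norm[OF assms(1)] by (simp add: norm_mult)
    show "AE x in lborel. integrable lborel (\<lambda>y. case (x, y) of (x, y) \<Rightarrow> f x * g y)"
      using assms(2) by simp
  qed measurable
qed

lemma iexp_pair_measurable [measurable]:
  "(\<lambda>(\<xi>::real^'n, h). iexp (c * ((x + h) \<bullet> \<xi>))) \<in> borel_measurable (lborel \<Otimes>\<^sub>M lborel)"
  unfolding lborel_prod case_prod_beta measurable_lborel2
  by (intro borel_measurable_continuous_onI continuous_intros)

lemma norm_one_minus_iexp_le: "norm (1 - iexp (c * (h \<bullet> \<xi>))) \<le> \<bar>c\<bar> * (norm h * norm \<xi>)"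
proof -
  have "norm (iexp (c * (h \<bullet> \<xi>)) - 1) \<le> \<bar>c * (h \<bullet> \<xi>)\<bar>"
    using iexp_approx1[of "c * (h \<bullet> \<xi>)" 0] by simp
  also have "\<dots> \<le> \<bar>c\<bar> * (norm h * norm \<xi>)"
    unfolding abs_mult by (intro mult_left_mono Cauchy_Schwarz_ineq2) auto
  finally show ?thesis by (simp add: norm_minus_commute)
qed

text \<open>The exchange formula of Fubini's theorem. It serves twice: with a Gaussian \<open>f\<close> in the inversion
theorem, and with a kernel \<open>k\<close> to turn a Fourier multiplier into an integral operator.\<close>

lemma ft_ft_mult:
  fixes k f :: "real^'n::finite \<Rightarrow> complex"
  assumes k: "integrable lborel k" and f: "integrable lborel f"
  shows "ft c (\<lambda>\<xi>. ft c k \<xi> * f \<xi>) x = (LINT h|lborel. k h * ft c f (x + h))"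
proof -
  have [measurable]: "k \<in> borel_measurable borel" "f \<in> borel_measurable borel" using assms by auto
  have int: "integrable (lborel \<Otimes>\<^sub>M lborel) (\<lambda>(\<xi>, h). (f \<xi> * k h) * iexp (c * ((x + h) \<bullet> \<xi>)))"
    by (rule Bochner_Integration.integrable_bound[OF integrable_pair_mult[OF f k]])
       (auto simp: norm_mult split_beta' simp del: of_real_mult)
  have "ft c (\<lambda>\<xi>. ft c k \<xi> * f \<xi>) x = (LINT \<xi>|lborel. LINT h|lborel. (f \<xi> * k h) * iexp (c * ((x + h) \<bullet> \<xi>)))"
    unfolding ft_def[of c k] ft_def[of c "\<lambda>\<xi>. _ \<xi> * f \<xi>"]
  proof (intro Bochner_Integration.integral_cong refl)
    fix \<xi>
    have "iexp (c * ((x + h) \<bullet> \<xi>)) = iexp (c * (\<xi> \<bullet> x)) * iexp (c * (h \<bullet> \<xi>))" for h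
      by (simp add: exp_add[symmetric] inner_add_left inner_commute algebra_simps)
    then have "(f \<xi> * k h) * iexp (c * ((x + h) \<bullet> \<xi>)) = (f \<xi> * iexp (c * (\<xi> \<bullet> x))) * (k h * iexp (c * (h \<bullet> \<xi>)))" for h
      by (simp only: mult_ac)
    then show "(LINT h|lborel. k h * iexp (c * (h \<bullet> \<xi>))) * f \<xi> * iexp (c * (\<xi> \<bullet> x))
        = (LINT h|lborel. (f \<xi> * k h) * iexp (c * ((x + h) \<bullet> \<xi>)))"
      by (simp only: integral_mult_right_zero) (simp add: mult_ac)
  qed
  also have "\<dots> = (LINT h|lborel. LINT \<xi>|lborel. (f \<xi> * k h) * iexp (c * ((x + h) \<bullet> \<xi>)))"
    by (rule lborel_pair.Fubini_integral[symmetric, OF int])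
  also have "\<dots> = (LINT h|lborel. k h * ft c f (x + h))"
    unfolding ft_def by (simp add: integral_mult_right_zero[symmetric] inner_commute mult_ac)
  finally show ?thesis .
qed

text \<open>A Gaussian in the frequency variable is a multiple of the heat kernel at the reciprocal time
\<open>1 / (16\<pi>\<^sup>2t)\<close>, whose transform is known.\<close>

lemma ft_gauss:
  assumes t: "t > 0" and c: "c\<^sup>2 = 4 * pi\<^sup>2"
  shows "ft c (\<lambda>\<xi>. of_real (exp (- t * c\<^sup>2 * (norm \<xi>)\<^sup>2))) z = of_real (heat t (z :: real^'n))"
proof -
  define r where "r = 1 / (16 * pi\<^sup>2 * t)"
  have r: "r > 0" using t by (simp add: r_def)
  let ?C = "(4 * pi * t) powr (- real CARD('n) / 2)"
  have "exp (- t * c\<^sup>2 * (norm \<xi>)\<^sup>2) = ?C * heat r \<xi>" for \<xi> :: "real^'n"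
  proof -
    have "4 * pi * r = 1 / (4 * pi * t)" unfolding r_def by (simp add: power2_eq_square)
    then have "?C * (4 * pi * r) powr (- real CARD('n) / 2) = 1"
      using t by (simp add: powr_divide powr_minus)
    moreover have "- (norm \<xi>)\<^sup>2 / (4 * r) = - t * c\<^sup>2 * (norm \<xi>)\<^sup>2"
      unfolding r_def c using t by simp
    ultimately show ?thesis unfolding heat_def by simp
  qed
  then have "ft c (\<lambda>\<xi>. of_real (exp (- t * c\<^sup>2 * (norm \<xi>)\<^sup>2))) z = of_real ?C * ft c (\<lambda>\<xi>. of_real (heat r \<xi>)) z"
    unfolding ft_def by (simp add: mult.assoc)
  also have "\<dots> = of_real (heat t z)"
  proof -
    have "- r * c\<^sup>2 * (norm z)\<^sup>2 = - (norm z)\<^sup>2 / (4 * t)" unfolding r_def c using t by simp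
    then show ?thesis by (simp only: ft_heat[OF r]) (simp add: heat_def)
  qed
  finally show ?thesis .
qed

text \<open>The inverse transform is regularized by a Gaussian. The regularized integral is the action of the
heat semigroup on \<open>f\<close>, which tends to \<open>f\<close> as the time tends to 0.\<close>

theorem ft_inversion:
  fixes f :: "real^'n::finite \<Rightarrow> complex"
  assumes f: "f \<in> schwartz" and c: "c\<^sup>2 = 4 * pi\<^sup>2"
  shows "ft (- c) (ft c f) = f"
proof
  fix x
  have "c \<noteq> 0" using c by auto
  have [measurable]: "f \<in> borel_measurable borel" "ft c f \<in> borel_measurable borel"
    using f \<open>c \<noteq> 0\<close> schwartz_ft schwartz_measurable by blast+
  note int_ft = schwartz_integrable[OF schwartz_ft[OF f \<open>c \<noteq> 0\<close>]]
  let ?m = "\<lambda>t \<xi>::real^'n. complex_of_real (exp (- t * c\<^sup>2 * (norm \<xi>)\<^sup>2))"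
  have m: "integrable lborel (?m t)" if "t > 0" for t
  proof -
    have "?m t = (\<lambda>\<xi>. of_real (gauss_exp (t * c\<^sup>2) 0 \<xi>))" by (simp add: gauss_exp_def)
    moreover have "0 < t * c\<^sup>2" using that \<open>c \<noteq> 0\<close> by simp
    ultimately show ?thesis using schwartz_integrable[OF schwartz_gauss_exp[of "t * c\<^sup>2" 0]] by simp
  qed
  let ?t = "\<lambda>n. 1 / real (Suc n)"
  have eq: "(LINT \<xi>|lborel. ft c f \<xi> * ?m (?t n) \<xi> * iexp (c * (\<xi> \<bullet> (- x)))) = (LINT y|lborel. f (x + y) * of_real (heat (?t n) y))" for n
  proof -
    have "(LINT \<xi>|lborel. ft c f \<xi> * ?m (?t n) \<xi> * iexp (c * (\<xi> \<bullet> (- x)))) = (LINT h|lborel. f h * ft c (?m (?t n)) (- x + h))"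
      using ft_ft_mult[OF schwartz_integrable[OF f] m, of "?t n" c "- x"] unfolding ft_def[of c "\<lambda>\<xi>. _ \<xi> * _ \<xi>"] by simp
    also have "\<dots> = (LINT h|lborel. f h * of_real (heat (?t n) (- x + h)))"
      by (subst ft_gauss[OF _ c]) simp_all
    also have "\<dots> = (LINT y|lborel. f (y + x) * of_real (heat (?t n) (- x + (y + x))))"
      by (rule integral_shift[symmetric]) measurable
    finally show ?thesis by (simp add: add.commute)
  qed
  obtain B where B: "\<And>x. norm (f x) \<le> B" using schwartz_bounded[OF f] by blast
  have "isCont f x" using schwartz_continuous[OF f] by (simp add: continuous_on_eq_continuous_at)
  from heat_approximate_identity[OF _ B this]
  have lim1: "(\<lambda>n. LINT \<xi>|lborel. ft c f \<xi> * ?m (?t n) \<xi> * iexp (c * (\<xi> \<bullet> (- x)))) \<longlonglongrightarrow> f x"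
    unfolding eq by simp
  have lim2: "(\<lambda>n. LINT \<xi>|lborel. ft c f \<xi> * ?m (?t n) \<xi> * iexp (c * (\<xi> \<bullet> (- x)))) \<longlonglongrightarrow> (LINT \<xi>|lborel. ft c f \<xi> * iexp (c * (\<xi> \<bullet> (- x))))"
  proof (rule integral_dominated_convergence[where w = "\<lambda>\<xi>. norm (ft c f \<xi>)"])
    show "AE \<xi> in lborel. (\<lambda>n. ft c f \<xi> * ?m (?t n) \<xi> * iexp (c * (\<xi> \<bullet> (- x)))) \<longlonglongrightarrow> ft c f \<xi> * iexp (c * (\<xi> \<bullet> (- x)))"
    proof (rule AE_I2)
      fix \<xi>
      have "(\<lambda>n. ft c f \<xi> * ?m (?t n) \<xi> * iexp (c * (\<xi> \<bullet> (- x)))) \<longlonglongrightarrow> ft c f \<xi> * of_real (exp (- 0 * c\<^sup>2 * (norm \<xi>)\<^sup>2)) * iexp (c * (\<xi> \<bullet> (- x)))"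
        using LIMSEQ_inverse_real_of_nat by (intro tendsto_intros) (simp add: inverse_eq_divide)
      then show "(\<lambda>n. ft c f \<xi> * ?m (?t n) \<xi> * iexp (c * (\<xi> \<bullet> (- x)))) \<longlonglongrightarrow> ft c f \<xi> * iexp (c * (\<xi> \<bullet> (- x)))" by simp
    qed
    show "AE \<xi> in lborel. norm (ft c f \<xi> * ?m (?t n) \<xi> * iexp (c * (\<xi> \<bullet> (- x)))) \<le> norm (ft c f \<xi>)" for n
      by (rule AE_I2) (simp only: norm_mult norm_exp_i_times norm_of_real, simp add: mult_left_le)
  qed (use int_ft in \<open>auto simp del: of_real_mult\<close>)
  have "ft (- c) (ft c f) x = (LINT \<xi>|lborel. ft c f \<xi> * iexp (c * (\<xi> \<bullet> (- x))))"
    by (simp add: ft_def[of "- c"])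
  then show "ft (- c) (ft c f) x = f x" using LIMSEQ_unique[OF lim1 lim2] by simp
qed

corollary inv_fourier_fourier: "f \<in> schwartz \<Longrightarrow> ft (2 * pi) (ft (- 2 * pi) f) = f"
  using ft_inversion[of f "- 2 * pi"] by (simp add: power_mult_distrib)

corollary fourier_inv_fourier: "f \<in> schwartz \<Longrightarrow> ft (- 2 * pi) (ft (2 * pi) f) = f"
  using ft_inversion[of f "2 * pi"] by (simp add: power_mult_distrib)

section \<open>The kernels of the Bessel potentials\<close>

lemma powr_le_exp:
  assumes "0 \<le> m"
  obtains C :: real where "0 < C" "\<And>x. 0 \<le> x \<Longrightarrow> x powr m \<le> C * exp x"
proof -
  obtain N where N: "m \<le> real N" using real_arch_simple by blast
  have "x powr m \<le> (1 + fact N) * exp x" if x: "0 \<le> x" for x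
  proof -
    have "x powr m \<le> 1 + x ^ N"
    proof (cases "x \<le> 1")
      case True
      have "x powr m \<le> 1" using x True assms by (rule_tac powr_le1) auto
      then show ?thesis using x by (simp add: add_increasing2)
    next
      case False
      have "x powr m \<le> x powr real N" using False N by (intro powr_mono) auto
      then show ?thesis using False by (simp add: powr_realpow)
    qed
    moreover have "x ^ N \<le> fact N * exp x"
      using exp_ge_power_div_fact[OF x, of N] by (simp add: pos_divide_le_eq mult.commute)
    moreover have "1 \<le> exp x" using x by simp
    ultimately show ?thesis unfolding distrib_right by linarith
  qed
  then show ?thesis by (intro that[of "1 + fact N"]) (simp_all add: add_pos_pos)
qed

text \<open>The Gaussian factor dominates every power of \<open>|h|\<^sup>2/4t\<close>. This converts powers of \<open>t\<close> into powers of
\<open>|h|\<close>, in the ratio fixed by parabolic scaling.\<close>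

lemma heat_pointwise_bound:
  assumes b: "0 \<le> b"
  obtains C where "0 < C" "\<And>t (h :: real^'n::finite). 0 < t \<Longrightarrow> h \<noteq> 0 \<Longrightarrow> 
     heat t h \<le> C * t powr (b / 2) * norm h powr (- real CARD('n) - b)"
proof -
  let ?m = "(real CARD('n) + b) / 2"
  obtain C0 where C0: "0 < C0" "\<And>x. 0 \<le> x \<Longrightarrow> x powr ?m \<le> C0 * exp x"
    using powr_le_exp[of ?m] b by (metis add_nonneg_nonneg divide_nonneg_nonneg of_nat_0_le_iff zero_le_numeral)
  define C where "C = (4 * pi) powr (- real CARD('n) / 2) * 4 powr ?m * C0"
  have "heat t h \<le> C * t powr (b / 2) * norm h powr (- real CARD('n) - b)" if t: "0 < t" and h: "h \<noteq> 0" for t and h :: "real^'n"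
  proof -
    let ?x = "(norm h)\<^sup>2 / (4 * t)"
    have x: "0 < ?x" using t h by simp
    have quot: "(N powr 2) powr (- m) / T powr (- m) = N powr (- 2 * m) * T powr m" for N T m :: real
      by (simp add: powr_powr powr_minus divide_inverse)
    have inv: "inverse e \<le> C0 * inverse p" if "p \<le> C0 * e" "0 < p" "0 < e" for e p :: real
      using that by (simp add: field_simps)
    have "exp (- ?x) \<le> C0 * ?x powr (- ?m)"
      unfolding exp_minus powr_minus by (rule inv[OF C0(2)]) (use x in auto)
    also have "?x powr (- ?m) = (norm h powr 2) powr (- ?m) / (4 * t) powr (- ?m)"
      using t h by (simp add: powr_divide)
    also have "\<dots> = norm h powr (- 2 * ?m) * (4 * t) powr ?m"
      by (rule quot)
    also have "(4 * t) powr ?m = 4 powr ?m * t powr ?m" using t by (simp add: powr_mult)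
    finally have e: "exp (- ?x) \<le> C0 * (norm h powr (- 2 * ?m) * (4 powr ?m * t powr ?m))" .
    have "heat t h \<le> (4 * pi * t) powr (- real CARD('n) / 2) * (C0 * (norm h powr (- 2 * ?m) * (4 powr ?m * t powr ?m)))"
      unfolding heat_def minus_divide_left[symmetric] by (intro mult_left_mono) (use e in auto)
    also have "\<dots> = C * (t powr (- real CARD('n) / 2) * t powr ?m) * norm h powr (- 2 * ?m)"
      unfolding C_def using t by (simp add: powr_mult mult_ac)
    also have "t powr (- real CARD('n) / 2) * t powr ?m = t powr (b / 2)"
      unfolding powr_add[symmetric] by (simp add: field_simps)
    also have "- 2 * ?m = - real CARD('n) - b" by simp
    finally show ?thesis .
  qed
  moreover have "0 < C" unfolding C_def using C0(1) by simp
  ultimately show ?thesis by (intro that[of C])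
qed

lemma heat_double:
  assumes t: "0 < t" 
  shows "heat t h * exp ((norm h)\<^sup>2 / (8 * t)) = 2 powr (real CARD('n) / 2) * heat (2 * t) (h :: real^'n)"
proof -
  have "(4 * pi * (2 * t)) powr (- real CARD('n) / 2) = 2 powr (- real CARD('n) / 2) * (4 * pi * t) powr (- real CARD('n) / 2)"
    using t by (subst powr_mult[symmetric]) (simp_all add: mult_ac)
  then have "2 powr (real CARD('n) / 2) * (4 * pi * (2 * t)) powr (- real CARD('n) / 2) = (4 * pi * t) powr (- real CARD('n) / 2)"
    by (simp add: powr_minus)
  moreover have "exp (- (norm h)\<^sup>2 / (4 * t)) * exp ((norm h)\<^sup>2 / (8 * t)) = exp (- (norm h)\<^sup>2 / (4 * (2 * t)))"
    using t unfolding exp_add[symmetric] by (simp add: field_simps)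
  ultimately show ?thesis unfolding heat_def by (simp add: mult.assoc[symmetric])
qed

text \<open>Half of the exponent pays for the power of \<open>|h|\<close>; what remains is the kernel at the doubled
time.\<close>

lemma heat_moment:
  assumes \<sigma>: "0 \<le> \<sigma>"
  obtains C where "0 < C" "\<And>t. 0 < t \<Longrightarrow>
     (\<integral>\<^sup>+h. ennreal (heat t (h :: real^'n::finite) * norm h powr \<sigma>) \<partial>lborel) \<le> ennreal (C * t powr (\<sigma> / 2))"
proof -
  obtain C0 where C0: "0 < C0" "\<And>x. 0 \<le> x \<Longrightarrow> x powr (\<sigma> / 2) \<le> C0 * exp x"
    using powr_le_exp[of "\<sigma> / 2"] \<sigma> by auto
  define C where "C = 8 powr (\<sigma> / 2) * C0 * 2 powr (real CARD('n) / 2)"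
  have "(\<integral>\<^sup>+h. ennreal (heat t (h :: real^'n) * norm h powr \<sigma>) \<partial>lborel) \<le> ennreal (C * t powr (\<sigma> / 2))" if t: "0 < t" for t
  proof -
    have "heat t h * norm h powr \<sigma> \<le> (C * t powr (\<sigma> / 2)) * heat (2 * t) h" for h :: "real^'n"
    proof -
      let ?x = "(norm h)\<^sup>2 / (8 * t)"
      have "norm h powr \<sigma> = (8 * t) powr (\<sigma> / 2) * ?x powr (\<sigma> / 2)"
      proof -
        have "(8 * t) powr (\<sigma> / 2) * ?x powr (\<sigma> / 2) = ((norm h)\<^sup>2) powr (\<sigma> / 2)"
          using t by (subst powr_mult[symmetric]) auto
        also have "\<dots> = norm h powr \<sigma>" by (cases "h = 0") (simp_all add: powr_powr flip: powr_numeral)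
        finally show ?thesis by simp
      qed
      also have "\<dots> \<le> (8 * t) powr (\<sigma> / 2) * (C0 * exp ?x)"
        using t by (intro mult_left_mono C0(2)) auto
      finally have "heat t h * norm h powr \<sigma> \<le> heat t h * ((8 * t) powr (\<sigma> / 2) * (C0 * exp ?x))"
        by (intro mult_left_mono) auto
      also have "\<dots> = (8 * t) powr (\<sigma> / 2) * C0 * (heat t h * exp ?x)" by (simp add: mult_ac)
      finally show ?thesis unfolding heat_double[OF t] C_def using t by (simp add: powr_mult mult_ac)
    qed
    then have "(\<integral>\<^sup>+h. ennreal (heat t (h :: real^'n) * norm h powr \<sigma>) \<partial>lborel)
       \<le> (\<integral>\<^sup>+h. ennreal (C * t powr (\<sigma> / 2)) * ennreal (heat (2 * t) (h :: real^'n)) \<partial>lborel)"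
      using C0(1) by (intro nn_integral_mono) (simp add: ennreal_mult'[symmetric] C_def ennreal_leI)
    also have "\<dots> = ennreal (C * t powr (\<sigma> / 2))"
      using t by (simp add: nn_integral_cmult nn_integral_heat)
    finally show ?thesis .
  qed
  moreover have "0 < C" unfolding C_def using C0(1) by simp
  ultimately show ?thesis by (intro that[of C])
qed

text \<open>The density of the Gamma integral, extended by 0 to the whole line. The order \<open>a\<close> may be negative;
the weight is then not integrable near 0.\<close>

definition gamma_weight :: "real \<Rightarrow> real \<Rightarrow> real" where
  "gamma_weight a t = indicator {0<..} t * (t powr (a - 1) * exp (- t))"

lemma gamma_weight_nonneg [simp]: "0 \<le> gamma_weight a t" unfolding gamma_weight_def by simp

lemma gamma_weight_measurable [measurable]: "gamma_weight a \<in> borel_measurable borel"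
  unfolding gamma_weight_def by measurable

lemma gamma_weight_powr: "gamma_weight a t * t powr b = gamma_weight (a + b) t"
  unfolding gamma_weight_def by (simp add: powr_add[symmetric] indicator_def algebra_simps)

lemma nn_integral_gamma_weight:
  assumes "0 < a" shows "(\<integral>\<^sup>+t. ennreal (gamma_weight a t) \<partial>lborel) = ennreal (Gamma a)"
  unfolding Gamma_conv_nn_integral_real[OF assms] gamma_weight_def
  by (intro nn_integral_cong) (auto simp: indicator_def exp_minus divide_inverse)

lemma nn_integral_gamma_weight_exp:
  assumes a: "0 < a" and \<mu>: "0 \<le> \<mu>" 
  shows "(\<integral>\<^sup>+t. ennreal (gamma_weight a t * exp (- t * \<mu>)) \<partial>lborel) = ennreal (Gamma a * (1 + \<mu>) powr (- a))"
proof -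
  have l: "0 < 1 + \<mu>" using \<mu> by simp
  have "ennreal (Gamma a) = \<bar>1 + \<mu>\<bar> * (\<integral>\<^sup>+t. ennreal (gamma_weight a (0 + (1 + \<mu>) * t)) \<partial>lborel)"
    unfolding nn_integral_gamma_weight[OF a, symmetric] by (rule nn_integral_real_affine) (use l in auto)
  also have "\<dots> = (\<integral>\<^sup>+t. ennreal (1 + \<mu>) * ennreal (gamma_weight a (0 + (1 + \<mu>) * t)) \<partial>lborel)"
    using l by (subst nn_integral_cmult) auto
  also have "\<dots> = (\<integral>\<^sup>+t. ennreal ((1 + \<mu>) powr a) * ennreal (gamma_weight a t * exp (- t * \<mu>)) \<partial>lborel)"
  proof (intro nn_integral_cong)
    fix t
    have "(1 + \<mu>) * gamma_weight a ((1 + \<mu>) * t) = (1 + \<mu>) powr a * (gamma_weight a t * exp (- t * \<mu>))"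
    proof (cases "0 < t")
      case True
      have "(1 + \<mu>) * (1 + \<mu>) powr (a - 1) = (1 + \<mu>) powr a" 
        using l by (simp add: powr_mult_base)
      moreover have "exp (- ((1 + \<mu>) * t)) = exp (- t) * exp (- t * \<mu>)"
        unfolding exp_add[symmetric] by (simp add: algebra_simps)
      ultimately show ?thesis using True l unfolding gamma_weight_def
        by (simp add: powr_mult mult.assoc[symmetric])
    next
      case False
      then have "\<not> 0 < (1 + \<mu>) * t" using l by (simp add: zero_less_mult_iff)
      then show ?thesis using False unfolding gamma_weight_def by simp
    qed
    then show "ennreal (1 + \<mu>) * ennreal (gamma_weight a (0 + (1 + \<mu>) * t)) = ennreal ((1 + \<mu>) powr a) * ennreal (gamma_weight a t * exp (- t * \<mu>))"
      using l by (simp add: ennreal_mult'[symmetric])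
  qed
  also have "\<dots> = ennreal ((1 + \<mu>) powr a) * (\<integral>\<^sup>+t. ennreal (gamma_weight a t * exp (- t * \<mu>)) \<partial>lborel)"
    by (rule nn_integral_cmult) measurable
  finally have "ennreal ((1 + \<mu>) powr (- a)) * ennreal (Gamma a) = ennreal ((1 + \<mu>) powr (- a)) * ennreal ((1 + \<mu>) powr a) * (\<integral>\<^sup>+t. ennreal (gamma_weight a t * exp (- t * \<mu>)) \<partial>lborel)"
    by (simp add: mult.assoc)
  moreover have "ennreal ((1 + \<mu>) powr (- a)) * ennreal ((1 + \<mu>) powr a) = 1"
    using l by (simp add: ennreal_mult'[symmetric] powr_minus)
  ultimately show ?thesis using a by (simp add: ennreal_mult'[symmetric] mult.commute)
qed

text \<open>\<open>1 - e\<^bsup>-t\<mu>\<^esup>\<close> is the integral of \<open>t e\<^bsup>-tr\<^esup>\<close> over \<open>0 \<le> r \<le> \<mu>\<close>. The factor \<open>t\<close> raises the order of the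
weight to \<open>1 - a > 0\<close>, and Tonelli's theorem leaves the integral of \<open>(1 + r)\<^bsup>a-1\<^esup>\<close>.\<close>

lemma nn_integral_gamma_weight_diff:
  assumes a: "0 < a" "a < 1" and \<mu>: "0 \<le> \<mu>" 
  shows "(\<integral>\<^sup>+t. ennreal (gamma_weight (- a) t * (1 - exp (- t * \<mu>))) \<partial>lborel) = ennreal (Gamma (1 - a) / a * ((1 + \<mu>) powr a - 1))"
proof -
  have "(\<integral>\<^sup>+t. ennreal (gamma_weight (- a) t * (1 - exp (- t * \<mu>))) \<partial>lborel)
     = (\<integral>\<^sup>+t. \<integral>\<^sup>+r. ennreal (gamma_weight (1 - a) t * exp (- t * r)) * indicator {0..\<mu>} r \<partial>lborel \<partial>lborel)"
  proof (intro nn_integral_cong)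
    fix t
    have "ennreal (gamma_weight (- a) t * (1 - exp (- t * \<mu>))) = (\<integral>\<^sup>+r. ennreal (gamma_weight (- a) t * (t * exp (- t * r))) * indicator {0..\<mu>} r \<partial>lborel)"
    proof (cases "0 < t")
      case True
      have "(\<integral>\<^sup>+r. ennreal (gamma_weight (- a) t * (t * exp (- t * r))) * indicator {0..\<mu>} r \<partial>lborel)
         = ennreal ((- gamma_weight (- a) t * exp (- t * \<mu>)) - (- gamma_weight (- a) t * exp (- t * 0)))"
      proof (rule nn_integral_FTC_Icc)
        show "((\<lambda>r. - gamma_weight (- a) t * exp (- t * r)) has_real_derivative gamma_weight (- a) t * (t * exp (- t * x))) (at x)" for x
          by (auto intro!: derivative_eq_intros)
      qed (use True \<mu> in auto)
      then show ?thesis by (simp add: algebra_simps)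
    next
      case False
      then show ?thesis unfolding gamma_weight_def by simp
    qed
    also have "\<dots> = (\<integral>\<^sup>+r. ennreal (gamma_weight (1 - a) t * exp (- t * r)) * indicator {0..\<mu>} r \<partial>lborel)"
    proof (intro nn_integral_cong)
      fix r
      have "gamma_weight (- a) t * t = gamma_weight (1 - a) t"
        using gamma_weight_powr[of "- a" t 1] by (auto simp: gamma_weight_def)
      then have "gamma_weight (- a) t * (t * exp (- t * r)) = gamma_weight (1 - a) t * exp (- t * r)"
        by (simp only: mult.assoc[symmetric])
      then show "ennreal (gamma_weight (- a) t * (t * exp (- t * r))) * indicator {0..\<mu>} r
          = ennreal (gamma_weight (1 - a) t * exp (- t * r)) * indicator {0..\<mu>} r"
        by (simp only:)
    qed
    finally show "ennreal (gamma_weight (- a) t * (1 - exp (- t * \<mu>))) = (\<integral>\<^sup>+r. ennreal (gamma_weight (1 - a) t * exp (- t * r)) * indicator {0..\<mu>} r \<partial>lborel)" .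
  qed
  also have "\<dots> = (\<integral>\<^sup>+r. \<integral>\<^sup>+t. ennreal (gamma_weight (1 - a) t * exp (- t * r)) * indicator {0..\<mu>} r \<partial>lborel \<partial>lborel)"
    by (rule lborel_pair.Fubini') measurable
  also have "\<dots> = (\<integral>\<^sup>+r. ennreal (Gamma (1 - a) * (1 + r) powr (a - 1)) * indicator {0..\<mu>} r \<partial>lborel)"
  proof (intro nn_integral_cong)
    fix r
    show "(\<integral>\<^sup>+t. ennreal (gamma_weight (1 - a) t * exp (- t * r)) * indicator {0..\<mu>} r \<partial>lborel) = ennreal (Gamma (1 - a) * (1 + r) powr (a - 1)) * indicator {0..\<mu>} r"
      using nn_integral_gamma_weight_exp[of "1 - a" r] a by (cases "r \<in> {0..\<mu>}") simp_all
  qed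
  also have "\<dots> = ennreal (Gamma (1 - a) / a * (1 + \<mu>) powr a - Gamma (1 - a) / a * (1 + 0) powr a)"
  proof (rule nn_integral_FTC_Icc)
    show "((\<lambda>r. Gamma (1 - a) / a * (1 + r) powr a) has_real_derivative Gamma (1 - a) * (1 + x) powr (a - 1)) (at x)" 
      if "x \<in> {0..\<mu>}" for x
      using that a by (auto intro!: derivative_eq_intros simp: powr_diff)
  qed (use a \<mu> Gamma_real_pos[of "1 - a"] in auto)
  finally show ?thesis by (simp add: right_diff_distrib)
qed

text \<open>For \<open>s > 0\<close> this is \<open>\<Gamma>(s/2)\<close> times the convolution kernel of the Bessel potential of order \<open>s\<close>. For
negative \<open>s\<close> the integral still converges away from the origin and gives the density of a Levy
measure. Where it diverges, at \<open>h = 0\<close> for \<open>s \<le> n\<close>, the value is 0.\<close>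

definition bessel_kernel :: "real \<Rightarrow> real^'n::finite \<Rightarrow> real" where
  "bessel_kernel s h = (LINT t|lborel. gamma_weight (s / 2) t * heat t h)"

lemma bessel_kernel_measurable [measurable]: "bessel_kernel s \<in> borel_measurable borel"
  unfolding bessel_kernel_def by measurable

lemma bessel_kernel_nonneg [simp]: "0 \<le> bessel_kernel s h"
  unfolding bessel_kernel_def by simp

lemma bessel_kernel_minus [simp]: "bessel_kernel s (- h) = bessel_kernel s h"
  unfolding bessel_kernel_def by simp

lemma ennreal_bessel_kernel_le:
  "ennreal (bessel_kernel s h) \<le> (\<integral>\<^sup>+t. ennreal (gamma_weight (s / 2) t * heat t h) \<partial>lborel)"
proof (cases "integrable lborel (\<lambda>t. gamma_weight (s / 2) t * heat t h)")
  case True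
  then show ?thesis unfolding bessel_kernel_def by (subst nn_integral_eq_integral) auto
next
  case False
  then show ?thesis unfolding bessel_kernel_def by (simp add: not_integrable_integral_eq)
qed

text \<open>The pointwise bound of the heat kernel is integrated in time; \<open>s + b > 0\<close> makes the resulting Gamma
integral converge at 0.\<close>

lemma bessel_kernel_pointwise:
  assumes b: "0 \<le> b" "0 < s + b"
  obtains C where "0 < C" "\<And>h :: real^'n::finite. h \<noteq> 0 \<Longrightarrow> integrable lborel (\<lambda>t. gamma_weight (s / 2) t * heat t h)"
    "\<And>h :: real^'n. h \<noteq> 0 \<Longrightarrow> bessel_kernel s h \<le> C * norm h powr (- real CARD('n) - b)"
proof -
  obtain C where C: "0 < C" "\<And>t (h :: real^'n). 0 < t \<Longrightarrow> h \<noteq> 0 \<Longrightarrow> 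
     heat t h \<le> C * t powr (b / 2) * norm h powr (- real CARD('n) - b)"
    by (rule heat_pointwise_bound[OF b(1), where 'n = 'n]) (rule that)
  let ?G = "Gamma ((s + b) / 2)"
  have G: "0 < ?G" using b by (intro Gamma_real_pos) simp
  have *: "(\<integral>\<^sup>+t. ennreal (gamma_weight (s / 2) t * heat t h) \<partial>lborel) \<le> ennreal ((C * ?G) * norm h powr (- real CARD('n) - b))" 
    if h: "h \<noteq> 0" for h :: "real^'n"
  proof -
    let ?N = "norm h powr (- real CARD('n) - b)"
    have "gamma_weight (s / 2) t * heat t h \<le> (C * ?N) * gamma_weight ((s + b) / 2) t" for t
    proof (cases "0 < t")
      case True
      have "gamma_weight (s / 2) t * heat t h \<le> gamma_weight (s / 2) t * (C * t powr (b / 2) * ?N)"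
        using C(2)[OF True h] by (intro mult_left_mono) auto
      also have "\<dots> = (C * ?N) * (gamma_weight (s / 2) t * t powr (b / 2))" by (simp add: mult_ac)
      finally show ?thesis unfolding gamma_weight_powr by (simp add: add_divide_distrib)
    qed (simp add: gamma_weight_def)
    then have "(\<integral>\<^sup>+t. ennreal (gamma_weight (s / 2) t * heat t h) \<partial>lborel) \<le> (\<integral>\<^sup>+t. ennreal (C * ?N) * ennreal (gamma_weight ((s + b) / 2) t) \<partial>lborel)"
      using C(1) by (intro nn_integral_mono) (simp add: ennreal_mult'[symmetric] ennreal_leI)
    also have "\<dots> = ennreal (C * ?N) * (\<integral>\<^sup>+t. ennreal (gamma_weight ((s + b) / 2) t) \<partial>lborel)"
      by (rule nn_integral_cmult) measurable
    also have "\<dots> = ennreal ((C * ?G) * ?N)"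
      using b C(1) G by (subst nn_integral_gamma_weight) (simp_all add: ennreal_mult'[symmetric] mult_ac)
    finally show ?thesis .
  qed
  show ?thesis
  proof (rule that[of "C * ?G"])
    show "0 < C * ?G" using C(1) G by simp
    fix h :: "real^'n" assume h: "h \<noteq> 0"
    show "integrable lborel (\<lambda>t. gamma_weight (s / 2) t * heat t h)"
      using *[OF h] by (intro integrableI_bounded) (auto simp: le_less_trans)
    have "ennreal (bessel_kernel s h) \<le> ennreal ((C * ?G) * norm h powr (- real CARD('n) - b))"
      using ennreal_bessel_kernel_le *[OF h] by (rule order_trans)
    then show "bessel_kernel s h \<le> (C * ?G) * norm h powr (- real CARD('n) - b)"
      using C(1) G by (subst (asm) ennreal_le_iff) auto
  qed
qed

lemma gamma_weight_heat_integrable: 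
  "h \<noteq> 0 \<Longrightarrow> integrable lborel (\<lambda>t. gamma_weight (s / 2) t * heat t (h :: real^'n::finite))"
  using bessel_kernel_pointwise[of "\<bar>s\<bar> + 1" s, where 'n = 'n] by force

lemma heat_moment_double:
  assumes "0 \<le> \<sigma>" "0 < s + \<sigma>"
  shows "(\<integral>\<^sup>+t. \<integral>\<^sup>+h. ennreal (gamma_weight (s / 2) t * heat t (h :: real^'n::finite) * norm h powr \<sigma>) \<partial>lborel \<partial>lborel) < \<infinity>"
proof -
  obtain C where C: "0 < C" "\<And>t. 0 < t \<Longrightarrow>
     (\<integral>\<^sup>+h. ennreal (heat t (h :: real^'n) * norm h powr \<sigma>) \<partial>lborel) \<le> ennreal (C * t powr (\<sigma> / 2))"
    by (rule heat_moment[OF assms(1), where 'n = 'n]) (rule that)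
  have "(\<integral>\<^sup>+h. ennreal (gamma_weight (s / 2) t * heat t (h :: real^'n) * norm h powr \<sigma>) \<partial>lborel)
     \<le> ennreal C * ennreal (gamma_weight ((s + \<sigma>) / 2) t)" for t
  proof (cases "0 < t")
    case True
    have "(\<integral>\<^sup>+h. ennreal (gamma_weight (s / 2) t * heat t (h :: real^'n) * norm h powr \<sigma>) \<partial>lborel)
       = ennreal (gamma_weight (s / 2) t) * (\<integral>\<^sup>+h. ennreal (heat t (h :: real^'n) * norm h powr \<sigma>) \<partial>lborel)"
      by (subst nn_integral_cmult[symmetric]) (simp_all add: ennreal_mult'[symmetric] mult.assoc)
    also have "\<dots> \<le> ennreal (gamma_weight (s / 2) t) * ennreal (C * t powr (\<sigma> / 2))"
      by (intro mult_left_mono C(2) True) auto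
    also have "\<dots> = ennreal C * ennreal (gamma_weight (s / 2) t * t powr (\<sigma> / 2))"
      using C(1) by (simp add: ennreal_mult'[symmetric] mult_ac)
    finally show ?thesis unfolding gamma_weight_powr by (simp add: add_divide_distrib)
  qed (simp add: gamma_weight_def)
  then have "(\<integral>\<^sup>+t. \<integral>\<^sup>+h. ennreal (gamma_weight (s / 2) t * heat t (h :: real^'n) * norm h powr \<sigma>) \<partial>lborel \<partial>lborel)
      \<le> (\<integral>\<^sup>+t. ennreal C * ennreal (gamma_weight ((s + \<sigma>) / 2) t) \<partial>lborel)"
    by (intro nn_integral_mono)
  also have "\<dots> = ennreal C * ennreal (Gamma ((s + \<sigma>) / 2))"
    using assms(2) by (simp add: nn_integral_cmult nn_integral_gamma_weight)
  also have "\<dots> < \<infinity>" by (simp add: ennreal_mult_less_top)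
  finally show ?thesis .
qed

lemma bessel_kernel_moment_nn:
  assumes "0 \<le> \<sigma>" "0 < s + \<sigma>"
  shows "(\<integral>\<^sup>+h. ennreal (bessel_kernel s (h :: real^'n::finite) * norm h powr \<sigma>) \<partial>lborel) < \<infinity>"
proof -
  have "(\<integral>\<^sup>+h. ennreal (bessel_kernel s (h :: real^'n) * norm h powr \<sigma>) \<partial>lborel)
     \<le> (\<integral>\<^sup>+h. \<integral>\<^sup>+t. ennreal (gamma_weight (s / 2) t * heat t (h :: real^'n) * norm h powr \<sigma>) \<partial>lborel \<partial>lborel)"
  proof (rule nn_integral_mono)
    fix h :: "real^'n"
    have "ennreal (bessel_kernel s h * norm h powr \<sigma>) = ennreal (bessel_kernel s h) * ennreal (norm h powr \<sigma>)"
      by (simp add: ennreal_mult')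
    also have "\<dots> \<le> (\<integral>\<^sup>+t. ennreal (gamma_weight (s / 2) t * heat t h) \<partial>lborel) * ennreal (norm h powr \<sigma>)"
      by (intro mult_right_mono ennreal_bessel_kernel_le) auto
    also have "\<dots> = (\<integral>\<^sup>+t. ennreal (gamma_weight (s / 2) t * heat t h * norm h powr \<sigma>) \<partial>lborel)"
      by (subst nn_integral_multc[symmetric]) (auto simp: ennreal_mult' intro!: nn_integral_cong)
    finally show "ennreal (bessel_kernel s h * norm h powr \<sigma>) \<le> (\<integral>\<^sup>+t. ennreal (gamma_weight (s / 2) t * heat t h * norm h powr \<sigma>) \<partial>lborel)" .
  qed
  also have "\<dots> = (\<integral>\<^sup>+t. \<integral>\<^sup>+h. ennreal (gamma_weight (s / 2) t * heat t (h :: real^'n) * norm h powr \<sigma>) \<partial>lborel \<partial>lborel)"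
    by (rule lborel_pair.Fubini') measurable
  also have "\<dots> < \<infinity>" by (rule heat_moment_double[OF assms])
  finally show ?thesis .
qed

lemma bessel_kernel_moment:
  assumes "0 \<le> \<sigma>" "0 < s + \<sigma>"
  shows "integrable lborel (\<lambda>h :: real^'n::finite. bessel_kernel s h * norm h powr \<sigma>)"
  using bessel_kernel_moment_nn[OF assms, where 'n = 'n] by (intro integrableI_bounded) (auto simp: abs_mult)

lemma bessel_kernel_integrable:
  assumes "0 < s" shows "integrable lborel (bessel_kernel s :: real^'n::finite \<Rightarrow> real)"
proof -
  have "AE h :: real^'n in lborel. bessel_kernel s h * norm h powr 0 = bessel_kernel s h"
    using AE_lborel_singleton[of "0 :: real^'n"] by eventually_elim simp
  moreover have "integrable lborel (\<lambda>h :: real^'n. bessel_kernel s h * norm h powr 0)"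
    by (rule bessel_kernel_moment) (use assms in simp_all)
  ultimately show ?thesis
    by (rule_tac integrable_cong_AE_imp) measurable
qed

section \<open>Smoothness of the kernels and the Bessel symbols\<close>

text \<open>The parallelogram law for \<open>y\<close> and \<open>y + h\<close> around their midpoint.\<close>

lemma heat_geometric_mean:
  assumes t: "0 < t"
  shows "sqrt (heat t (y + h)) * sqrt (heat t y) = heat t (y + (1/2) *\<^sub>R h) * exp (- (norm (h :: real^'n))\<^sup>2 / (16 * t))"
proof -
  have par: "(norm (y + h))\<^sup>2 + (norm y)\<^sup>2 = 2 * (norm (y + (1/2) *\<^sub>R h))\<^sup>2 + (norm h)\<^sup>2 / 2"
    unfolding power2_norm_eq_inner by (simp add: inner_add inner_commute algebra_simps)
  let ?c = "(4 * pi * t) powr (- real CARD('n) / 2)"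
  have sq: "(k * a) * (k * b) = (k * z * w)\<^sup>2" if "a * b = (z * w)\<^sup>2" for k a b z w :: real
  proof -
    have "(k * a) * (k * b) = k\<^sup>2 * (a * b)" by (simp add: power2_eq_square)
    then show ?thesis unfolding that power_mult_distrib by (simp only: mult.assoc)
  qed
  define A B Z H where "A = (norm (y + h))\<^sup>2" and "B = (norm y)\<^sup>2" and "Z = (norm (y + (1/2) *\<^sub>R h))\<^sup>2" and "H = (norm h)\<^sup>2"
  have AB: "A + B = 2 * Z + H / 2" using par by (simp only: A_def B_def Z_def H_def)
  have "exp (- A / (4 * t)) * exp (- B / (4 * t)) = exp (- (A + B) / (4 * t))"
    unfolding exp_add[symmetric] by (simp add: diff_divide_distrib)
  also have "- (A + B) / (4 * t) = 2 * (- Z / (4 * t)) + 2 * (- H / (16 * t))"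
    unfolding AB using t by (simp add: field_simps)
  also have "exp \<dots> = (exp (- Z / (4 * t)) * exp (- H / (16 * t)))\<^sup>2"
    unfolding exp_add exp_double power_mult_distrib ..
  finally have "(?c * exp (- A / (4 * t))) * (?c * exp (- B / (4 * t))) = (?c * exp (- Z / (4 * t)) * exp (- H / (16 * t)))\<^sup>2"
    by (rule sq)
  then have "heat t (y + h) * heat t y = (heat t (y + (1/2) *\<^sub>R h) * exp (- (norm h)\<^sup>2 / (16 * t)))\<^sup>2"
    by (simp only: heat_def A_def B_def Z_def H_def)
  then show ?thesis by (simp add: real_sqrt_mult[symmetric])
qed

text \<open>The distance in total variation is bounded by the Hellinger distance, which is explicit for
Gaussians: for \<open>a\<^sup>2\<close>, \<open>b\<^sup>2\<close> the two densities, \<open>|a\<^sup>2 - b\<^sup>2| = |a - b|(a + b)\<close>, and the integral of \<open>ab\<close>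
is \<open>exp(-|h|\<^sup>2/16t)\<close>.\<close>

lemma heat_shift_difference:
  assumes t: "0 < t"
  shows "(\<integral>\<^sup>+y. ennreal \<bar>heat t (y + h) - heat t y\<bar> \<partial>lborel) \<le> ennreal (3 * (norm (h :: real^'n) / sqrt t))"
    and "(\<integral>\<^sup>+y. ennreal \<bar>heat t (y + h) - heat t (y :: real^'n)\<bar> \<partial>lborel) \<le> 2"
proof -
  note int = heat_integrable[OF t, where 'n = 'n]
  note int_h = integrable_shift[OF int]
  have I: "(LINT y|lborel. heat t (y + k)) = 1" for k :: "real^'n"
    by (subst integral_shift) (simp_all add: integral_heat[OF t])
  have "(\<integral>\<^sup>+y. ennreal \<bar>heat t (y + h) - heat t y\<bar> \<partial>lborel) \<le> (\<integral>\<^sup>+y. ennreal (heat t (y + h) + heat t y) \<partial>lborel)"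
    by (intro nn_integral_mono ennreal_leI) (simp add: abs_le_iff add_increasing add_increasing2)
  also have "\<dots> = ennreal (LINT y|lborel. heat t (y + h) + heat t y)"
    by (intro nn_integral_eq_integral Bochner_Integration.integrable_add int int_h) simp
  also have "(LINT y|lborel. heat t (y + h) + heat t y) = 2"
    using I[of 0] by (simp add: Bochner_Integration.integral_add[OF int_h int] I)
  finally show "(\<integral>\<^sup>+y. ennreal \<bar>heat t (y + h) - heat t y\<bar> \<partial>lborel) \<le> 2" by simp
  show "(\<integral>\<^sup>+y. ennreal \<bar>heat t (y + h) - heat t y\<bar> \<partial>lborel) \<le> ennreal (3 * (norm h / sqrt t))"
  proof (cases "h = 0")
    case True
    then show ?thesis by simp
  next
    case False
    \<comment> \<open>The weight in the elementary Young inequality, chosen to balance its two terms.\<close>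
    define \<mu> where "\<mu> = sqrt t / norm h"
    have \<mu>: "0 < \<mu>" using False t by (simp add: \<mu>_def)
    have young: "d * e \<le> (\<mu> / 2) * d\<^sup>2 + (1 / (2 * \<mu>)) * e\<^sup>2" for d e :: real
    proof -
      have "(\<mu> / 2) * d\<^sup>2 + (1 / (2 * \<mu>)) * e\<^sup>2 - d * e = (\<mu> * d - e)\<^sup>2 / (2 * \<mu>)"
        using \<mu> by (simp add: field_simps power2_eq_square)
      moreover have "0 \<le> (\<mu> * d - e)\<^sup>2 / (2 * \<mu>)" using \<mu> by simp
      ultimately show ?thesis by linarith
    qed
    define e where "e = exp (- (norm h)\<^sup>2 / (16 * t))"
    let ?g = "\<lambda>y. heat t (y + (1/2) *\<^sub>R h)"
    let ?F = "\<lambda>y. (\<mu> / 2) * (heat t (y + h) + heat t y - 2 * e * ?g y) + (1 / \<mu>) * (heat t (y + h) + heat t y)"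
    have pw: "\<bar>heat t (y + h) - heat t y\<bar> \<le> ?F y" for y
    proof -
      define a b where "a = sqrt (heat t (y + h))" and "b = sqrt (heat t y)"
      have ab: "a\<^sup>2 = heat t (y + h)" "b\<^sup>2 = heat t y" "a * b = ?g y * e" "0 \<le> a" "0 \<le> b"
        unfolding a_def b_def e_def by (simp_all add: heat_geometric_mean[OF t])
      have "\<bar>a\<^sup>2 - b\<^sup>2\<bar> = \<bar>a - b\<bar> * (a + b)" 
        using ab(4,5) by (simp add: power2_eq_square square_diff_square_factored abs_mult mult.commute)
      also have "\<dots> \<le> (\<mu> / 2) * (a - b)\<^sup>2 + (1 / (2 * \<mu>)) * (a + b)\<^sup>2"
        using young[of "\<bar>a - b\<bar>" "a + b"] by simp
      also have "(1 / (2 * \<mu>)) * (a + b)\<^sup>2 \<le> (1 / (2 * \<mu>)) * (2 * (a\<^sup>2 + b\<^sup>2))"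
      proof (rule mult_left_mono)
        have "0 \<le> (a - b)\<^sup>2" by simp
        then show "(a + b)\<^sup>2 \<le> 2 * (a\<^sup>2 + b\<^sup>2)" by (simp add: power2_sum power2_diff)
      qed (use \<mu> in simp)
      also have "(\<mu> / 2) * (a - b)\<^sup>2 + (1 / (2 * \<mu>)) * (2 * (a\<^sup>2 + b\<^sup>2)) = ?F y"
      proof -
        have "?F y = (\<mu> / 2) * (a\<^sup>2 + b\<^sup>2 - 2 * (a * b)) + (1 / \<mu>) * (a\<^sup>2 + b\<^sup>2)"
          unfolding ab(1-3) by (simp only: mult_ac)
        also have "\<dots> = (\<mu> / 2) * (a - b)\<^sup>2 + (1 / (2 * \<mu>)) * (2 * (a\<^sup>2 + b\<^sup>2))"
        proof -
          have "(1 / (2 * \<mu>)) * (2 * q) = (1 / \<mu>) * q" for q by simp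
          then show ?thesis by (simp only: power2_diff mult.assoc)
        qed
        finally show ?thesis by simp
      qed
      finally show ?thesis unfolding ab by simp
    qed
    have intF: "integrable lborel ?F"
      by (intro Bochner_Integration.integrable_add Bochner_Integration.integrable_diff integrable_mult_right int int_h)
    have "(\<integral>\<^sup>+y. ennreal \<bar>heat t (y + h) - heat t y\<bar> \<partial>lborel) \<le> (\<integral>\<^sup>+y. ennreal (?F y) \<partial>lborel)"
      by (intro nn_integral_mono ennreal_leI pw)
    also have "\<dots> = ennreal (LINT y|lborel. ?F y)"
      by (rule nn_integral_eq_integral[OF intF]) (intro AE_I2 order_trans[OF abs_ge_zero pw])
    also have "(LINT y|lborel. ?F y) = (\<mu> / 2) * (1 + 1 - 2 * e * 1) + (1 / \<mu>) * (1 + 1)"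
      using I[of 0] I[of h] I[of "(1/2) *\<^sub>R h"] int int_h[of h] int_h[of "(1/2) *\<^sub>R h"] by simp
    also have "\<dots> \<le> (\<mu> / 2) * ((norm h)\<^sup>2 / (8 * t)) + (1 / \<mu>) * 2"
    proof -
      have "1 + - (norm h)\<^sup>2 / (16 * t) \<le> e" unfolding e_def by (rule exp_ge_add_one_self)
      then have "1 + 1 - 2 * e * 1 \<le> (norm h)\<^sup>2 / (8 * t)" by simp
      then show ?thesis using \<mu> by (intro add_mono mult_left_mono) auto
    qed
    also have "\<dots> \<le> 3 * (norm h / sqrt t)"
    proof -
      have "\<mu> * (norm h)\<^sup>2 / t = norm h / sqrt t"
        using False t unfolding \<mu>_def by (simp add: field_simps power2_eq_square)
      then have "(\<mu> / 2) * ((norm h)\<^sup>2 / (8 * t)) = (norm h / sqrt t) / 16" by simp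
      moreover have "1 / \<mu> = norm h / sqrt t" by (simp add: \<mu>_def)
      moreover have "0 \<le> norm h / sqrt t" using t by simp
      ultimately show ?thesis by simp
    qed
    finally show ?thesis by (simp add: ennreal_leI)
  qed
qed

text \<open>Interpolation between the two bounds, according to whether \<open>|h|/\<surd>t\<close> is at most 1.\<close>

lemma heat_shift_difference_powr:
  assumes t: "0 < t" and \<sigma>: "0 \<le> \<sigma>" "\<sigma> \<le> 1" and h: "h \<noteq> 0"
  shows "(\<integral>\<^sup>+y. ennreal \<bar>heat t (y + h) - heat t y\<bar> \<partial>lborel) \<le> ennreal (3 * norm (h :: real^'n) powr \<sigma> * t powr (- \<sigma> / 2))"
proof -
  let ?r = "norm h / sqrt t"
  have r: "0 < ?r" using t h by simp
  have eq: "?r powr \<sigma> = norm h powr \<sigma> * t powr (- \<sigma> / 2)"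
  proof -
    have "?r powr \<sigma> = norm h powr \<sigma> / sqrt t powr \<sigma>" using t by (simp add: powr_divide)
    also have "sqrt t powr \<sigma> = t powr (\<sigma> / 2)"
      using t unfolding powr_half_sqrt[OF less_imp_le[OF t], symmetric] powr_powr by simp
    also have "norm h powr \<sigma> / t powr (\<sigma> / 2) = norm h powr \<sigma> * t powr (- \<sigma> / 2)"
      using powr_minus_divide[of t "\<sigma> / 2"] by simp
    finally show ?thesis .
  qed
  have "(\<integral>\<^sup>+y. ennreal \<bar>heat t (y + h) - heat t y\<bar> \<partial>lborel) \<le> ennreal (3 * ?r powr \<sigma>)"
  proof (cases "?r \<le> 1")
    case True
    have "?r powr 1 \<le> ?r powr \<sigma>" using True r \<sigma> by (intro powr_mono') auto
    moreover have "?r powr 1 = ?r" by (rule powr_one[OF less_imp_le[OF r]])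
    ultimately have "?r \<le> ?r powr \<sigma>" by (simp only:)
    then have "3 * ?r \<le> 3 * ?r powr \<sigma>" by (rule mult_left_mono) simp
    then show ?thesis using heat_shift_difference(1)[OF t, of h] by (meson ennreal_leI order_trans)
  next
    case False
    have "1 \<le> ?r powr \<sigma>" using False \<sigma> by (intro ge_one_powr_ge_zero) auto
    then have "ennreal 2 \<le> ennreal (3 * ?r powr \<sigma>)" by (intro ennreal_leI) simp
    then show ?thesis using heat_shift_difference(2)[OF t, of h] by (simp add: order_trans)
  qed
  then show ?thesis unfolding eq by (simp only: mult.assoc)
qed

lemma bessel_kernel_shift_difference:
  assumes \<sigma>: "0 \<le> \<sigma>" "\<sigma> \<le> 1" "\<sigma> < s"
  shows "(\<integral>\<^sup>+y. ennreal \<bar>bessel_kernel s (y + h) - bessel_kernel s y\<bar> \<partial>lborel) 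
     \<le> ennreal (3 * Gamma ((s - \<sigma>) / 2) * norm (h :: real^'n) powr \<sigma>)"
proof (cases "h = 0")
  case False
  let ?w = "gamma_weight (s / 2)"
  have AE: "AE y in lborel. y \<noteq> 0 \<and> y + h \<noteq> 0"
    using AE_lborel_singleton[of "0 :: real^'n"] AE_lborel_singleton[of "- h"]
    by eventually_elim (auto simp: eq_neg_iff_add_eq_0)
  have "(\<integral>\<^sup>+y. ennreal \<bar>bessel_kernel s (y + h) - bessel_kernel s y\<bar> \<partial>lborel)
     \<le> (\<integral>\<^sup>+y. \<integral>\<^sup>+t. ennreal (?w t) * ennreal \<bar>heat t (y + h) - heat t y\<bar> \<partial>lborel \<partial>lborel)"
  proof (rule nn_integral_mono_AE, use AE in eventually_elim)
    fix y assume y: "y \<noteq> 0 \<and> y + h \<noteq> 0"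
    have int: "integrable lborel (\<lambda>t. ?w t * heat t (y + h) - ?w t * heat t y)"
      using y by (intro Bochner_Integration.integrable_diff gamma_weight_heat_integrable) auto
    have "bessel_kernel s (y + h) - bessel_kernel s y = (LINT t|lborel. ?w t * heat t (y + h) - ?w t * heat t y)"
      unfolding bessel_kernel_def using y
      by (intro Bochner_Integration.integral_diff[symmetric] gamma_weight_heat_integrable) auto
    then have "ennreal \<bar>bessel_kernel s (y + h) - bessel_kernel s y\<bar> \<le> (\<integral>\<^sup>+t. ennreal (norm (?w t * heat t (y + h) - ?w t * heat t y)) \<partial>lborel)"
      using integral_norm_bound_ennreal[OF int] by simp
    also have "\<dots> = (\<integral>\<^sup>+t. ennreal (?w t) * ennreal \<bar>heat t (y + h) - heat t y\<bar> \<partial>lborel)"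
      by (intro nn_integral_cong) (simp add: ennreal_mult'[symmetric] abs_mult right_diff_distrib[symmetric])
    finally show "ennreal \<bar>bessel_kernel s (y + h) - bessel_kernel s y\<bar> \<le> (\<integral>\<^sup>+t. ennreal (?w t) * ennreal \<bar>heat t (y + h) - heat t y\<bar> \<partial>lborel)" .
  qed
  also have "\<dots> = (\<integral>\<^sup>+t. \<integral>\<^sup>+y. ennreal (?w t) * ennreal \<bar>heat t (y + h) - heat t y\<bar> \<partial>lborel \<partial>lborel)"
    by (rule lborel_pair.Fubini') measurable
  also have "\<dots> \<le> (\<integral>\<^sup>+t. ennreal (3 * norm h powr \<sigma>) * ennreal (gamma_weight ((s - \<sigma>) / 2) t) \<partial>lborel)"
  proof (rule nn_integral_mono)
    fix t
    show "(\<integral>\<^sup>+y. ennreal (?w t) * ennreal \<bar>heat t (y + h) - heat t y\<bar> \<partial>lborel) \<le> ennreal (3 * norm h powr \<sigma>) * ennreal (gamma_weight ((s - \<sigma>) / 2) t)"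
    proof (cases "0 < t")
      case True
      have "(\<integral>\<^sup>+y. ennreal (?w t) * ennreal \<bar>heat t (y + h) - heat t y\<bar> \<partial>lborel)
         = ennreal (?w t) * (\<integral>\<^sup>+y. ennreal \<bar>heat t (y + h) - heat t y\<bar> \<partial>lborel)"
        by (rule nn_integral_cmult) measurable
      also have "\<dots> \<le> ennreal (?w t) * ennreal (3 * norm h powr \<sigma> * t powr (- \<sigma> / 2))"
        by (intro mult_left_mono heat_shift_difference_powr True \<sigma> False) simp
      also have "\<dots> = ennreal (3 * norm h powr \<sigma>) * ennreal (?w t * t powr (- \<sigma> / 2))"
        by (simp add: ennreal_mult'[symmetric] mult_ac)
      also have "?w t * t powr (- \<sigma> / 2) = gamma_weight ((s - \<sigma>) / 2) t"
        unfolding gamma_weight_powr by (simp add: diff_divide_distrib)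
      finally show ?thesis .
    qed (simp add: gamma_weight_def)
  qed
  also have "\<dots> = ennreal (3 * norm h powr \<sigma>) * (\<integral>\<^sup>+t. ennreal (gamma_weight ((s - \<sigma>) / 2) t) \<partial>lborel)"
    by (rule nn_integral_cmult) measurable
  also have "\<dots> = ennreal (3 * norm h powr \<sigma>) * ennreal (Gamma ((s - \<sigma>) / 2))"
    using \<sigma> by (subst nn_integral_gamma_weight) auto
  also have "\<dots> = ennreal (3 * Gamma ((s - \<sigma>) / 2) * norm h powr \<sigma>)"
    using Gamma_real_pos[of "(s - \<sigma>) / 2"] \<sigma> by (simp add: ennreal_mult'[symmetric] mult_ac)
  finally show ?thesis .
qed simp

lemma integrable_gamma_heat_pair:
  assumes "0 \<le> \<sigma>" "0 < s + \<sigma>"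
  shows "integrable (lborel \<Otimes>\<^sub>M lborel) (\<lambda>(t, h :: real^'n::finite). gamma_weight (s / 2) t * heat t h * norm h powr \<sigma>)"
proof (rule integrableI_bounded)
  show "(\<lambda>(t, h :: real^'n). gamma_weight (s / 2) t * heat t h * norm h powr \<sigma>) \<in> borel_measurable (lborel \<Otimes>\<^sub>M lborel)"
    by measurable
  have "(\<integral>\<^sup>+x. ennreal (norm (case x of (t, h :: real^'n) \<Rightarrow> gamma_weight (s / 2) t * heat t h * norm h powr \<sigma>)) \<partial>(lborel \<Otimes>\<^sub>M lborel))
     = (\<integral>\<^sup>+t. \<integral>\<^sup>+h. ennreal (gamma_weight (s / 2) t * heat t (h :: real^'n) * norm h powr \<sigma>) \<partial>lborel \<partial>lborel)"
    by (subst lborel.nn_integral_fst[symmetric]) (auto simp: abs_mult)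
  then show "(\<integral>\<^sup>+x. ennreal (norm (case x of (t, h :: real^'n) \<Rightarrow> gamma_weight (s / 2) t * heat t h * norm h powr \<sigma>)) \<partial>(lborel \<Otimes>\<^sub>M lborel)) < \<infinity>"
    using heat_moment_double[OF assms, where 'n = 'n] by simp
qed

text \<open>The bound on \<open>g\<close> compensates the singularity of the kernel at the origin, so Fubini's theorem
allows the integral over time to be taken last.\<close>

lemma integral_bessel_kernel:
  fixes g :: "real^'n::finite \<Rightarrow> complex"
  assumes \<sigma>: "0 \<le> \<sigma>" "0 < s + \<sigma>" and [measurable]: "g \<in> borel_measurable borel" 
    and g: "\<And>h. h \<noteq> 0 \<Longrightarrow> norm (g h) \<le> C * norm h powr \<sigma>"
  shows "(LINT h|lborel. of_real (bessel_kernel s h) * g h) = (LINT t|lborel. of_real (gamma_weight (s / 2) t) * (LINT h|lborel. of_real (heat t h) * g h))"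
proof -
  let ?f = "\<lambda>t h. complex_of_real (gamma_weight (s / 2) t * heat t h) * g h"
  have AE0: "AE h :: real^'n in lborel. h \<noteq> 0" by (rule AE_lborel_singleton)
  have AE: "AE p in lborel \<Otimes>\<^sub>M lborel. snd p \<noteq> (0 :: real^'n)" 
  proof (rule lborel_pair.AE_pair_measure)
    show "{p \<in> space (lborel \<Otimes>\<^sub>M lborel). snd p \<noteq> (0 :: real^'n)} \<in> sets (lborel \<Otimes>\<^sub>M lborel)" by measurable
  qed (simp add: AE_lborel_singleton)
  have int: "integrable (lborel \<Otimes>\<^sub>M lborel) (case_prod ?f)"
  proof (rule Bochner_Integration.integrable_bound[OF integrable_mult_right[OF integrable_gamma_heat_pair[OF \<sigma>, where 'n = 'n], of C]])
    show "AE p in lborel \<Otimes>\<^sub>M lborel. norm (case_prod ?f p) \<le> norm (C * (case p of (t, h) \<Rightarrow> gamma_weight (s / 2) t * heat t h * norm h powr \<sigma>))"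
      using AE
    proof eventually_elim
      fix p :: "real \<times> (real^'n)" assume "snd p \<noteq> 0"
      then have h: "snd p \<noteq> 0" .
      have C0: "0 \<le> C * norm (snd p) powr \<sigma>" using g[OF h] norm_ge_zero order_trans by blast
      have "norm (case_prod ?f p) = gamma_weight (s / 2) (fst p) * heat (fst p) (snd p) * norm (g (snd p))"
        by (simp add: split_beta norm_mult abs_mult)
      also have "\<dots> \<le> gamma_weight (s / 2) (fst p) * heat (fst p) (snd p) * (C * norm (snd p) powr \<sigma>)"
        by (intro mult_left_mono g h) simp
      also have "\<dots> = C * (gamma_weight (s / 2) (fst p) * heat (fst p) (snd p) * norm (snd p) powr \<sigma>)" by (simp add: mult_ac)
      finally show "norm (case_prod ?f p) \<le> norm (C * (case p of (t, h) \<Rightarrow> gamma_weight (s / 2) t * heat t h * norm h powr \<sigma>))"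
        by (simp add: split_beta)
    qed
  qed measurable
  have "(LINT h|lborel. of_real (bessel_kernel s h) * g h) = (LINT h|lborel. LINT t|lborel. ?f t h)"
  proof (rule integral_cong_AE)
    show "AE h in lborel. of_real (bessel_kernel s h) * g h = (LINT t|lborel. ?f t h)"
      using AE0
    proof eventually_elim
      fix h :: "real^'n"
      have "(LINT t|lborel. complex_of_real (gamma_weight (s / 2) t * heat t h)) = of_real (bessel_kernel s h)"
        unfolding bessel_kernel_def by (rule integral_complex_of_real)
      then show "of_real (bessel_kernel s h) * g h = (LINT t|lborel. ?f t h)" by simp
    qed
  qed measurable
  also have "\<dots> = (LINT t|lborel. LINT h|lborel. ?f t h)"
    by (rule lborel_pair.Fubini_integral[OF int])
  also have "\<dots> = (LINT t|lborel. of_real (gamma_weight (s / 2) t) * (LINT h|lborel. of_real (heat t h) * g h))"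
    by (intro Bochner_Integration.integral_cong refl) (simp add: mult.assoc)
  finally show ?thesis .
qed

lemma ft_bessel_kernel:
  assumes s: "0 < s" and c: "c\<^sup>2 = 4 * pi\<^sup>2"
  shows "ft c (\<lambda>h. of_real (bessel_kernel s h)) \<xi> = of_real (Gamma (s / 2) * bracket_sq (\<xi> :: real^'n::finite) powr (- s / 2))"
proof -
  let ?\<mu> = "c\<^sup>2 * (norm \<xi>)\<^sup>2"
  have "ft c (\<lambda>h. of_real (bessel_kernel s h)) \<xi> = (LINT t|lborel. of_real (gamma_weight (s / 2) t) * (LINT h|lborel. of_real (heat t h) * iexp (c * (h \<bullet> \<xi>))))"
    unfolding ft_def 
  proof (rule integral_bessel_kernel[where \<sigma> = 0 and C = 1])
    show "norm (iexp (c * (h \<bullet> \<xi>))) \<le> 1 * norm h powr 0" if "h \<noteq> 0" for h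
      using that by (simp only: norm_exp_i_times) simp
  qed (use s in auto)
  also have "\<dots> = (LINT t|lborel. complex_of_real (gamma_weight (s / 2) t * exp (- t * ?\<mu>)))"
  proof (intro Bochner_Integration.integral_cong refl)
    fix t
    show "of_real (gamma_weight (s / 2) t) * (LINT h|lborel. of_real (heat t h) * iexp (c * (h \<bullet> \<xi>))) = complex_of_real (gamma_weight (s / 2) t * exp (- t * ?\<mu>))"
    proof (cases "0 < t")
      case True
      have "(LINT h|lborel. of_real (heat t h) * iexp (c * (h \<bullet> \<xi>))) = of_real (exp (- t * ?\<mu>))"
        using ft_heat[OF True, of c \<xi>] unfolding ft_def by (simp only: mult.assoc)
      then show ?thesis by (simp only: of_real_mult)
    qed (simp add: gamma_weight_def)
  qed
  also have "\<dots> = of_real (LINT t|lborel. gamma_weight (s / 2) t * exp (- t * ?\<mu>))"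
    by (rule integral_complex_of_real)
  also have "(LINT t|lborel. gamma_weight (s / 2) t * exp (- t * ?\<mu>)) = Gamma (s / 2) * (1 + ?\<mu>) powr (- (s / 2))"
    using nn_integral_gamma_weight_exp[of "s / 2" ?\<mu>] s Gamma_real_pos[of "s / 2"]
    by (subst integral_eq_nn_integral) (auto simp: mult.assoc[symmetric])
  also have "1 + ?\<mu> = bracket_sq \<xi>" unfolding bracket_sq_def c by simp
  finally show ?thesis by simp
qed

text \<open>The Levy-Khintchine formula for a fractional power of the Bessel symbol. The bound
\<open>|1 - e\<^bsup>i\<theta>\<^esup>| \<le> |\<theta>|\<close> and \<open>2a < 1\<close> give absolute convergence.\<close>

lemma bessel_kernel_negative_order:
  assumes a: "0 < a" "2 * a < 1" and c: "c\<^sup>2 = 4 * pi\<^sup>2"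
  shows "(LINT h|lborel. of_real (bessel_kernel (- 2 * a) h) * (1 - iexp (c * (h \<bullet> \<xi>))))
     = of_real (Gamma (1 - a) / a * (bracket_sq (\<xi> :: real^'n::finite) powr a - 1))"
proof -
  let ?\<mu> = "c\<^sup>2 * (norm \<xi>)\<^sup>2" and ?s = "- 2 * a"
  have "(LINT h|lborel. of_real (bessel_kernel ?s h) * (1 - iexp (c * (h \<bullet> \<xi>)))) = (LINT t|lborel. of_real (gamma_weight (?s / 2) t) * (LINT h|lborel. of_real (heat t h) * (1 - iexp (c * (h \<bullet> \<xi>)))))"
  proof (rule integral_bessel_kernel[where \<sigma> = 1 and C = "\<bar>c\<bar> * norm \<xi>"])
    show "norm (1 - iexp (c * (h \<bullet> \<xi>))) \<le> \<bar>c\<bar> * norm \<xi> * norm h powr 1" for h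
      using norm_one_minus_iexp_le[of c h \<xi>] by (simp add: mult_ac)
  qed (use a in auto)
  also have "\<dots> = (LINT t|lborel. complex_of_real (gamma_weight (- a) t * (1 - exp (- t * ?\<mu>))))"
  proof (intro Bochner_Integration.integral_cong refl)
    fix t
    show "of_real (gamma_weight (?s / 2) t) * (LINT h|lborel. of_real (heat t h) * (1 - iexp (c * (h \<bullet> \<xi>)))) = complex_of_real (gamma_weight (- a) t * (1 - exp (- t * ?\<mu>)))"
    proof (cases "0 < t")
      case True
      have int: "integrable lborel (\<lambda>h :: real^'n. complex_of_real (heat t h))" by (intro schwartz_integrable schwartz_heat True)
      have "(LINT h|lborel. of_real (heat t h) * (1 - iexp (c * (h \<bullet> \<xi>)))) = (LINT h|lborel. of_real (heat t (h :: real^'n))) - ft c (\<lambda>h. of_real (heat t h)) \<xi>"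
        unfolding ft_def right_diff_distrib mult_1_right
        by (rule Bochner_Integration.integral_diff[OF int integrable_times_iexp[OF int]])
      also have "\<dots> = of_real (1 - exp (- t * ?\<mu>))"
        unfolding ft_heat[OF True] integral_complex_of_real integral_heat[OF True] by (simp add: mult.assoc)
      finally show ?thesis by simp
    qed (simp add: gamma_weight_def)
  qed
  also have "\<dots> = of_real (LINT t|lborel. gamma_weight (- a) t * (1 - exp (- t * ?\<mu>)))"
    by (rule integral_complex_of_real)
  also have "(LINT t|lborel. gamma_weight (- a) t * (1 - exp (- t * ?\<mu>))) = Gamma (1 - a) / a * ((1 + ?\<mu>) powr a - 1)"
  proof -
    have nn: "0 \<le> gamma_weight (- a) t * (1 - exp (- t * ?\<mu>))" for t
      by (cases "0 < t") (auto simp: gamma_weight_def intro!: mult_nonneg_nonneg)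
    have "0 \<le> (1 + ?\<mu>) powr a - 1" using a by (simp add: ge_one_powr_ge_zero)
    then have "0 \<le> Gamma (1 - a) / a * ((1 + ?\<mu>) powr a - 1)"
      using a Gamma_real_pos[of "1 - a"] by (intro mult_nonneg_nonneg) auto
    then show ?thesis
      using nn_integral_gamma_weight_diff[of a ?\<mu>] a nn by (subst integral_eq_nn_integral) auto
  qed
  also have "1 + ?\<mu> = bracket_sq \<xi>" unfolding bracket_sq_def c by simp
  finally show ?thesis .
qed

text \<open>The transpose of the Bessel potential of order \<open>s\<close>: the inverse transform comes first, as it does
when the potential of a distribution is evaluated at a test function.\<close>

definition bessel_op :: "real \<Rightarrow> (real^'n::finite \<Rightarrow> complex) \<Rightarrow> real^'n \<Rightarrow> complex" where
  "bessel_op s f = ft (- 2 * pi) (\<lambda>\<xi>. of_real (bracket_sq \<xi> powr (- s / 2)) * ft (2 * pi) f \<xi>)"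

lemma schwartz_bessel_op: "f \<in> schwartz \<Longrightarrow> bessel_op s f \<in> schwartz"
  unfolding bessel_op_def by (intro schwartz_ft schwartz_bracket_sq_mult) auto

lemma bessel_op_inverse: 
  assumes "f \<in> schwartz" shows "bessel_op (- s) (bessel_op s f) = f"
proof -
  let ?g = "\<lambda>\<xi>. of_real (bracket_sq \<xi> powr (- s / 2)) * ft (2 * pi) f \<xi>"
  have "?g \<in> schwartz" by (intro schwartz_ft schwartz_bracket_sq_mult assms) auto
  then have "ft (2 * pi) (bessel_op s f) = ?g"
    unfolding bessel_op_def by (rule inv_fourier_fourier)
  then have "bessel_op (- s) (bessel_op s f) = ft (- 2 * pi) (\<lambda>\<xi>. of_real (bracket_sq \<xi> powr (s / 2)) * (of_real (bracket_sq \<xi> powr (- s / 2)) * ft (2 * pi) f \<xi>))"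
    unfolding bessel_op_def[of "- s"] by simp
  also have "(\<lambda>\<xi>. of_real (bracket_sq \<xi> powr (s / 2)) * (of_real (bracket_sq \<xi> powr (- s / 2)) * ft (2 * pi) f \<xi>)) = ft (2 * pi) f"
  proof
    fix \<xi> :: "real^'a"
    have "bracket_sq \<xi> powr (s / 2) * bracket_sq \<xi> powr (- s / 2) = 1"
      using bracket_sq_pos[of \<xi>] by (simp add: powr_add[symmetric])
    then show "of_real (bracket_sq \<xi> powr (s / 2)) * (of_real (bracket_sq \<xi> powr (- s / 2)) * ft (2 * pi) f \<xi>) = ft (2 * pi) f \<xi>"
      by (simp only: mult.assoc[symmetric] of_real_mult[symmetric] of_real_1 mult_1_left)
  qed
  finally show ?thesis using fourier_inv_fourier[OF assms] by simp
qed

lemma bessel_op_positive: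
  fixes f :: "real^'n::finite \<Rightarrow> complex"
  assumes s: "0 < s" and f: "f \<in> schwartz"
  shows "bessel_op s f x = (LINT h|lborel. of_real (bessel_kernel s h / Gamma (s / 2)) * f (x + h))"
proof -
  let ?c = "- 2 * pi" and ?k = "\<lambda>h::real^'n. complex_of_real (bessel_kernel s h / Gamma (s / 2))"
  have G: "0 < Gamma (s / 2)" using s by (intro Gamma_real_pos) simp
  have k: "integrable lborel ?k"
    using bessel_kernel_integrable[OF s, where 'n = 'n] by (intro integrable_of_real) simp
  have "ft ?c ?k \<xi> = of_real (bracket_sq \<xi> powr (- s / 2))" for \<xi>
  proof -
    have "ft ?c ?k \<xi> = of_real (inverse (Gamma (s / 2))) * ft ?c (\<lambda>h. of_real (bessel_kernel s h)) \<xi>"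
    proof -
      have "?k = (\<lambda>h. of_real (inverse (Gamma (s / 2))) * of_real (bessel_kernel s h))"
        by (simp only: divide_inverse of_real_mult mult.commute)
      then have "ft ?c ?k \<xi> = ft ?c (\<lambda>h. of_real (inverse (Gamma (s / 2))) * of_real (bessel_kernel s h)) \<xi>"
        by (simp only:)
      also have "\<dots> = of_real (inverse (Gamma (s / 2))) * ft ?c (\<lambda>h. of_real (bessel_kernel s h)) \<xi>"
        unfolding ft_def mult.assoc by (rule integral_mult_right_zero)
      finally show ?thesis .
    qed
    also have "\<dots> = of_real (inverse (Gamma (s / 2)) * (Gamma (s / 2) * bracket_sq \<xi> powr (- s / 2)))"
      by (subst ft_bessel_kernel[OF s]) (simp_all add: power_mult_distrib)
    finally show ?thesis using G by simp
  qed
  then have "bessel_op s f x = ft ?c (\<lambda>\<xi>. ft ?c ?k \<xi> * ft (2 * pi) f \<xi>) x"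
    unfolding bessel_op_def by simp
  also have "\<dots> = (LINT h|lborel. ?k h * ft ?c (ft (2 * pi) f) (x + h))"
    by (rule ft_ft_mult[OF k]) (intro schwartz_integrable schwartz_ft f, simp)
  finally show ?thesis unfolding fourier_inv_fourier[OF f] .
qed

text \<open>The symbol is replaced by its Levy-Khintchine formula, and the frequency integral is carried out
first: multiplication by a character becomes translation of \<open>f\<close>.\<close>

lemma bessel_op_negative:
  fixes f :: "real^'n::finite \<Rightarrow> complex"
  assumes s: "0 < s" "s < 1" and f: "f \<in> schwartz"
  defines "C \<equiv> (s / 2) / Gamma (1 - s / 2)"
  shows "bessel_op (- s) f x = f x + of_real C * (LINT h|lborel. of_real (bessel_kernel (- s) h) * (f x - f (x + h)))"
proof -
  let ?c = "- 2 * pi" and ?K = "bessel_kernel (- s)"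
  define g where "g = ft (2 * pi) f"
  have g: "g \<in> schwartz" unfolding g_def by (intro schwartz_ft f) simp
  have [measurable]: "g \<in> borel_measurable borel" using g by (rule schwartz_measurable)
  have gf: "ft ?c g = f" unfolding g_def by (rule fourier_inv_fourier[OF f])
  have G: "0 < Gamma (1 - s / 2)" using s by (intro Gamma_real_pos) simp
  have symbol: "complex_of_real (bracket_sq \<xi> powr (s / 2)) = 1 + of_real C * (LINT h|lborel. of_real (?K h) * (1 - iexp (?c * (h \<bullet> \<xi>))))" for \<xi> :: "real^'n"
  proof -
    have "C * (Gamma (1 - s / 2) / (s / 2) * (bracket_sq \<xi> powr (s / 2) - 1)) = bracket_sq \<xi> powr (s / 2) - 1"
    proof -
      have "(s / 2) / G * (G / (s / 2) * Y) = Y" if "G \<noteq> 0" for G Y :: real using that s by simp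
      from this[OF less_imp_neq[OF G, symmetric]] show ?thesis unfolding C_def .
    qed
    moreover have "(LINT h|lborel. of_real (?K h) * (1 - iexp (?c * (h \<bullet> \<xi>)))) = complex_of_real (Gamma (1 - s / 2) / (s / 2) * (bracket_sq \<xi> powr (s / 2) - 1))"
      using bessel_kernel_negative_order[of "s / 2" ?c \<xi>] s by (simp add: power_mult_distrib del: of_real_mult)
    ultimately show ?thesis by (simp only: of_real_mult[symmetric]) simp
  qed
  let ?F = "\<lambda>\<xi> h. of_real (?K h) * (1 - iexp (?c * (h \<bullet> \<xi>))) * (g \<xi> * iexp (?c * (\<xi> \<bullet> x)))"
  have [measurable]: "(\<lambda>(\<xi>::real^'n, h). iexp (?c * (h \<bullet> \<xi>))) \<in> borel_measurable (lborel \<Otimes>\<^sub>M lborel)"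
    using iexp_pair_measurable[of ?c 0] by simp
  have int: "integrable (lborel \<Otimes>\<^sub>M lborel) (case_prod ?F)"
  proof (rule integrable_pair_dominated)
    let ?a = "\<lambda>\<xi>. (1 + norm \<xi>) ^ 1 * norm (g \<xi>)" and ?b = "\<lambda>h::real^'n. 2 * pi * (?K h * norm h powr 1)"
    show "integrable (lborel \<Otimes>\<^sub>M lborel) (\<lambda>(\<xi>, h). ?a \<xi> * ?b h)"
      using s by (intro integrable_pair_mult schwartz_integrable_weighted g integrable_mult_right bessel_kernel_moment) auto
    fix \<xi> h :: "real^'n"
    have "norm (1 - iexp (?c * (h \<bullet> \<xi>))) \<le> \<bar>?c\<bar> * (norm h * norm \<xi>)" by (rule norm_one_minus_iexp_le)
    also have "\<dots> \<le> \<bar>?c\<bar> * (norm h * (1 + norm \<xi>))" by (intro mult_left_mono) auto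
    finally have e: "norm (1 - iexp (?c * (h \<bullet> \<xi>))) \<le> 2 * pi * (norm h * (1 + norm \<xi>))" by simp
    have "norm (?F \<xi> h) = ?K h * norm (1 - iexp (?c * (h \<bullet> \<xi>))) * norm (g \<xi>)"
      by (simp only: norm_mult norm_exp_i_times norm_of_real) simp
    also have "\<dots> \<le> ?K h * (2 * pi * (norm h * (1 + norm \<xi>))) * norm (g \<xi>)"
      by (intro mult_right_mono mult_left_mono e) auto
    also have "\<dots> = ?a \<xi> * ?b h" by simp
    finally show "norm (?F \<xi> h) \<le> ?a \<xi> * ?b h" .
  qed measurable
  have gi: "integrable lborel (\<lambda>\<xi>. g \<xi> * iexp (?c * (\<xi> \<bullet> y)))" for y
    by (intro integrable_times_iexp schwartz_integrable g)
  have F1: "integrable lborel (\<lambda>\<xi>. LINT h|lborel. ?F \<xi> h)"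
    using lborel_pair.integrable_fst'[OF int] by simp
  have "bessel_op (- s) f x = (LINT \<xi>|lborel. g \<xi> * iexp (?c * (\<xi> \<bullet> x)) + of_real C * (LINT h|lborel. ?F \<xi> h))"
    unfolding bessel_op_def g_def[symmetric] ft_def[of ?c "\<lambda>\<xi>. _ \<xi> * g \<xi>"]
  proof (intro Bochner_Integration.integral_cong refl)
    fix \<xi>
    show "of_real (bracket_sq \<xi> powr (- (- s) / 2)) * g \<xi> * iexp (?c * (\<xi> \<bullet> x)) = g \<xi> * iexp (?c * (\<xi> \<bullet> x)) + of_real C * (LINT h|lborel. ?F \<xi> h)"
      unfolding minus_minus symbol integral_mult_left_zero by (simp only: distrib_right mult_1_left mult.assoc)
  qed
  also have "\<dots> = ft ?c g x + of_real C * (LINT \<xi>|lborel. LINT h|lborel. ?F \<xi> h)"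
    unfolding ft_def by (subst Bochner_Integration.integral_add[OF gi integrable_mult_right[OF F1]]) simp
  also have "(LINT \<xi>|lborel. LINT h|lborel. ?F \<xi> h) = (LINT h|lborel. LINT \<xi>|lborel. ?F \<xi> h)"
    by (rule lborel_pair.Fubini_integral[symmetric, OF int])
  also have "\<dots> = (LINT h|lborel. of_real (?K h) * (f x - f (x + h)))"
  proof (intro Bochner_Integration.integral_cong refl)
    fix h
    have "iexp (?c * (h \<bullet> \<xi>)) * iexp (?c * (\<xi> \<bullet> x)) = iexp (?c * (\<xi> \<bullet> (x + h)))" for \<xi>
      unfolding exp_add[symmetric] by (simp add: inner_add_right inner_commute algebra_simps)
    then have "?F \<xi> h = of_real (?K h) * (g \<xi> * iexp (?c * (\<xi> \<bullet> x)) - g \<xi> * iexp (?c * (\<xi> \<bullet> (x + h))))" for \<xi>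
      by (simp only: left_diff_distrib right_diff_distrib mult_1_left mult_ac)
    then have "(LINT \<xi>|lborel. ?F \<xi> h) = of_real (?K h) * (ft ?c g x - ft ?c g (x + h))"
      unfolding ft_def by (simp only: integral_mult_right_zero Bochner_Integration.integral_diff[OF gi gi])
    then show "(LINT \<xi>|lborel. ?F \<xi> h) = of_real (?K h) * (f x - f (x + h))" unfolding gf .
  qed
  finally show ?thesis unfolding gf .
qed

text \<open>On the parabolic time scale \<open>|h|\<^sup>2 \<le> t \<le> 2|h|\<^sup>2\<close> the integrand is comparable to a power of \<open>|h|\<close>.
Together with integrability of the kernel this bounds the integrals of \<open>|h|\<^bsup>s-n\<^esup>\<close> near the origin.\<close>

lemma bessel_kernel_lower_bound:
  assumes s: "0 < s"
  obtains c where "0 < c" "\<And>h :: real^'n::finite. h \<noteq> 0 \<Longrightarrow> norm h \<le> 1 \<Longrightarrow> c * norm h powr (s - real CARD('n)) \<le> bessel_kernel s h"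
proof -
  let ?n = "real CARD('n)"
  define e where "e = s / 2 - 1 - ?n / 2"
  define m where "m = min 1 (2 powr e)"
  have m: "0 < m" by (simp add: m_def)
  define c where "c = (4 * pi) powr (- ?n / 2) * (m * exp (- 2) * exp (- 1 / 4))"
  have c: "0 < c" using m by (simp add: c_def)
  have "c * norm h powr (s - ?n) \<le> bessel_kernel s h" if h: "h \<noteq> 0" "norm h \<le> 1" for h :: "real^'n"
  proof -
    define r where "r = (norm h)\<^sup>2"
    have r: "0 < r" "r \<le> 1" using h power_le_one[of "norm h" 2] by (simp_all add: r_def)
    have low: "c * r powr e * indicator {r..2 * r} t \<le> gamma_weight (s / 2) t * heat t h" for t
    proof (cases "t \<in> {r..2 * r}")
      case True
      then have t: "r \<le> t" "t \<le> 2 * r" "0 < t" using r by auto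
      have a1: "m * r powr e \<le> t powr e"
      proof (cases "0 \<le> e")
        case True
        have "m * r powr e \<le> 1 * r powr e" unfolding m_def by (intro mult_right_mono) auto
        also have "\<dots> \<le> t powr e" using True t r by (simp add: powr_mono2)
        finally show ?thesis .
      next
        case False
        have "m * r powr e \<le> 2 powr e * r powr e" unfolding m_def by (intro mult_right_mono) auto
        also have "\<dots> = (2 * r) powr e" using r by (simp add: powr_mult)
        also have "\<dots> \<le> t powr e" using False t r by (intro powr_mono2') auto
        finally show ?thesis .
      qed
      have a2: "exp (- 2) \<le> exp (- t)" using t r by simp
      have a3: "exp (- 1 / 4) \<le> exp (- r / (4 * t))" using t by (simp add: pos_divide_le_eq)
      have "(m * r powr e) * (exp (- 2) * exp (- 1 / 4)) \<le> t powr e * (exp (- t) * exp (- r / (4 * t)))"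
        using m by (intro mult_mono a1 a2 a3) auto
      then have "(4 * pi) powr (- ?n / 2) * ((m * r powr e) * (exp (- 2) * exp (- 1 / 4))) \<le> (4 * pi) powr (- ?n / 2) * (t powr e * (exp (- t) * exp (- r / (4 * t))))"
        by (rule mult_left_mono) simp
      also have "\<dots> = gamma_weight (s / 2) t * heat t h"
      proof -
        have "t powr e = t powr (s / 2 - 1) * t powr (- ?n / 2)" unfolding e_def powr_add[symmetric] by simp
        moreover have "(4 * pi * t) powr (- ?n / 2) = (4 * pi) powr (- ?n / 2) * t powr (- ?n / 2)" using t by (simp add: powr_mult)
        moreover have "gamma_weight (s / 2) t = t powr (s / 2 - 1) * exp (- t)" using t by (simp add: gamma_weight_def)
        ultimately show ?thesis unfolding heat_def r_def by (simp only: mult_ac)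
      qed
      finally show ?thesis using True by (simp add: c_def mult_ac)
    qed simp
    have "ennreal (c * r powr e * r) = (\<integral>\<^sup>+t. ennreal (c * r powr e) * indicator {r..2 * r} t \<partial>lborel)"
      using r c by (simp add: nn_integral_cmult ennreal_mult'[symmetric])
    also have "\<dots> \<le> (\<integral>\<^sup>+t. ennreal (gamma_weight (s / 2) t * heat t h) \<partial>lborel)"
    proof (rule nn_integral_mono)
      fix t
      have "ennreal (c * r powr e) * indicator {r..2 * r} t = ennreal (c * r powr e * indicator {r..2 * r} t)"
        by (simp add: indicator_def)
      then show "ennreal (c * r powr e) * indicator {r..2 * r} t \<le> ennreal (gamma_weight (s / 2) t * heat t h)"
        using ennreal_leI[OF low] by (simp only:)
    qed
    also have "\<dots> = ennreal (bessel_kernel s h)"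
      unfolding bessel_kernel_def by (rule nn_integral_eq_integral[OF gamma_weight_heat_integrable[OF h(1)]]) simp
    finally have "c * r powr e * r \<le> bessel_kernel s h" by (simp add: ennreal_le_iff)
    moreover have "r powr e * r = norm h powr (s - ?n)"
    proof -
      have "r powr e * r = r powr (e + 1)" using r by (simp add: powr_add)
      also have "\<dots> = (norm h powr 2) powr (e + 1)" using h by (simp add: r_def)
      also have "\<dots> = norm h powr (2 * (e + 1))" by (rule powr_powr)
      also have "2 * (e + 1) = s - ?n" by (simp add: e_def)
      finally show ?thesis .
    qed
    ultimately show ?thesis by (simp add: mult.assoc)
  qed
  then show ?thesis using c by (rule_tac that)
qed

section \<open>Weighted Jensen inequality and convolution in Lebesgue spaces\<close>

text \<open>The \<open>p\<close>-th power of the norm, as an extended value that makes sense before integrability is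
known.\<close>

definition Lp_int :: "real \<Rightarrow> (real^'n::finite \<Rightarrow> complex) \<Rightarrow> ennreal" where
  "Lp_int p u = (\<integral>\<^sup>+x. ennreal (norm (u x) powr p) \<partial>lborel)"

lemma Lp_iff: "u \<in> Lp p \<longleftrightarrow> u \<in> borel_measurable borel \<and> Lp_int p u < \<infinity>"
proof -
  have "integrable lborel (\<lambda>x. norm (u x) powr p) \<longleftrightarrow> Lp_int p u < \<infinity>" if [measurable]: "u \<in> borel_measurable borel"
    unfolding Lp_int_def integrable_iff_bounded by simp
  then show ?thesis unfolding Lp_def by auto
qed

lemma Lp_measurable [measurable_dest]: "u \<in> Lp p \<Longrightarrow> u \<in> borel_measurable borel"
  by (simp add: Lp_iff)

text \<open>The tangent line of the convex function \<open>x\<^bsup>p\<^esup>\<close> at \<open>m\<close>, in the form of Young's inequality for \<open>x\<close> and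
\<open>m\<^bsup>p-1\<^esup>\<close>.\<close>

lemma powr_tangent:
  fixes x m p :: real
  assumes p: "1 < p" and "0 \<le> x" "0 \<le> m"
  shows "m powr p + p * m powr (p - 1) * (x - m) \<le> x powr p"
proof -
  define q where "q = p / (p - 1)"
  have q: "1 < q" "1 / p + 1 / q = 1" "p / q = p - 1" "(p - 1) * q = p" 
    using p by (simp_all add: q_def field_simps)
  have "x * m powr (p - 1) \<le> x powr p / p + (m powr (p - 1)) powr q / q"
    using assms q by (intro Youngs_inequality) auto
  then have "p * (x * m powr (p - 1)) \<le> p * (x powr p / p + m powr p / q)"
    unfolding powr_powr q(4) using p by (intro mult_left_mono) auto
  also have "\<dots> = x powr p + (p - 1) * m powr p"
  proof -
    have "p * (m powr p / q) = (p / q) * m powr p" by simp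
    then show ?thesis unfolding q(3) using p by (simp add: distrib_left)
  qed
  finally have *: "p * (x * m powr (p - 1)) \<le> x powr p + (p - 1) * m powr p" .
  have "m powr (p - 1) * m = m powr p" using assms by (cases "m = 0") (simp_all add: powr_diff)
  then have "m powr p + p * m powr (p - 1) * (x - m) = p * (x * m powr (p - 1)) - (p - 1) * m powr p"
    by (simp add: algebra_simps)
  with * show ?thesis by simp
qed

lemma le_one_plus_powr: "1 < p \<Longrightarrow> 0 \<le> (x::real) \<Longrightarrow> x \<le> 1 + x powr p"
proof (cases "x \<le> 1")
  case False
  assume "1 < p"
  then have "x powr 1 \<le> x powr p" using False by (intro powr_mono) auto
  then show ?thesis using False by simp
qed (simp add: add_increasing2)

text \<open>The tangent inequality is integrated against \<open>k\<close>, with the tangent taken at the mean \<open>m\<close> of \<open>|F|\<close>.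
If the right-hand side is finite, the integral of \<open>k|F|\<close> exists because \<open>x \<le> 1 + x\<^bsup>p\<^esup>\<close>.\<close>

lemma weighted_jensen:
  fixes F :: "'a \<Rightarrow> complex"
  assumes p: "1 < p" and k: "integrable M k" "\<And>y. 0 \<le> k y" and [measurable]: "F \<in> borel_measurable M"
  shows "ennreal (norm (LINT y|M. of_real (k y) * F y) powr p) 
     \<le> ennreal ((LINT y|M. k y) powr (p - 1)) * (\<integral>\<^sup>+y. ennreal (k y * norm (F y) powr p) \<partial>M)"
proof -
  define W where "W = (LINT y|M. k y)"
  have W: "0 \<le> W" unfolding W_def using k(2) by (rule Bochner_Integration.integral_nonneg)
  have [measurable]: "k \<in> borel_measurable M" using k by auto
  let ?I = "LINT y|M. of_real (k y) * F y"
  show ?thesis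
  proof (cases "W = 0")
    case True
    then have "AE y in M. k y = 0" using integral_nonneg_eq_0_iff_AE[OF k(1)] k(2) unfolding W_def by simp
    then have "AE y in M. of_real (k y) * F y = 0" by eventually_elim simp
    then have "?I = (LINT y|M. 0)" by (intro integral_cong_AE) auto
    then show ?thesis using p by simp
  next
    case False
    with W have W0: "0 < W" by simp
    show ?thesis
    proof (cases "(\<integral>\<^sup>+y. ennreal (k y * norm (F y) powr p) \<partial>M) = \<infinity>")
      case True
      have "ennreal (W powr (p - 1)) \<noteq> 0" using W0 by (simp add: ennreal_eq_0_iff)
      then show ?thesis unfolding True W_def[symmetric] by (simp add: ennreal_mult_top)
    next
      case False
      have ip: "integrable M (\<lambda>y. k y * norm (F y) powr p)"
        using False k(2) by (intro integrableI_nonneg) (auto simp: less_top)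
      have i1: "integrable M (\<lambda>y. k y * norm (F y))"
      proof (rule integrable_dominated[OF Bochner_Integration.integrable_add[OF k(1) ip]])
        fix y
        have "k y * norm (F y) \<le> k y * (1 + norm (F y) powr p)"
          using k(2) by (intro mult_left_mono le_one_plus_powr p) auto
        then show "norm (k y * norm (F y)) \<le> k y + k y * norm (F y) powr p"
          using k(2)[of y] by (simp add: distrib_left)
      qed measurable
      define J where "J = (LINT y|M. k y * norm (F y))"
      have J: "0 \<le> J" unfolding J_def using k(2) by (intro Bochner_Integration.integral_nonneg) simp
      define m where "m = J / W"
      have m: "0 \<le> m" using J W0 by (simp add: m_def)
      have "norm ?I \<le> J"
        unfolding J_def by (rule norm_integral_le[OF i1]) (use k(2) in \<open>simp_all add: norm_mult\<close>)
      then have le1: "norm ?I powr p \<le> J powr p" using p by (intro powr_mono2) auto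
      have "(LINT y|M. (m powr p - p * m powr (p - 1) * m) * k y + (p * m powr (p - 1)) * (k y * norm (F y))) \<le> (LINT y|M. k y * norm (F y) powr p)"
      proof (rule integral_mono)
        fix y
        have "k y * (m powr p + p * m powr (p - 1) * (norm (F y) - m)) \<le> k y * norm (F y) powr p"
          using k(2) by (intro mult_left_mono powr_tangent p m) auto
        then show "(m powr p - p * m powr (p - 1) * m) * k y + (p * m powr (p - 1)) * (k y * norm (F y)) \<le> k y * norm (F y) powr p"
          by (simp add: algebra_simps)
      qed (intro Bochner_Integration.integrable_add integrable_mult_right k i1 ip)+
      also have "(LINT y|M. (m powr p - p * m powr (p - 1) * m) * k y + (p * m powr (p - 1)) * (k y * norm (F y))) = (m powr p - p * m powr (p - 1) * m) * W + (p * m powr (p - 1)) * J"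
        unfolding W_def J_def by (subst Bochner_Integration.integral_add) (auto intro!: integrable_mult_right k i1)
      also have "\<dots> = m powr p * W"
        using W0 by (simp add: m_def left_diff_distrib)
      finally have le2: "m powr p * W \<le> (LINT y|M. k y * norm (F y) powr p)" .
      have "J powr p = W powr (p - 1) * (m powr p * W)"
      proof -
        have "W powr (p - 1) * W = W powr p" using W0 by (simp add: powr_diff)
        moreover have "m powr p * W powr p = J powr p" using J W0 by (simp add: m_def powr_divide)
        ultimately show ?thesis by (metis mult.commute mult.assoc)
      qed
      also have "\<dots> \<le> W powr (p - 1) * (LINT y|M. k y * norm (F y) powr p)"
        by (intro mult_left_mono le2) simp
      finally have "norm ?I powr p \<le> W powr (p - 1) * (LINT y|M. k y * norm (F y) powr p)" using le1 by linarith
      then have "ennreal (norm ?I powr p) \<le> ennreal (W powr (p - 1)) * ennreal (LINT y|M. k y * norm (F y) powr p)"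
        by (simp add: ennreal_mult'[symmetric] ennreal_leI)
      also have "ennreal (LINT y|M. k y * norm (F y) powr p) = (\<integral>\<^sup>+y. ennreal (k y * norm (F y) powr p) \<partial>M)"
        using k(2) by (intro nn_integral_eq_integral[symmetric] ip) simp
      finally show ?thesis unfolding W_def .
    qed
  qed
qed

text \<open>Written with \<open>x + y\<close>; this is the convolution with the reflection of \<open>K\<close>, hence with \<open>K\<close> itself for
the even kernels below.\<close>

definition conv :: "(real^'n::finite \<Rightarrow> real) \<Rightarrow> (real^'n \<Rightarrow> complex) \<Rightarrow> real^'n \<Rightarrow> complex" where
  "conv K f x = (LINT y|lborel. of_real (K y) * f (x + y))"

lemma conv_measurable [measurable]:
  assumes [measurable]: "K \<in> borel_measurable borel" "f \<in> borel_measurable borel"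
  shows "conv K f \<in> borel_measurable borel"
  unfolding conv_def by measurable

lemma nn_integral_conv:
  fixes f :: "real^'n::finite \<Rightarrow> complex"
  assumes [measurable]: "K \<in> borel_measurable borel" "f \<in> borel_measurable borel" and K: "\<And>y. 0 \<le> K y"
  shows "(\<integral>\<^sup>+x. \<integral>\<^sup>+y. ennreal (K y * norm (f (x + y)) powr p) \<partial>lborel \<partial>lborel) = (\<integral>\<^sup>+y. ennreal (K y) \<partial>lborel) * Lp_int p f"
proof -
  have "(\<integral>\<^sup>+x. \<integral>\<^sup>+y. ennreal (K y * norm (f (x + y)) powr p) \<partial>lborel \<partial>lborel) = (\<integral>\<^sup>+y. \<integral>\<^sup>+x. ennreal (K y * norm (f (x + y)) powr p) \<partial>lborel \<partial>lborel)"
    by (rule lborel_pair.Fubini') measurable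
  also have "\<dots> = (\<integral>\<^sup>+y. ennreal (K y) * Lp_int p f \<partial>lborel)"
  proof (intro nn_integral_cong)
    fix y
    have "(\<integral>\<^sup>+x. ennreal (K y * norm (f (x + y)) powr p) \<partial>lborel) = ennreal (K y) * (\<integral>\<^sup>+x. ennreal (norm (f (x + y)) powr p) \<partial>lborel)"
      unfolding ennreal_mult'[OF K] by (rule nn_integral_cmult) measurable
    also have "(\<integral>\<^sup>+x. ennreal (norm (f (x + y)) powr p) \<partial>lborel) = Lp_int p f"
      unfolding Lp_int_def by (rule nn_integral_shift[of "\<lambda>x. ennreal (norm (f x) powr p)"]) measurable
    finally show "(\<integral>\<^sup>+x. ennreal (K y * norm (f (x + y)) powr p) \<partial>lborel) = ennreal (K y) * Lp_int p f" .
  qed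
  also have "\<dots> = (\<integral>\<^sup>+y. ennreal (K y) \<partial>lborel) * Lp_int p f"
    by (rule nn_integral_multc) measurable
  finally show ?thesis .
qed

lemma conv_integrable_AE:
  fixes f :: "real^'n::finite \<Rightarrow> complex"
  assumes p: "1 < p" and K: "integrable lborel K" and f: "f \<in> Lp p"
  shows "AE x in lborel. integrable lborel (\<lambda>y. of_real (K y) * f (x + y))"
proof -
  have [measurable]: "K \<in> borel_measurable borel" "f \<in> borel_measurable borel" using K f by (auto dest: Lp_measurable)
  have "(\<integral>\<^sup>+y. ennreal \<bar>K y\<bar> \<partial>lborel) < \<infinity>" using K by (simp add: integrable_iff_bounded)
  then have "(\<integral>\<^sup>+x. \<integral>\<^sup>+y. ennreal (\<bar>K y\<bar> * norm (f (x + y)) powr p) \<partial>lborel \<partial>lborel) \<noteq> \<infinity>"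
    using f by (subst nn_integral_conv) (auto simp: Lp_iff ennreal_mult_eq_top_iff)
  then have "AE x in lborel. (\<integral>\<^sup>+y. ennreal (\<bar>K y\<bar> * norm (f (x + y)) powr p) \<partial>lborel) \<noteq> \<infinity>"
    by (intro nn_integral_PInf_AE) auto
  then show ?thesis
  proof eventually_elim
    fix x assume "(\<integral>\<^sup>+y. ennreal (\<bar>K y\<bar> * norm (f (x + y)) powr p) \<partial>lborel) \<noteq> \<infinity>"
    then have ip: "integrable lborel (\<lambda>y. \<bar>K y\<bar> * norm (f (x + y)) powr p)"
      by (intro integrableI_nonneg) (auto simp: less_top)
    show "integrable lborel (\<lambda>y. of_real (K y) * f (x + y))"
    proof (rule integrable_dominated[OF Bochner_Integration.integrable_add[OF integrable_abs[OF K] ip]])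
      fix y
      have "\<bar>K y\<bar> * norm (f (x + y)) \<le> \<bar>K y\<bar> * (1 + norm (f (x + y)) powr p)"
        by (intro mult_left_mono le_one_plus_powr p) auto
      then show "norm (of_real (K y) * f (x + y)) \<le> \<bar>K y\<bar> + \<bar>K y\<bar> * norm (f (x + y)) powr p"
        by (simp only: distrib_left mult_1_right norm_mult norm_of_real)
    qed measurable
  qed
qed

text \<open>Young's inequality for convolutions, by Jensen's inequality for the measure \<open>|K(y)| dy\<close> and
Tonelli's theorem. The sign of \<open>K\<close> is moved to the function.\<close>

lemma Lp_int_conv_le:
  fixes f :: "real^'n::finite \<Rightarrow> complex"
  assumes p: "1 < p" and K: "integrable lborel K" and [measurable]: "f \<in> borel_measurable borel"
  shows "Lp_int p (conv K f) \<le> ennreal ((LINT y|lborel. \<bar>K y\<bar>) powr p) * Lp_int p f"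
proof -
  have [measurable]: "K \<in> borel_measurable borel" using K by auto
  define W where "W = (LINT y|lborel. \<bar>K y\<bar>)"
  have W: "0 \<le> W" unfolding W_def by (intro Bochner_Integration.integral_nonneg) simp
  have "Lp_int p (conv K f) \<le> (\<integral>\<^sup>+x. ennreal (W powr (p - 1)) * (\<integral>\<^sup>+y. ennreal (\<bar>K y\<bar> * norm (f (x + y)) powr p) \<partial>lborel) \<partial>lborel)"
    unfolding Lp_int_def
  proof (rule nn_integral_mono)
    fix x
    have "of_real \<bar>K y\<bar> * (of_real (sgn (K y)) * f (x + y)) = of_real (K y) * f (x + y)" for y
      by (simp only: mult.assoc[symmetric] of_real_mult[symmetric] abs_mult_sgn)
    then have "conv K f x = (LINT y|lborel. of_real \<bar>K y\<bar> * (of_real (sgn (K y)) * f (x + y)))"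
      unfolding conv_def by (simp only:)
    then have "ennreal (norm (conv K f x) powr p) \<le> ennreal (W powr (p - 1)) * (\<integral>\<^sup>+y. ennreal (\<bar>K y\<bar> * norm (of_real (sgn (K y)) * f (x + y)) powr p) \<partial>lborel)"
      unfolding W_def by (simp only:) (intro weighted_jensen p integrable_abs K, auto)
    also have "(\<integral>\<^sup>+y. ennreal (\<bar>K y\<bar> * norm (of_real (sgn (K y)) * f (x + y)) powr p) \<partial>lborel) \<le> (\<integral>\<^sup>+y. ennreal (\<bar>K y\<bar> * norm (f (x + y)) powr p) \<partial>lborel)"
    proof (intro nn_integral_mono ennreal_leI mult_left_mono powr_mono2)
      fix y
      show "norm (complex_of_real (sgn (K y)) * f (x + y)) \<le> norm (f (x + y))"
        by (cases "K y = 0") (simp_all add: norm_mult abs_sgn_eq)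
    qed (use p in auto)
    finally show "ennreal (norm (conv K f x) powr p) \<le> ennreal (W powr (p - 1)) * (\<integral>\<^sup>+y. ennreal (\<bar>K y\<bar> * norm (f (x + y)) powr p) \<partial>lborel)"
      by (simp add: mult_left_mono)
  qed
  also have "\<dots> = ennreal (W powr (p - 1)) * ((\<integral>\<^sup>+y. ennreal \<bar>K y\<bar> \<partial>lborel) * Lp_int p f)"
    using nn_integral_conv[of "\<lambda>y. \<bar>K y\<bar>" f p] by (subst nn_integral_cmult) auto
  also have "(\<integral>\<^sup>+y. ennreal \<bar>K y\<bar> \<partial>lborel) = ennreal W"
    unfolding W_def by (intro nn_integral_eq_integral integrable_abs K) simp
  also have "ennreal (W powr (p - 1)) * (ennreal W * Lp_int p f) = ennreal (W powr (p - 1) * W) * Lp_int p f"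
    using W by (simp add: ennreal_mult mult.assoc)
  also have "W powr (p - 1) * W = W powr p" using W by (cases "W = 0") (simp_all add: powr_diff)
  finally show ?thesis unfolding W_def .
qed

section \<open>The Gagliardo integral through differences\<close>

definition diff_int :: "real \<Rightarrow> (real^'n::finite \<Rightarrow> complex) \<Rightarrow> real^'n \<Rightarrow> ennreal" where
  "diff_int p u h = Lp_int p (\<lambda>x. u (x + h) - u x)"

lemma diff_int_measurable [measurable]:
  assumes [measurable]: "u \<in> borel_measurable borel"
  shows "diff_int p u \<in> borel_measurable borel"
  unfolding diff_int_def Lp_int_def by measurable

text \<open>The substitution \<open>y = x + h\<close>; the quotient at \<open>h = 0\<close> and the power of 0 are both 0.\<close>

lemma gagliardo_integral_eq:
  fixes u :: "real^'n::finite \<Rightarrow> complex"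
  assumes [measurable]: "u \<in> borel_measurable borel"
  shows "gagliardo_integral s p u = (\<integral>\<^sup>+h. ennreal (norm h powr (- real CARD('n) - s * p)) * diff_int p u h \<partial>lborel)"
proof -
  let ?e = "real CARD('n) + s * p"
  have "gagliardo_integral s p u = (\<integral>\<^sup>+x. \<integral>\<^sup>+h. ennreal (norm h powr (- ?e)) * ennreal (norm (u (x + h) - u x) powr p) \<partial>lborel \<partial>lborel)"
    unfolding gagliardo_integral_def
  proof (rule nn_integral_cong)
    fix x
    have "(\<integral>\<^sup>+y. ennreal (norm (u x - u y) powr p / norm (x - y) powr ?e) \<partial>lborel)
       = (\<integral>\<^sup>+h. ennreal (norm (u x - u (h + x)) powr p / norm (x - (h + x)) powr ?e) \<partial>lborel)"
      by (rule nn_integral_shift[symmetric, where f = "\<lambda>y. ennreal (norm (u x - u y) powr p / norm (x - y) powr ?e)"]) measurable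
    also have "\<dots> = (\<integral>\<^sup>+h. ennreal (norm h powr (- ?e)) * ennreal (norm (u (x + h) - u x) powr p) \<partial>lborel)"
    proof (rule nn_integral_cong)
      fix h
      have "norm (u x - u (h + x)) powr p / norm (x - (h + x)) powr ?e = norm h powr (- ?e) * norm (u (x + h) - u x) powr p"
        unfolding powr_minus divide_inverse norm_minus_commute[of "u x"] by (simp add: add.commute)
      then show "ennreal (norm (u x - u (h + x)) powr p / norm (x - (h + x)) powr ?e) = ennreal (norm h powr (- ?e)) * ennreal (norm (u (x + h) - u x) powr p)"
        by (simp only: ennreal_mult'[OF powr_ge_zero])
    qed
    finally show "(\<integral>\<^sup>+y. ennreal (norm (u x - u y) powr p / norm (x - y) powr ?e) \<partial>lborel)
       = (\<integral>\<^sup>+h. ennreal (norm h powr (- ?e)) * ennreal (norm (u (x + h) - u x) powr p) \<partial>lborel)" .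
  qed
  also have "\<dots> = (\<integral>\<^sup>+h. \<integral>\<^sup>+x. ennreal (norm h powr (- ?e)) * ennreal (norm (u (x + h) - u x) powr p) \<partial>lborel \<partial>lborel)"
    by (rule lborel_pair.Fubini') measurable
  also have "\<dots> = (\<integral>\<^sup>+h. ennreal (norm h powr (- ?e)) * diff_int p u h \<partial>lborel)"
    unfolding diff_int_def Lp_int_def by (intro nn_integral_cong nn_integral_cmult) measurable
  finally show ?thesis by simp
qed

section \<open>Lebesgue functions are determined by the distributions they induce\<close>

text \<open>\<open>|u| \<le> 1 + |u|\<^bsup>p\<^esup>\<close> replaces the Hoelder inequality, as only integrability is at stake.\<close>

lemma Lp_times_bounded_integrable:
  assumes p: "1 < p" and u: "u \<in> Lp p" and \<phi>: "integrable lborel \<phi>" and B: "\<And>x. norm (\<phi> x) \<le> B"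
  shows "integrable lborel (\<lambda>x. u x * \<phi> x)"
proof -
  have [measurable]: "u \<in> borel_measurable borel" "\<phi> \<in> borel_measurable borel"
    using u \<phi> Lp_measurable by auto
  have i1: "integrable lborel (\<lambda>x. norm (\<phi> x))" by (intro integrable_norm \<phi>)
  have i2: "integrable lborel (\<lambda>x. B * norm (u x) powr p)" using u unfolding Lp_def by (intro integrable_mult_right) auto
  show ?thesis
  proof (rule integrable_dominated[OF Bochner_Integration.integrable_add[OF i1 i2]])
    fix x
    have "norm (u x) * norm (\<phi> x) \<le> (1 + norm (u x) powr p) * norm (\<phi> x)"
      by (intro mult_right_mono le_one_plus_powr p) auto
    also have "\<dots> \<le> norm (\<phi> x) + norm (u x) powr p * B"
      unfolding distrib_right mult_1_left by (intro add_left_mono mult_left_mono B) auto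
    finally show "norm (u x * \<phi> x) \<le> norm (\<phi> x) + B * norm (u x) powr p"
      by (simp only: norm_mult mult.commute)
  qed measurable
qed

lemma Lp_times_schwartz_integrable:
  assumes "1 < p" "u \<in> Lp p" "\<phi> \<in> schwartz"
  shows "integrable lborel (\<lambda>x. u x * \<phi> x)"
proof -
  obtain B where "\<And>x. norm (\<phi> x) \<le> B" using schwartz_bounded[OF assms(3)] by blast
  then show ?thesis by (intro Lp_times_bounded_integrable[OF assms(1,2) schwartz_integrable[OF assms(3)]])
qed

text \<open>Indicators of closed sets are decreasing limits of continuous functions of the distance. So the
positive and the negative part of \<open>f\<close> define finite measures that agree on the closed sets, an
intersection-stable generator.\<close>

lemma AE_zero_if_orthogonal_continuous:
  fixes f :: "'a::euclidean_space \<Rightarrow> real"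
  assumes f: "integrable lborel f"
    and orth: "\<And>g. continuous_on UNIV g \<Longrightarrow> (\<And>x. 0 \<le> g x \<and> g x \<le> 1) \<Longrightarrow> (LINT x|lborel. f x * g x) = 0"
  shows "AE x in lborel. f x = 0"
proof -
  have [measurable]: "f \<in> borel_measurable borel" using f by auto
  have closed_zero: "(LINT x|lborel. f x * indicator A x) = 0" if A: "closed A" for A
  proof (cases "A = {}")
    case False
    have [measurable]: "A \<in> sets borel" using A by simp
    let ?g = "\<lambda>n x. max 0 (1 - real n * infdist x A)"
    have [measurable]: "?g n \<in> borel_measurable borel" for n
      by (intro borel_measurable_continuous_onI continuous_intros)
    have "(\<lambda>n. LINT x|lborel. f x * ?g n x) \<longlonglongrightarrow> (LINT x|lborel. f x * indicator A x)"
    proof (rule integral_dominated_convergence[where w = "\<lambda>x. norm (f x)"])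
      show "AE x in lborel. (\<lambda>n. f x * ?g n x) \<longlonglongrightarrow> f x * indicator A x"
      proof (rule AE_I2)
        fix x
        have "(\<lambda>n. ?g n x) \<longlonglongrightarrow> indicator A x"
        proof (cases "x \<in> A")
          case True
          then show ?thesis by (simp add: infdist_zero)
        next
          case False
          then have d: "0 < infdist x A"
            using in_closed_iff_infdist_zero[OF A \<open>A \<noteq> {}\<close>, of x] infdist_nonneg[of x A] by linarith
          obtain N where N: "1 / infdist x A < real N" using reals_Archimedean2 by blast
          have "?g n x = 0" if "N \<le> n" for n
          proof -
            have "1 / infdist x A < real n" using N that by (meson less_le_trans of_nat_le_iff)
            then show ?thesis using d by (simp add: pos_divide_less_eq max_def)
          qed
          then have "\<forall>\<^sub>F n in sequentially. ?g n x = 0" unfolding eventually_sequentially by blast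
          then show ?thesis using False by (simp add: tendsto_eventually)
        qed
        then show "(\<lambda>n. f x * ?g n x) \<longlonglongrightarrow> f x * indicator A x" by (intro tendsto_mult tendsto_const)
      qed
      show "AE x in lborel. norm (f x * ?g n x) \<le> norm (f x)" for n
      proof (rule AE_I2)
        fix x
        have "\<bar>?g n x\<bar> \<le> 1" using infdist_nonneg[of x A] by (auto simp: max_def)
        then show "norm (f x * ?g n x) \<le> norm (f x)" unfolding real_norm_def abs_mult by (intro mult_left_le) auto
      qed
    qed (use f in auto)
    moreover have "(LINT x|lborel. f x * ?g n x) = 0" for n
    proof (rule orth)
      show "continuous_on UNIV (?g n)" by (intro continuous_intros)
      show "0 \<le> ?g n x \<and> ?g n x \<le> 1" for x using infdist_nonneg[of x A] by (auto simp: max_def)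
    qed
    ultimately show ?thesis by (simp add: LIMSEQ_const_iff)
  qed simp
  let ?P = "density lborel (\<lambda>x. ennreal (f x))" and ?N = "density lborel (\<lambda>x. ennreal (- f x))"
  have finP: "(\<integral>\<^sup>+x. ennreal (f x) \<partial>lborel) \<noteq> \<infinity>" and finN: "(\<integral>\<^sup>+x. ennreal (- f x) \<partial>lborel) \<noteq> \<infinity>"
    using integrableD(2,3)[OF f] by auto
  have "?P = ?N"
  proof (rule measure_eqI_generator_eq[where \<Omega> = UNIV and E = "Collect closed" and A = "\<lambda>_. UNIV"])
    show "Int_stable (Collect (closed :: 'a set \<Rightarrow> bool))" by (auto simp: Int_stable_def)
    show "sets ?P = sigma_sets UNIV (Collect closed)" "sets ?N = sigma_sets UNIV (Collect closed)"
      by (simp_all add: borel_eq_closed)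
    show "emeasure ?P UNIV \<noteq> \<infinity>" using finP by (simp add: emeasure_density)
    fix A :: "'a set" assume "A \<in> Collect closed"
    then have A: "closed A" and [measurable]: "A \<in> sets borel" by auto
    have i: "integrable lborel (\<lambda>x. f x * indicator A x)" by (rule integrable_real_mult_indicator) (use f in auto)
    have enn: "a = b" if "enn2real a = enn2real b" "a \<noteq> \<infinity>" "b \<noteq> \<infinity>" for a b
      using that by (cases a; cases b) auto
    have fin: "(\<integral>\<^sup>+x. ennreal (f x * indicator A x) \<partial>lborel) \<noteq> \<infinity>" "(\<integral>\<^sup>+x. ennreal (- (f x * indicator A x)) \<partial>lborel) \<noteq> \<infinity>"
      using integrableD(2,3)[OF i] by auto
    have "enn2real (\<integral>\<^sup>+x. ennreal (f x * indicator A x) \<partial>lborel) = enn2real (\<integral>\<^sup>+x. ennreal (- (f x * indicator A x)) \<partial>lborel)"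
      using real_lebesgue_integral_def[OF i] closed_zero[OF A] by simp
    then have "(\<integral>\<^sup>+x. ennreal (f x * indicator A x) \<partial>lborel) = (\<integral>\<^sup>+x. ennreal (- (f x * indicator A x)) \<partial>lborel)"
      using fin enn by blast
    moreover have "ennreal (f x) * indicator A x = ennreal (f x * indicator A x)" "ennreal (- f x) * indicator A x = ennreal (- (f x * indicator A x))" for x
      by (simp_all add: indicator_def)
    moreover have "emeasure ?P A = (\<integral>\<^sup>+x. ennreal (f x) * indicator A x \<partial>lborel)" "emeasure ?N A = (\<integral>\<^sup>+x. ennreal (- f x) * indicator A x \<partial>lborel)"
      by (rule emeasure_density; measurable)+
    ultimately show "emeasure ?P A = emeasure ?N A" by (simp only:)
  qed auto
  then have "AE x in lborel. ennreal (f x) = ennreal (- f x)"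
    using finP finN by (subst (asm) finite_density_unique) auto
  then show ?thesis
  proof eventually_elim
    fix x assume "ennreal (f x) = ennreal (- f x)"
    then show "f x = 0" by (cases "0 \<le> f x") (auto simp: ennreal_neg ennreal_eq_0_iff)
  qed
qed

text \<open>Multiplied by a Gaussian, \<open>w\<close> becomes integrable, and the product of that Gaussian with a heat
kernel is a Schwartz function. Hence the heat semigroup annihilates the integrable product, which
is therefore orthogonal to every bounded continuous function, the limit of its own heat
evolution.\<close>

lemma AE_zero_if_orthogonal_schwartz:
  fixes w :: "real^'n::finite \<Rightarrow> complex"
  assumes [measurable]: "w \<in> borel_measurable borel" 
    and int: "\<And>\<phi>. \<phi> \<in> schwartz \<Longrightarrow> integrable lborel (\<lambda>x. w x * \<phi> x)"
    and orth: "\<And>\<phi>. \<phi> \<in> schwartz \<Longrightarrow> (LINT x|lborel. w x * \<phi> x) = 0"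
  shows "AE x in lborel. w x = 0"
proof -
  define f where "f = (\<lambda>x. w x * of_real (gauss_exp 1 0 x))"
  have f: "integrable lborel f" unfolding f_def by (intro int schwartz_gauss_exp) simp
  then have [measurable]: "f \<in> borel_measurable borel" by auto
  have heat0: "(LINT y|lborel. f y * of_real (heat t (y - x))) = 0" if t: "0 < t" for t x
  proof -
    define c where "c = (4 * pi * t) powr (- real CARD('n) / 2) * exp (- (norm x)\<^sup>2 / (4 * t))"
    \<comment> \<open>A product of two Gaussians is a Gaussian, so it is an admissible test function.\<close>
    have "gauss_exp 1 0 y * heat t (y - x) = c * gauss_exp (1 + 1 / (4 * t)) ((1 / (2 * t)) *\<^sub>R x) y" for y
    proof -
      have n: "(norm (y - x))\<^sup>2 = (norm y)\<^sup>2 - 2 * (x \<bullet> y) + (norm x)\<^sup>2"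
        unfolding power2_norm_eq_inner by (simp add: inner_diff inner_commute)
      have "- (norm y)\<^sup>2 + - (norm (y - x))\<^sup>2 / (4 * t) = - (norm x)\<^sup>2 / (4 * t) + ((1 / (2 * t)) * (x \<bullet> y) - (1 + 1 / (4 * t)) * (norm y)\<^sup>2)"
        unfolding n using t by (simp add: field_simps)
      then have "exp (- (norm y)\<^sup>2) * exp (- (norm (y - x))\<^sup>2 / (4 * t)) = exp (- (norm x)\<^sup>2 / (4 * t)) * exp ((1 / (2 * t)) * (x \<bullet> y) - (1 + 1 / (4 * t)) * (norm y)\<^sup>2)"
        unfolding exp_add[symmetric] by (simp only:)
      then show ?thesis unfolding gauss_exp_def heat_def c_def by (simp add: mult_ac)
    qed
    then have "f y * of_real (heat t (y - x)) = w y * (of_real c * of_real (gauss_exp (1 + 1 / (4 * t)) ((1 / (2 * t)) *\<^sub>R x) y))" for y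
      unfolding f_def mult.assoc of_real_mult[symmetric] by (simp only:)
    then show ?thesis
      using t by (simp only:) (intro orth schwartz_cmult schwartz_gauss_exp, simp add: add_pos_pos)
  qed
  have g0: "(LINT x|lborel. f x * of_real (g x)) = 0" if g: "continuous_on UNIV g" "\<And>x. 0 \<le> g x \<and> g x \<le> 1" for g :: "real^'n \<Rightarrow> real"
  proof -
    have [measurable]: "g \<in> borel_measurable borel" using g(1) by (rule borel_measurable_continuous_onI)
    let ?t = "\<lambda>n. 1 / real (Suc n)"
    let ?G = "\<lambda>n y. LINT z|lborel. complex_of_real (g (y + z)) * of_real (heat (?t n) z)"
    have norm_G: "norm (?G n y) \<le> 1" for n y
    proof -
      have "norm (?G n y) \<le> (LINT z|lborel. heat (?t n) (z :: real^'n))"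
        using g(2) by (intro norm_integral_le heat_integrable) (auto simp: norm_mult mult_left_le_one_le)
      also have "\<dots> = 1" by (rule integral_heat) simp
      finally show ?thesis .
    qed
    have "(\<lambda>n. LINT y|lborel. f y * ?G n y) \<longlonglongrightarrow> (LINT y|lborel. f y * of_real (g y))"
    proof (rule integral_dominated_convergence[where w = "\<lambda>x. norm (f x)"])
      show "AE y in lborel. (\<lambda>n. f y * ?G n y) \<longlonglongrightarrow> f y * of_real (g y)"
      proof (rule AE_I2)
        fix y
        have "isCont g y" using g(1) by (simp add: continuous_on_eq_continuous_at)
        then have "isCont (\<lambda>y. complex_of_real (g y)) y" by (intro continuous_intros)
        moreover have "norm (complex_of_real (g y)) \<le> 1" for y using g(2) by simp
        ultimately have "(\<lambda>n. ?G n y) \<longlonglongrightarrow> of_real (g y)"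
          by (intro heat_approximate_identity[where B = 1]) auto
        then show "(\<lambda>n. f y * ?G n y) \<longlonglongrightarrow> f y * of_real (g y)" by (intro tendsto_mult tendsto_const)
      qed
      show "AE y in lborel. norm (f y * ?G n y) \<le> norm (f y)" for n
        using norm_G by (auto simp: norm_mult intro!: mult_left_le)
    qed (use f in auto)
    moreover have "(LINT y|lborel. f y * ?G n y) = 0" for n
    proof -
      let ?F = "\<lambda>y z. f y * (of_real (g z) * of_real (heat (?t n) (z - y)))"
      have F0: "(LINT y|lborel. ?F y z) = 0" for z
      proof -
        have "heat (?t n) (z - y) = heat (?t n) (y - z)" for y using heat_minus[of "?t n" "z - y"] by simp
        then have "?F y z = of_real (g z) * (f y * of_real (heat (?t n) (y - z)))" for y by (simp only: mult_ac)
        then have "(LINT y|lborel. ?F y z) = of_real (g z) * (LINT y|lborel. f y * of_real (heat (?t n) (y - z)))"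
          by (simp only: integral_mult_right_zero)
        then show ?thesis using heat0[of "?t n" z] by simp
      qed
      have "(LINT y|lborel. f y * ?G n y) = (LINT y|lborel. LINT z|lborel. ?F y z)"
      proof (intro Bochner_Integration.integral_cong refl)
        fix y
        have "?G n y = (LINT z|lborel. complex_of_real (g (z + y)) * of_real (heat (?t n) (z + y - y)))" by (simp add: add.commute)
        also have "\<dots> = (LINT z|lborel. complex_of_real (g z) * of_real (heat (?t n) (z - y)))"
          by (rule integral_shift[where f = "\<lambda>z. complex_of_real (g z) * of_real (heat (?t n) (z - y))"]) measurable
        finally show "f y * ?G n y = (LINT z|lborel. ?F y z)" by (simp only: integral_mult_right_zero)
      qed
      also have "\<dots> = (LINT z|lborel. LINT y|lborel. ?F y z)"
      proof (rule lborel_pair.Fubini_integral[symmetric], rule lborel_pair.Fubini_integrable)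
        have h: "integrable lborel (\<lambda>z. heat (?t n) (z - y))" for y :: "real^'n"
          using integrable_shift[OF heat_integrable[of "?t n"], of "- y"] by simp
        have hi: "integrable lborel (\<lambda>z. complex_of_real (g z) * of_real (heat (?t n) (z - y)))" for y
          by (rule Bochner_Integration.integrable_bound[OF h[of y]])
             (use g(2) in \<open>auto simp: norm_mult mult_left_le_one_le\<close>)
        show "AE y in lborel. integrable lborel (\<lambda>z. case (y, z) of (y, z) \<Rightarrow> ?F y z)"
          using hi by (simp only: prod.case) (intro AE_I2 integrable_mult_right)
        show "integrable lborel (\<lambda>y. LINT z|lborel. norm (case (y, z) of (y, z) \<Rightarrow> ?F y z))"
        proof (rule integrable_dominated[OF integrable_norm[OF f]])
          fix y
          have "norm (LINT z|lborel. norm (?F y z)) \<le> (LINT z|lborel. norm (f y) * heat (?t n) (z - y))"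
          proof (rule norm_integral_le[OF integrable_mult_right[OF h]])
            fix z
            have "g z * heat (?t n) (z - y) \<le> 1 * heat (?t n) (z - y)" using g(2) by (intro mult_right_mono) auto
            then show "norm (norm (?F y z)) \<le> norm (f y) * heat (?t n) (z - y)"
              using g(2)[of z] by (simp add: norm_mult mult_left_mono)
          qed measurable
          also have "\<dots> = norm (f y) * (LINT z|lborel. heat (?t n) (z + (- y)))" by simp
          also have "(LINT z|lborel. heat (?t n) (z + (- y))) = 1"
            by (subst integral_shift) (simp_all add: integral_heat)
          finally show "norm (LINT z|lborel. norm (case (y, z) of (y, z) \<Rightarrow> ?F y z)) \<le> norm (f y)" by simp
        qed measurable
      qed measurable
      also have "\<dots> = 0" by (simp only: F0) simp
      finally show ?thesis by simp
    qed
    ultimately show ?thesis by (simp add: LIMSEQ_const_iff)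
  qed
  have gi: "integrable lborel (\<lambda>x. f x * of_real (g x))" if g: "continuous_on UNIV g" "\<And>x. 0 \<le> g x \<and> g x \<le> 1" for g :: "real^'n \<Rightarrow> real"
  proof -
    have [measurable]: "g \<in> borel_measurable borel" using g(1) by (rule borel_measurable_continuous_onI)
    show ?thesis by (rule Bochner_Integration.integrable_bound[OF f]) (use g(2) in \<open>auto simp: norm_mult mult_left_le\<close>)
  qed
  have "AE x in lborel. Re (f x) = 0"
  proof (rule AE_zero_if_orthogonal_continuous)
    fix g :: "real^'n \<Rightarrow> real" assume g: "continuous_on UNIV g" "\<And>x. 0 \<le> g x \<and> g x \<le> 1"
    have "(LINT x|lborel. Re (f x * of_real (g x))) = 0" using integral_Re[OF gi[OF g]] g0[OF g] by simp
    then show "(LINT x|lborel. Re (f x) * g x) = 0" by simp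
  qed (use f in auto)
  moreover have "AE x in lborel. Im (f x) = 0"
  proof (rule AE_zero_if_orthogonal_continuous)
    fix g :: "real^'n \<Rightarrow> real" assume g: "continuous_on UNIV g" "\<And>x. 0 \<le> g x \<and> g x \<le> 1"
    have "(LINT x|lborel. Im (f x * of_real (g x))) = 0" using integral_Im[OF gi[OF g]] g0[OF g] by simp
    then show "(LINT x|lborel. Im (f x) * g x) = 0" by simp
  qed (use f in auto)
  ultimately show ?thesis
  proof eventually_elim
    fix x assume "Re (f x) = 0" "Im (f x) = 0"
    then have "f x = 0" by (simp add: complex_eq_iff)
    then show "w x = 0" by (simp add: f_def gauss_exp_def)
  qed
qed

lemma distr_of_inject_AE:
  assumes p: "1 < p" "1 < p'" and u: "u \<in> Lp p" and v: "v \<in> Lp p'" and eq: "distr_of u = distr_of v"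
  shows "AE x in lborel. u x = v x"
proof -
  have [measurable]: "u \<in> borel_measurable borel" "v \<in> borel_measurable borel" using u v by (auto dest: Lp_measurable)
  have "AE x in lborel. u x - v x = 0"
  proof (rule AE_zero_if_orthogonal_schwartz)
    fix \<phi> :: "real^'a \<Rightarrow> complex" assume \<phi>: "\<phi> \<in> schwartz"
    note i = Lp_times_schwartz_integrable[OF p(1) u \<phi>] Lp_times_schwartz_integrable[OF p(2) v \<phi>]
    show "integrable lborel (\<lambda>x. (u x - v x) * \<phi> x)"
      unfolding left_diff_distrib by (rule Bochner_Integration.integrable_diff[OF i])
    have "(LINT x|lborel. (u x - v x) * \<phi> x) = distr_of u \<phi> - distr_of v \<phi>"
      unfolding left_diff_distrib distr_of_def using \<phi> by (simp add: Bochner_Integration.integral_diff[OF i])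
    then show "(LINT x|lborel. (u x - v x) * \<phi> x) = 0" by (simp add: eq)
  qed measurable
  then show ?thesis by eventually_elim simp
qed

lemma Lp_rep_distr_of:
  assumes p: "1 < p" and u: "u \<in> Lp p"
  shows "Lp_rep p (distr_of u) \<in> Lp p" "AE x in lborel. Lp_rep p (distr_of u) x = u x"
proof -
  have "Lp_rep p (distr_of u) \<in> Lp p \<and> distr_of (Lp_rep p (distr_of u)) = distr_of u"
    unfolding Lp_rep_def by (rule someI[of "\<lambda>v. v \<in> Lp p \<and> distr_of v = distr_of u"]) (use u in auto)
  then show "Lp_rep p (distr_of u) \<in> Lp p" "AE x in lborel. Lp_rep p (distr_of u) x = u x"
    using distr_of_inject_AE[OF p p _ u] by auto
qed

lemma AE_shift:
  fixes h :: "'a::euclidean_space"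
  assumes "AE x in lborel. u x = (v x :: complex)" and [measurable]: "u \<in> borel_measurable borel" "v \<in> borel_measurable borel"
  shows "AE x in lborel. u (x + h) = v (x + h)"
proof -
  have "AE x in distr lborel borel ((+) h). u x = v x" unfolding lborel_distr_plus by (rule assms(1))
  then show ?thesis by (subst (asm) AE_distr_iff) (simp_all add: add.commute)
qed

lemma Lp_int_cong_AE:
  assumes "AE x in lborel. u x = v x" shows "Lp_int p u = Lp_int p v"
  unfolding Lp_int_def by (rule nn_integral_cong_AE) (use assms in \<open>eventually_elim, simp\<close>)

lemma gagliardo_integral_cong_AE:
  assumes "AE x in lborel. u x = v x" and [measurable]: "u \<in> borel_measurable borel" "v \<in> borel_measurable borel"
  shows "gagliardo_integral s p u = gagliardo_integral s p v"
proof -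
  have "diff_int p u h = diff_int p v h" for h
    unfolding diff_int_def
  proof (rule Lp_int_cong_AE)
    show "AE x in lborel. u (x + h) - u x = v (x + h) - v x"
      using assms(1) AE_shift[OF assms] by eventually_elim simp
  qed
  then show ?thesis by (simp add: gagliardo_integral_eq)
qed

lemma Lp_norm_eq: 
  assumes "u \<in> borel_measurable borel" shows "Lp_norm p u = enn2real (Lp_int p u) powr (1 / p)"
  unfolding Lp_norm_def Lp_int_def using assms by (subst integral_eq_nn_integral) auto

section \<open>Bessel potentials of Lebesgue functions have finite Gagliardo integral\<close>

text \<open>The translation is moved from \<open>g\<close> to the kernel. Almost every \<open>x\<close> admits this, as both
integrals converge there.\<close>

lemma diff_int_conv_le:
  fixes g :: "real^'n::finite \<Rightarrow> complex"
  assumes p: "1 < p" and K: "integrable lborel K" and g: "g \<in> Lp p"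
  shows "diff_int p (conv K g) h \<le> ennreal ((LINT y|lborel. \<bar>K (y + - h) - K y\<bar>) powr p) * Lp_int p g"
proof -
  have [measurable]: "g \<in> borel_measurable borel" "K \<in> borel_measurable borel" using g K by (auto dest: Lp_measurable)
  let ?D = "\<lambda>y. K (y + - h) - K y"
  note Kh = integrable_shift[OF K, of "- h"]
  have "AE x in lborel. conv K g (x + h) - conv K g x = conv ?D g x"
    using conv_integrable_AE[OF p K g] conv_integrable_AE[OF p Kh g]
  proof eventually_elim
    fix x assume i: "integrable lborel (\<lambda>y. of_real (K y) * g (x + y))" "integrable lborel (\<lambda>y. of_real (K (y + - h)) * g (x + y))"
    have "conv K g (x + h) = (LINT y|lborel. of_real (K (y + h + - h)) * g (x + (y + h)))"
      unfolding conv_def by (simp add: add_ac)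
    also have "\<dots> = (LINT y|lborel. of_real (K (y + - h)) * g (x + y))"
      by (rule integral_shift[where f = "\<lambda>y. of_real (K (y + - h)) * g (x + y)"]) measurable
    finally show "conv K g (x + h) - conv K g x = conv ?D g x"
      unfolding conv_def of_real_diff left_diff_distrib by (simp only: Bochner_Integration.integral_diff[OF i(2,1)])
  qed
  then have "diff_int p (conv K g) h = Lp_int p (conv ?D g)"
    unfolding diff_int_def by (rule Lp_int_cong_AE)
  also have "\<dots> \<le> ennreal ((LINT y|lborel. \<bar>?D y\<bar>) powr p) * Lp_int p g"
    by (intro Lp_int_conv_le p Bochner_Integration.integrable_diff Kh K) measurable
  finally show ?thesis .
qed

definition normalized_kernel :: "real \<Rightarrow> real^'n::finite \<Rightarrow> real" where
  "normalized_kernel s h = bessel_kernel s h / Gamma (s / 2)"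

lemma normalized_kernel_measurable [measurable]: "normalized_kernel s \<in> borel_measurable borel"
  unfolding normalized_kernel_def by measurable

lemma normalized_kernel_integrable: "0 < s \<Longrightarrow> integrable lborel (normalized_kernel s)"
  unfolding normalized_kernel_def by (simp add: bessel_kernel_integrable)

lemma normalized_kernel_shift_difference:
  assumes \<sigma>: "0 \<le> \<sigma>" "\<sigma> \<le> 1" "\<sigma> < s"
  obtains c where "0 \<le> c" "\<And>h :: real^'n::finite. h \<noteq> 0 \<Longrightarrow> 
    (LINT y|lborel. \<bar>normalized_kernel s (y + h) - normalized_kernel s y\<bar>) \<le> c * norm h powr \<sigma>"
proof -
  have G: "0 < Gamma (s / 2)" "0 < Gamma ((s - \<sigma>) / 2)" using \<sigma> by (intro Gamma_real_pos; simp)+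
  let ?c = "3 * Gamma ((s - \<sigma>) / 2) / Gamma (s / 2)"
  have "(LINT y|lborel. \<bar>normalized_kernel s (y + h) - normalized_kernel s y\<bar>) \<le> ?c * norm h powr \<sigma>" for h :: "real^'n"
  proof -
    have i: "integrable lborel (\<lambda>y. \<bar>bessel_kernel s (y + h) - bessel_kernel s y\<bar>)"
      using \<sigma> bessel_kernel_integrable[of s, where 'n = 'n]
      by (intro integrable_abs Bochner_Integration.integrable_diff integrable_shift) auto
    have "ennreal (LINT y|lborel. \<bar>bessel_kernel s (y + h) - bessel_kernel s y\<bar>) \<le> ennreal (3 * Gamma ((s - \<sigma>) / 2) * norm h powr \<sigma>)"
      using bessel_kernel_shift_difference[OF \<sigma>, of h] by (subst nn_integral_eq_integral[OF i, symmetric]) auto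
    then have le: "(LINT y|lborel. \<bar>bessel_kernel s (y + h) - bessel_kernel s y\<bar>) \<le> 3 * Gamma ((s - \<sigma>) / 2) * norm h powr \<sigma>"
      using G by (subst (asm) ennreal_le_iff) auto
    have "\<bar>normalized_kernel s (y + h) - normalized_kernel s y\<bar> = \<bar>bessel_kernel s (y + h) - bessel_kernel s y\<bar> / Gamma (s / 2)" for y
      using G(1) unfolding normalized_kernel_def diff_divide_distrib[symmetric] abs_divide by (simp only: abs_of_pos)
    then have "(LINT y|lborel. \<bar>normalized_kernel s (y + h) - normalized_kernel s y\<bar>) = (LINT y|lborel. \<bar>bessel_kernel s (y + h) - bessel_kernel s y\<bar>) / Gamma (s / 2)"
      by (simp only: integral_divide_zero)
    also have "\<dots> \<le> 3 * Gamma ((s - \<sigma>) / 2) * norm h powr \<sigma> / Gamma (s / 2)"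
      using le G(1) by (intro divide_right_mono) auto
    finally show ?thesis by simp
  qed
  moreover have "0 \<le> ?c" using G by simp
  ultimately show ?thesis by (intro that[of ?c])
qed

text \<open>Near the origin the difference estimate of an order \<open>\<sigma>\<close> between \<open>s\<close> and \<open>s\<^sub>1\<close> leaves the integrable
singularity \<open>|h|\<^bsup>\<beta>-n\<^esup>\<close>; away from it, order 0 leaves \<open>|h|\<^bsup>-n-sp\<^esup>\<close>. Both are dominated by
functions already known to be integrable, a Bessel kernel and a decay weight.\<close>

theorem bessel_potential_gagliardo:
  assumes p: "1 < p" and s: "0 < s" "s < s1" "s1 < 1"
  obtains C where "0 \<le> C" "\<And>g :: real^'n::finite \<Rightarrow> complex. g \<in> Lp p \<Longrightarrow> 
     gagliardo_integral s p (conv (normalized_kernel s1) g) \<le> ennreal C * Lp_int p g"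
proof -
  let ?n = "real CARD('n)" and ?K = "normalized_kernel s1 :: real^'n \<Rightarrow> real"
  define \<sigma> where "\<sigma> = (s + s1) / 2"
  have \<sigma>: "0 \<le> \<sigma>" "\<sigma> \<le> 1" "\<sigma> < s1" "s < \<sigma>" using s by (auto simp: \<sigma>_def)
  obtain c0 where c0: "0 \<le> c0" "\<And>h :: real^'n. h \<noteq> 0 \<Longrightarrow> (LINT y|lborel. \<bar>?K (y + h) - ?K y\<bar>) \<le> c0 * norm h powr 0"
    by (rule normalized_kernel_shift_difference[of 0 s1, where 'n = 'n]) (use s in auto)
  obtain c1 where c1: "0 \<le> c1" "\<And>h :: real^'n. h \<noteq> 0 \<Longrightarrow> (LINT y|lborel. \<bar>?K (y + h) - ?K y\<bar>) \<le> c1 * norm h powr \<sigma>"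
    by (rule normalized_kernel_shift_difference[OF \<sigma>(1-3), where 'n = 'n]) blast
  define \<beta> where "\<beta> = (\<sigma> - s) * p"
  have \<beta>: "0 < \<beta>" using \<sigma>(4) p by (simp add: \<beta>_def)
  obtain d where d: "0 < d" "\<And>h :: real^'n. h \<noteq> 0 \<Longrightarrow> norm h \<le> 1 \<Longrightarrow> d * norm h powr (\<beta> - ?n) \<le> bessel_kernel \<beta> h"
    by (rule bessel_kernel_lower_bound[OF \<beta>, where 'n = 'n]) blast
  have sp: "0 < s * p" using s p by simp
  define w where "w = (\<lambda>h :: real^'n. (c1 powr p / d) * bessel_kernel \<beta> h + (c0 powr p * 2 powr (?n + s * p)) * (1 + norm h) powr (- ?n - s * p))"
  have w0: "0 \<le> w h" for h unfolding w_def using d(1) by (intro add_nonneg_nonneg mult_nonneg_nonneg) auto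
  have wi: "integrable lborel w"
    unfolding w_def by (intro Bochner_Integration.integrable_add integrable_mult_right bessel_kernel_integrable \<beta> integrable_decay_weight_powr sp)
  have key: "norm h powr (- ?n - s * p) * (LINT y|lborel. \<bar>?K (y + - h) - ?K y\<bar>) powr p \<le> w h" for h :: "real^'n"
  proof (cases "h = 0")
    case True
    then show ?thesis using w0 by simp
  next
    case False
    let ?\<kappa> = "LINT y|lborel. \<bar>?K (y + - h) - ?K y\<bar>"
    have \<kappa>: "0 \<le> ?\<kappa>" by (intro Bochner_Integration.integral_nonneg) simp
    show ?thesis
    proof (cases "norm h \<le> 1")
      case True
      have "?\<kappa> powr p \<le> (c1 * norm h powr \<sigma>) powr p"
        using c1(2)[of "- h"] False \<kappa> p by (intro powr_mono2) auto
      also have "\<dots> = c1 powr p * norm h powr (\<sigma> * p)" using c1(1) by (simp add: powr_mult powr_powr)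
      finally have "norm h powr (- ?n - s * p) * ?\<kappa> powr p \<le> norm h powr (- ?n - s * p) * (c1 powr p * norm h powr (\<sigma> * p))"
        by (rule mult_left_mono) simp
      also have "\<dots> = c1 powr p * (norm h powr (- ?n - s * p) * norm h powr (\<sigma> * p))" by (simp only: mult_ac)
      also have "norm h powr (- ?n - s * p) * norm h powr (\<sigma> * p) = norm h powr (\<beta> - ?n)"
        unfolding powr_add[symmetric] \<beta>_def by (simp add: algebra_simps)
      also have "c1 powr p * norm h powr (\<beta> - ?n) \<le> (c1 powr p / d) * bessel_kernel \<beta> h"
      proof -
        have "norm h powr (\<beta> - ?n) \<le> bessel_kernel \<beta> h / d"
          using d(2)[OF False True] d(1) by (simp add: pos_le_divide_eq mult.commute)
        then have "c1 powr p * norm h powr (\<beta> - ?n) \<le> c1 powr p * (bessel_kernel \<beta> h / d)" by (rule mult_left_mono) simp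
        then show ?thesis by simp
      qed
      also have "\<dots> \<le> w h" unfolding w_def by simp
      finally show ?thesis .
    next
      case False
      have h: "h \<noteq> 0" "1 < norm h" using False by auto
      have "?\<kappa> powr p \<le> c0 powr p"
        using c0(2)[of "- h"] h \<kappa> p by (intro powr_mono2) auto
      moreover have "norm h powr (- ?n - s * p) \<le> 2 powr (?n + s * p) * (1 + norm h) powr (- ?n - s * p)"
      proof -
        have "norm h powr (- ?n - s * p) \<le> ((1 + norm h) / 2) powr (- ?n - s * p)"
          using h sp by (intro powr_mono2') auto
        also have "\<dots> = (1 + norm h) powr (- ?n - s * p) / 2 powr (- ?n - s * p)"
          using h by (intro powr_divide)
        also have "2 powr (- ?n - s * p) = inverse (2 powr (?n + s * p) :: real)"
        proof -
          have "- ?n - s * p = - (?n + s * p)" by simp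
          then show ?thesis by (simp only: powr_minus)
        qed
        finally show ?thesis by (simp only: divide_inverse inverse_inverse_eq mult.commute)
      qed
      ultimately have "norm h powr (- ?n - s * p) * ?\<kappa> powr p \<le> (2 powr (?n + s * p) * (1 + norm h) powr (- ?n - s * p)) * c0 powr p"
        by (intro mult_mono) auto
      also have "\<dots> \<le> w h" unfolding w_def using d(1) by (simp add: mult_ac)
      finally show ?thesis .
    qed
  qed
  have "gagliardo_integral s p (conv ?K g) \<le> ennreal (LINT h|lborel. w h) * Lp_int p g" if g: "g \<in> Lp p" for g
  proof -
    have [measurable]: "g \<in> borel_measurable borel" using g by (rule Lp_measurable)
    have [measurable]: "w \<in> borel_measurable borel" using wi by auto
    have K: "integrable lborel ?K" using s by (intro normalized_kernel_integrable) simp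
    have "gagliardo_integral s p (conv ?K g) = (\<integral>\<^sup>+h. ennreal (norm h powr (- ?n - s * p)) * diff_int p (conv ?K g) h \<partial>lborel)"
      by (rule gagliardo_integral_eq) measurable
    also have "\<dots> \<le> (\<integral>\<^sup>+h. ennreal (w h) * Lp_int p g \<partial>lborel)"
    proof (rule nn_integral_mono)
      fix h :: "real^'n"
      let ?\<kappa> = "LINT y|lborel. \<bar>?K (y + - h) - ?K y\<bar>"
      have "ennreal (norm h powr (- ?n - s * p)) * diff_int p (conv ?K g) h \<le> ennreal (norm h powr (- ?n - s * p)) * (ennreal (?\<kappa> powr p) * Lp_int p g)"
        by (intro mult_left_mono diff_int_conv_le p K g) simp
      also have "\<dots> = ennreal (norm h powr (- ?n - s * p) * ?\<kappa> powr p) * Lp_int p g"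
        by (simp only: ennreal_mult'[OF powr_ge_zero] mult.assoc)
      also have "\<dots> \<le> ennreal (w h) * Lp_int p g"
        by (intro mult_right_mono ennreal_leI key) simp
      finally show "ennreal (norm h powr (- ?n - s * p)) * diff_int p (conv ?K g) h \<le> ennreal (w h) * Lp_int p g" .
    qed
    also have "\<dots> = (\<integral>\<^sup>+h. ennreal (w h) \<partial>lborel) * Lp_int p g"
      by (rule nn_integral_multc) measurable
    also have "(\<integral>\<^sup>+h. ennreal (w h) \<partial>lborel) = ennreal (LINT h|lborel. w h)"
      by (rule nn_integral_eq_integral[OF wi]) (simp add: w0)
    finally show ?thesis .
  qed
  moreover have "0 \<le> (LINT h|lborel. w h)" using w0 by (intro Bochner_Integration.integral_nonneg)
  ultimately show ?thesis by (intro that)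
qed

section \<open>The hypersingular integral of a Gagliardo function\<close>

text \<open>Up to a constant, the difference between the Bessel potential of order \<open>-s\<close> and the identity.\<close>

definition hypersingular :: "real \<Rightarrow> (real^'n::finite \<Rightarrow> complex) \<Rightarrow> real^'n \<Rightarrow> complex" where
  "hypersingular s u x = (LINT h|lborel. of_real (bessel_kernel (- s) h) * (u x - u (x + h)))"

lemma hypersingular_measurable [measurable]:
  assumes [measurable]: "u \<in> borel_measurable borel"
  shows "hypersingular s u \<in> borel_measurable borel"
  unfolding hypersingular_def by measurable

text \<open>Jensen's inequality for the finite measure \<open>K(h)|h|\<^bsup>s\<^esup> dh\<close> and the function
\<open>|h|\<^bsup>-s\<^esup>(u(x) - u(x + h))\<close>. The remaining kernel \<open>K(h)|h|\<^bsup>s-sp\<^esup>\<close> is bounded by exactly the weight of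
the Gagliardo integral, because \<open>K(h) = O(|h|\<^bsup>-n-s\<^esup>)\<close>.\<close>

theorem Lp_int_hypersingular_le:
  assumes p: "1 < p" and s: "0 < s0" "s0 < s" "s < 1"
  obtains C where "0 \<le> C" "\<And>u :: real^'n::finite \<Rightarrow> complex. u \<in> borel_measurable borel \<Longrightarrow>
     Lp_int p (hypersingular s0 u) \<le> ennreal C * gagliardo_integral s p u"
proof -
  let ?n = "real CARD('n)" and ?K = "bessel_kernel (- s0) :: real^'n \<Rightarrow> real"
  obtain C where C: "0 < C" "\<And>h :: real^'n. h \<noteq> 0 \<Longrightarrow> ?K h \<le> C * norm h powr (- ?n - s)"
    by (rule bessel_kernel_pointwise[of s "- s0", where 'n = 'n]) (use s in auto)
  define k where "k = (\<lambda>h :: real^'n. ?K h * norm h powr s)"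
  have k: "integrable lborel k" "\<And>h. 0 \<le> k h" unfolding k_def using s by (auto intro!: bessel_kernel_moment)
  define W where "W = (LINT h|lborel. k h)"
  have bound: "Lp_int p (hypersingular s0 u) \<le> ennreal (W powr (p - 1) * C) * gagliardo_integral s p u" 
    if [measurable]: "u \<in> borel_measurable borel" for u :: "real^'n \<Rightarrow> complex"
  proof -
    let ?F = "\<lambda>x h. of_real (norm h powr (- s)) * (u x - u (x + h))"
    have "Lp_int p (hypersingular s0 u) \<le> (\<integral>\<^sup>+x. ennreal (W powr (p - 1)) * (\<integral>\<^sup>+h. ennreal C * (ennreal (norm h powr (- ?n - s * p)) * ennreal (norm (u (x + h) - u x) powr p)) \<partial>lborel) \<partial>lborel)"
      unfolding Lp_int_def
    proof (rule nn_integral_mono)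
      fix x
      have "of_real (?K h) * (u x - u (x + h)) = of_real (k h) * ?F x h" for h
      proof (cases "h = 0")
        case False
        then have "norm h powr s * norm h powr (- s) = 1" by (simp add: powr_minus)
        then have "?K h = k h * norm h powr (- s)" unfolding k_def mult.assoc by simp
        then show ?thesis by (simp only: of_real_mult mult.assoc)
      qed simp
      then have "hypersingular s0 u x = (LINT h|lborel. of_real (k h) * ?F x h)"
        unfolding hypersingular_def by (simp only:)
      then have "ennreal (norm (hypersingular s0 u x) powr p) \<le> ennreal (W powr (p - 1)) * (\<integral>\<^sup>+h. ennreal (k h * norm (?F x h) powr p) \<partial>lborel)"
        unfolding W_def by (simp only:) (intro weighted_jensen p k, measurable)
      also have "\<dots> \<le> ennreal (W powr (p - 1)) * (\<integral>\<^sup>+h. ennreal C * (ennreal (norm h powr (- ?n - s * p)) * ennreal (norm (u (x + h) - u x) powr p)) \<partial>lborel)"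
      proof (intro mult_left_mono nn_integral_mono)
        fix h :: "real^'n"
        have "k h * norm (?F x h) powr p \<le> C * (norm h powr (- ?n - s * p) * norm (u (x + h) - u x) powr p)"
        proof (cases "h = 0")
          case False
          let ?d = "norm (u (x + h) - u x) powr p"
          have "norm (?F x h) powr p = norm h powr (- s * p) * ?d"
            unfolding norm_mult norm_of_real norm_minus_commute[of "u x"] by (simp add: powr_mult powr_powr)
          then have "k h * norm (?F x h) powr p = ?K h * (norm h powr s * norm h powr (- s * p) * ?d)"
            unfolding k_def by (simp only: mult.assoc)
          also have "\<dots> \<le> C * norm h powr (- ?n - s) * (norm h powr s * norm h powr (- s * p) * ?d)"
            by (intro mult_right_mono C(2) False) simp
          also have "\<dots> = C * ((norm h powr (- ?n - s) * (norm h powr s * norm h powr (- s * p))) * ?d)" by (simp only: mult.assoc)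
          also have "norm h powr (- ?n - s) * (norm h powr s * norm h powr (- s * p)) = norm h powr (- ?n - s * p)"
            unfolding powr_add[symmetric] by simp
          finally show ?thesis .
        qed simp
        then show "ennreal (k h * norm (?F x h) powr p) \<le> ennreal C * (ennreal (norm h powr (- ?n - s * p)) * ennreal (norm (u (x + h) - u x) powr p))"
          using C(1) by (simp add: ennreal_mult'[symmetric] ennreal_leI)
      qed simp
      finally show "ennreal (norm (hypersingular s0 u x) powr p) \<le> ennreal (W powr (p - 1)) * (\<integral>\<^sup>+h. ennreal C * (ennreal (norm h powr (- ?n - s * p)) * ennreal (norm (u (x + h) - u x) powr p)) \<partial>lborel)" .
    qed
    also have "\<dots> = ennreal (W powr (p - 1)) * (\<integral>\<^sup>+x. \<integral>\<^sup>+h. ennreal C * (ennreal (norm h powr (- ?n - s * p)) * ennreal (norm (u (x + h) - u x) powr p)) \<partial>lborel \<partial>lborel)"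
      by (rule nn_integral_cmult) measurable
    also have "(\<integral>\<^sup>+x. \<integral>\<^sup>+h. ennreal C * (ennreal (norm h powr (- ?n - s * p)) * ennreal (norm (u (x + h) - u x) powr p)) \<partial>lborel \<partial>lborel)
        = (\<integral>\<^sup>+h. \<integral>\<^sup>+x. ennreal C * (ennreal (norm h powr (- ?n - s * p)) * ennreal (norm (u (x + h) - u x) powr p)) \<partial>lborel \<partial>lborel)"
      by (rule lborel_pair.Fubini') measurable
    also have "\<dots> = (\<integral>\<^sup>+h. ennreal C * (ennreal (norm h powr (- ?n - s * p)) * diff_int p u h) \<partial>lborel)"
      unfolding diff_int_def Lp_int_def mult.assoc[symmetric] by (intro nn_integral_cong nn_integral_cmult) measurable
    also have "\<dots> = ennreal C * gagliardo_integral s p u"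
      unfolding gagliardo_integral_eq[OF that] by (rule nn_integral_cmult) measurable
    finally show ?thesis using C(1) by (simp add: ennreal_mult mult.assoc)
  qed
  show ?thesis by (rule that[of "W powr (p - 1) * C"]) (use C(1) bound in simp_all)
qed

lemma young_sum:
  fixes a b :: real
  assumes "1 < p" "1 < q" "1 / p + 1 / q = 1" "0 \<le> a" "0 \<le> b"
  shows "a * b \<le> a powr p + b powr q"
proof -
  have "a * b \<le> a powr p / p + b powr q / q" by (rule Youngs_inequality) (use assms in auto)
  also have "\<dots> \<le> a powr p + b powr q"
    using assms by (intro add_mono) (auto simp: divide_le_eq mult_le_cancel_left1)
  finally show ?thesis .
qed

text \<open>Young's inequality for \<open>|h|\<^bsup>-s/q\<^esup>|u(x + h) - u(x)|\<close> and \<open>|h|\<^bsup>s/q\<^esup>|v(x)|\<close>: the first summand is controlled by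
the Gagliardo integral, the second by the moment of order \<open>s\<close> of the kernel.\<close>

lemma hypersingular_pair_integrable:
  fixes u v :: "real^'n::finite \<Rightarrow> complex"
  assumes p: "1 < p" "1 < q" "1 / p + 1 / q = 1" and s: "0 < s0" "s0 < s" "s < 1"
    and u: "u \<in> Lp p" "gagliardo_integral s p u < \<infinity>" and v: "v \<in> Lp q"
  shows "integrable (lborel \<Otimes>\<^sub>M lborel) (\<lambda>(x, h). of_real (bessel_kernel (- s0) h) * (u x - u (x + h)) * v x)"
proof -
  let ?n = "real CARD('n)" and ?K = "bessel_kernel (- s0) :: real^'n \<Rightarrow> real"
  have [measurable]: "u \<in> borel_measurable borel" "v \<in> borel_measurable borel" using u v by (auto dest: Lp_measurable)
  obtain C where C: "0 < C" "\<And>h :: real^'n. h \<noteq> 0 \<Longrightarrow> ?K h \<le> C * norm h powr (- ?n - s)"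
    by (rule bessel_kernel_pointwise[of s "- s0", where 'n = 'n]) (use s in auto)
  have pq: "p / q = p - 1" using p by (simp add: field_simps)
  define A where "A = (\<lambda>x h. norm h powr (- ?n - s * p) * norm (u (x + h) - u x) powr p)"
  define B where "B = (\<lambda>x h. ?K h * norm h powr s * norm (v x) powr q)"
  have A: "integrable (lborel \<Otimes>\<^sub>M lborel) (\<lambda>(x, h). A x h)"
  proof (rule integrableI_bounded)
    show "(\<lambda>(x, h). A x h) \<in> borel_measurable (lborel \<Otimes>\<^sub>M lborel)" unfolding A_def by measurable
    have "(\<integral>\<^sup>+z. ennreal (norm (case z of (x, h) \<Rightarrow> A x h)) \<partial>(lborel \<Otimes>\<^sub>M lborel)) = (\<integral>\<^sup>+x. \<integral>\<^sup>+h. ennreal (A x h) \<partial>lborel \<partial>lborel)"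
      by (subst lborel.nn_integral_fst[symmetric]) (auto simp: A_def)
    also have "\<dots> = (\<integral>\<^sup>+h. \<integral>\<^sup>+x. ennreal (A x h) \<partial>lborel \<partial>lborel)"
      unfolding A_def by (rule lborel_pair.Fubini') measurable
    also have "\<dots> = gagliardo_integral s p u"
      unfolding gagliardo_integral_eq[OF \<open>u \<in> borel_measurable borel\<close>] A_def diff_int_def Lp_int_def ennreal_mult'[OF powr_ge_zero]
      by (intro nn_integral_cong nn_integral_cmult) measurable
    finally show "(\<integral>\<^sup>+z. ennreal (norm (case z of (x, h) \<Rightarrow> A x h)) \<partial>(lborel \<Otimes>\<^sub>M lborel)) < \<infinity>" using u(2) by simp
  qed
  have B: "integrable (lborel \<Otimes>\<^sub>M lborel) (\<lambda>(x, h). B x h)"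
  proof -
    have "integrable (lborel \<Otimes>\<^sub>M lborel) (\<lambda>(x, h). norm (v x) powr q * (?K h * norm h powr s))"
      using v s unfolding Lp_def by (intro integrable_pair_mult bessel_kernel_moment) auto
    then show ?thesis unfolding B_def by (simp only: mult.commute)
  qed
  show ?thesis
  proof (rule integrable_pair_dominated)
    show "integrable (lborel \<Otimes>\<^sub>M lborel) (\<lambda>(x, h). C * A x h + B x h)"
      using Bochner_Integration.integrable_add[OF integrable_mult_right[OF A, of C] B] by (simp add: case_prod_unfold)
    fix x h :: "real^'n"
      have "?K h * norm (u x - u (x + h)) * norm (v x) \<le> C * A x h + B x h"
      proof (cases "h = 0")
        case True
        then show ?thesis by (simp add: A_def B_def)
      next
        case False
        let ?a = "norm (u (x + h) - u x)" and ?b = "norm (v x)" and ?r = "norm h"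
        have "?r powr (- s / q) * ?r powr (s / q) = 1" using False by (simp add: powr_add[symmetric])
        then have "?a * ?b = (?r powr (- s / q) * ?a) * (?r powr (s / q) * ?b)"
          by (metis (no_types) mult.assoc mult.left_commute mult.right_neutral)
        also have "\<dots> \<le> (?r powr (- s / q) * ?a) powr p + (?r powr (s / q) * ?b) powr q"
          by (rule young_sum[OF p]) auto
        also have "\<dots> = ?r powr (- s * (p / q)) * ?a powr p + ?r powr s * ?b powr q"
          using p by (simp add: powr_mult powr_powr)
        finally have "?K h * (?a * ?b) \<le> ?K h * (?r powr (- s * (p / q)) * ?a powr p + ?r powr s * ?b powr q)"
          by (rule mult_left_mono) simp
        also have "\<dots> = ?K h * (?r powr (- s * (p / q)) * ?a powr p) + B x h"
          unfolding B_def by (simp only: distrib_left mult.assoc)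
        also have "?K h * (?r powr (- s * (p / q)) * ?a powr p) \<le> C * ?r powr (- ?n - s) * (?r powr (- s * (p / q)) * ?a powr p)"
          by (intro mult_right_mono C(2) False) simp
        also have "\<dots> = C * ((?r powr (- ?n - s) * ?r powr (- s * (p / q))) * ?a powr p)" by (simp only: mult.assoc)
        also have "?r powr (- ?n - s) * ?r powr (- s * (p / q)) = ?r powr (- ?n - s * p)"
        proof -
          have "(- ?n - s) + (- s * (p - 1)) = - ?n - s * p" by (simp add: right_diff_distrib)
          then show ?thesis by (simp only: powr_add[symmetric] pq)
        qed
        finally show ?thesis unfolding A_def by (simp only: norm_minus_commute[of "u x"] mult.assoc)
      qed
    then show "norm (of_real (?K h) * (u x - u (x + h)) * v x) \<le> C * A x h + B x h"
      by (simp add: norm_mult)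
  qed measurable
qed

text \<open>For fixed \<open>h\<close> the difference operator becomes, in the other factor, the one with \<open>-h\<close>, and the kernel
is even. The two orders of integration are justified by the preceding lemma applied to \<open>u, v\<close> and
to \<open>v, u\<close>.\<close>

lemma hypersingular_symmetric:
  fixes u v :: "real^'n::finite \<Rightarrow> complex"
  assumes p: "1 < p" "1 < q" "1 / p + 1 / q = 1" and s: "0 < s0" "s0 < s" "s < 1"
    and u: "u \<in> Lp p" "gagliardo_integral s p u < \<infinity>" and v: "v \<in> Lp q" "gagliardo_integral s q v < \<infinity>"
    and uv: "integrable lborel (\<lambda>x. u x * v x)" 
    and uvh: "\<And>h. integrable lborel (\<lambda>x. u x * v (x + h))"
  shows "(LINT x|lborel. u x * hypersingular s0 v x) = (LINT x|lborel. hypersingular s0 u x * v x)"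
    and "integrable lborel (\<lambda>x. hypersingular s0 u x * v x)" 
    and "integrable lborel (\<lambda>x. u x * hypersingular s0 v x)" 
proof -
  let ?K = "bessel_kernel (- s0) :: real^'n \<Rightarrow> real"
  have [measurable]: "u \<in> borel_measurable borel" "v \<in> borel_measurable borel" using u v by (auto dest: Lp_measurable)
  note i1 = hypersingular_pair_integrable[OF p s u v(1)]
  have "1 / q + 1 / p = 1" using p(3) by simp
  from hypersingular_pair_integrable[OF p(2,1) this s v u(1)]
  have i2: "integrable (lborel \<Otimes>\<^sub>M lborel) (\<lambda>(x, h). of_real (?K h) * (v x - v (x + h)) * u x)" .
  have e1: "hypersingular s0 u x * v x = (LINT h|lborel. of_real (?K h) * (u x - u (x + h)) * v x)" for x
    unfolding hypersingular_def by (rule integral_mult_left_zero[symmetric])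
  have e2: "u x * hypersingular s0 v x = (LINT h|lborel. of_real (?K h) * (v x - v (x + h)) * u x)" for x
    unfolding hypersingular_def mult.commute[of "u x"] by (rule integral_mult_left_zero[symmetric])
  show "integrable lborel (\<lambda>x. hypersingular s0 u x * v x)" 
    unfolding e1 using lborel_pair.integrable_fst'[OF i1] by simp
  show "integrable lborel (\<lambda>x. u x * hypersingular s0 v x)" 
    unfolding e2 using lborel_pair.integrable_fst'[OF i2] by simp
  have uhv: "integrable lborel (\<lambda>x. u (x + h) * v x)" for h
    using integrable_shift[OF uvh[of "- h"], of h] by simp
  have "(LINT x|lborel. u x * hypersingular s0 v x) = (LINT h|lborel. LINT x|lborel. of_real (?K h) * (v x - v (x + h)) * u x)"
    unfolding e2 by (rule lborel_pair.Fubini_integral[symmetric]) (rule i2)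
  also have "\<dots> = (LINT h|lborel. LINT x|lborel. of_real (?K (- h)) * (v x - v (x + (- h))) * u x)"
    by (rule integral_reflect_euclidean[symmetric, where f = "\<lambda>h. LINT x|lborel. of_real (?K h) * (v x - v (x + h)) * u x"]) measurable
  also have "\<dots> = (LINT h|lborel. LINT x|lborel. of_real (?K h) * (u x - u (x + h)) * v x)"
  proof (rule Bochner_Integration.integral_cong[OF refl])
    fix h
    have "(LINT x|lborel. of_real (?K (- h)) * (v x - v (x + (- h))) * u x) = of_real (?K h) * ((LINT x|lborel. u x * v x) - (LINT x|lborel. u x * v (x + (- h))))"
    proof -
      have "of_real (?K (- h)) * (v x - v (x + (- h))) * u x = of_real (?K h) * (u x * v x - u x * v (x + (- h)))" for x
        by (simp add: algebra_simps)
      then show ?thesis by (simp only: integral_mult_right_zero Bochner_Integration.integral_diff[OF uv uvh])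
    qed
    also have "(LINT x|lborel. u x * v (x + (- h))) = (LINT x|lborel. u (x + h) * v (x + h + (- h)))"
      by (rule integral_shift[symmetric, where f = "\<lambda>x. u x * v (x + (- h))"]) measurable
    also have "\<dots> = (LINT x|lborel. u (x + h) * v x)" by simp
    also have "of_real (?K h) * ((LINT x|lborel. u x * v x) - (LINT x|lborel. u (x + h) * v x)) = (LINT x|lborel. of_real (?K h) * (u x - u (x + h)) * v x)"
      unfolding mult.assoc left_diff_distrib by (simp only: integral_mult_right_zero Bochner_Integration.integral_diff[OF uv uhv])
    finally show "(LINT x|lborel. of_real (?K (- h)) * (v x - v (x + (- h))) * u x) = (LINT x|lborel. of_real (?K h) * (u x - u (x + h)) * v x)" .
  qed
  also have "\<dots> = (LINT x|lborel. hypersingular s0 u x * v x)"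
    unfolding e1 by (rule lborel_pair.Fubini_integral) (rule i1)
  finally show "(LINT x|lborel. u x * hypersingular s0 v x) = (LINT x|lborel. hypersingular s0 u x * v x)" .
qed

section \<open>Tempered distributions induced by Lebesgue functions\<close>

lemma schwartz_diff: "f \<in> schwartz \<Longrightarrow> g \<in> schwartz \<Longrightarrow> f - g \<in> schwartz"
  using schwartz_add[of f "\<lambda>x. (- 1) * g x"] schwartz_cmult[of g "- 1"] by (simp add: fun_diff_def)

lemma schwartz_seminorm_bound:
  "f \<in> schwartz \<Longrightarrow> norm x ^ k * norm (f x) \<le> schwartz_seminorm k [] f"
  unfolding schwartz_seminorm_def iter_partial.simps
  using schwartz_decays[of f] by (intro cSUP_upper) (auto simp: decays_iff_bdd_above)

lemma topspace_schwartz: "topspace (schwartz_topology :: (real^'n::finite \<Rightarrow> complex) topology) = schwartz"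
proof
  show "topspace (schwartz_topology :: (real^'n \<Rightarrow> complex) topology) \<subseteq> schwartz"
    unfolding schwartz_topology_def topology_generated_by_topspace by blast
  show "schwartz \<subseteq> topspace (schwartz_topology :: (real^'n \<Rightarrow> complex) topology)"
  proof
    fix f :: "real^'n \<Rightarrow> complex" assume f: "f \<in> schwartz"
    have "schwartz_seminorm 0 [] (f - f) < 1" by (simp add: schwartz_seminorm_def)
    then have "f \<in> {g \<in> schwartz. schwartz_seminorm 0 [] (g - f) < 1}" using f by simp
    moreover have "{g \<in> schwartz. schwartz_seminorm 0 [] (g - f) < 1} \<in> {{g \<in> schwartz. schwartz_seminorm k is (g - f) < \<epsilon>} |k is f \<epsilon>. f \<in> schwartz \<and> \<epsilon> > 0}"
      using f zero_less_one by blast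
    ultimately show "f \<in> topspace schwartz_topology"
      unfolding schwartz_topology_def topology_generated_by_topspace by blast
  qed
qed

lemma openin_schwartz_ball:
  "f \<in> schwartz \<Longrightarrow> 0 < \<epsilon> \<Longrightarrow> openin schwartz_topology {g \<in> schwartz. schwartz_seminorm k is (g - f) < \<epsilon>}"
  unfolding schwartz_topology_def by (rule topology_generated_by_Basis) blast

lemma Lp_decay_weight_integrable:
  fixes u :: "real^'n::finite \<Rightarrow> complex"
  assumes p: "1 < p" and u: "u \<in> Lp p"
  shows "integrable lborel (\<lambda>x. norm (u x) * (1 / (1 + norm x) ^ (2 * CARD('n))))"
proof -
  have "norm (complex_of_real (1 / (1 + norm x) ^ (2 * CARD('n)))) \<le> 1" for x :: "real^'n"
  proof -
    have "1 \<le> (1 + norm x) ^ (2 * CARD('n))" by (rule one_le_power) simp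
    moreover have "\<bar>1 / a\<bar> \<le> 1" if "1 \<le> a" for a :: real using that by (simp add: divide_le_eq_1)
    ultimately have "\<bar>1 / (1 + norm x) ^ (2 * CARD('n))\<bar> \<le> 1" by blast
    then show ?thesis by (simp only: norm_of_real)
  qed
  then have "integrable lborel (\<lambda>x. u x * complex_of_real (1 / (1 + norm x) ^ (2 * CARD('n))))"
    by (rule Lp_times_bounded_integrable[OF p u integrable_of_real[OF integrable_decay_weight]])
  then have "integrable lborel (\<lambda>x. norm (u x * complex_of_real (1 / (1 + norm x) ^ (2 * CARD('n)))))" by (rule integrable_norm)
  moreover have "norm (u x * complex_of_real (1 / (1 + norm x) ^ (2 * CARD('n)))) = norm (u x) * (1 / (1 + norm x) ^ (2 * CARD('n)))" for x
    unfolding norm_mult norm_of_real by simp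
  ultimately show ?thesis by (simp only:)
qed

text \<open>A Schwartz function is bounded by two seminorms times \<open>(1 + |x|)\<^bsup>-2n\<^esup>\<close>, against which \<open>u\<close> is
integrable.\<close>

lemma distr_of_bound:
  fixes u :: "real^'n::finite \<Rightarrow> complex"
  assumes p: "1 < p" and u: "u \<in> Lp p"
  obtains M where "0 < M" "\<And>\<phi>. \<phi> \<in> schwartz \<Longrightarrow> 
    norm (distr_of u \<phi>) \<le> M * (schwartz_seminorm 0 [] \<phi> + schwartz_seminorm (2 * CARD('n)) [] \<phi>)"
proof -
  let ?N = "2 * CARD('n)"
  let ?w = "\<lambda>x::real^'n. 1 / (1 + norm x) ^ ?N"
  have [measurable]: "u \<in> borel_measurable borel" using u by (rule Lp_measurable)
  define M where "M = 2 ^ ?N * (LINT x|lborel. norm (u x) * ?w x)"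
  have M: "0 \<le> M" unfolding M_def by (intro mult_nonneg_nonneg Bochner_Integration.integral_nonneg) auto
  have "norm (distr_of u \<phi>) \<le> (M + 1) * (schwartz_seminorm 0 [] \<phi> + schwartz_seminorm ?N [] \<phi>)" if \<phi>: "\<phi> \<in> schwartz" for \<phi>
  proof -
    have [measurable]: "\<phi> \<in> borel_measurable borel" using \<phi> by (rule schwartz_measurable)
    define S where "S = schwartz_seminorm 0 [] \<phi> + schwartz_seminorm ?N [] \<phi>"
    have b: "norm (\<phi> x) \<le> 2 ^ ?N * S * ?w x" for x
    proof -
      have "(1 + norm x) ^ ?N * norm (\<phi> x) \<le> 2 ^ ?N * (norm x ^ 0 * norm (\<phi> x) + norm x ^ ?N * norm (\<phi> x))"
        by (rule one_plus_power_mult_le) auto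
      also have "\<dots> \<le> 2 ^ ?N * S" unfolding S_def
        by (intro mult_left_mono add_mono schwartz_seminorm_bound \<phi>) simp
      finally show ?thesis by (simp add: pos_le_divide_eq add_pos_nonneg mult.commute)
    qed
    have S: "0 \<le> S" 
    proof -
      have "0 \<le> 2 ^ ?N * S * ?w 0" using b[of 0] norm_ge_zero order_trans by blast
      then have "0 \<le> 2 ^ ?N * S" by simp
      moreover have "0 < (2 :: real) ^ ?N" by simp
      ultimately show ?thesis unfolding zero_le_mult_iff by linarith
    qed
    have "norm (distr_of u \<phi>) \<le> (LINT x|lborel. (2 ^ ?N * S) * (norm (u x) * ?w x))"
      unfolding distr_of_def using \<phi>
    proof (simp only: if_True, intro norm_integral_le integrable_mult_right Lp_decay_weight_integrable[OF p u])
      fix x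
      have "norm (u x) * norm (\<phi> x) \<le> norm (u x) * (2 ^ ?N * S * ?w x)" by (intro mult_left_mono b) simp
      then show "norm (u x * \<phi> x) \<le> (2 ^ ?N * S) * (norm (u x) * ?w x)" by (simp only: norm_mult mult_ac)
    qed measurable
    also have "\<dots> = (2 ^ ?N * S) * (LINT x|lborel. norm (u x) * ?w x)" by (rule integral_mult_right_zero)
    also have "\<dots> = M * S" unfolding M_def by (simp only: mult_ac)
    also have "\<dots> \<le> (M + 1) * S" using S by (intro mult_right_mono) auto
    finally show ?thesis unfolding S_def .
  qed
  then show ?thesis using M by (intro that[of "M + 1"]) auto
qed

lemma distr_of_add:
  assumes "1 < p" "u \<in> Lp p" "\<phi> \<in> schwartz" "\<psi> \<in> schwartz"
  shows "distr_of u (\<lambda>x. \<phi> x + \<psi> x) = distr_of u \<phi> + distr_of u \<psi>"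
  unfolding distr_of_def using assms schwartz_add[OF assms(3,4)]
  by (simp add: distrib_left Bochner_Integration.integral_add[OF Lp_times_schwartz_integrable Lp_times_schwartz_integrable])

lemma distr_of_cmult:
  assumes "\<phi> \<in> schwartz"
  shows "distr_of u (\<lambda>x. c * \<phi> x) = c * distr_of u \<phi>"
  unfolding distr_of_def using assms schwartz_cmult[OF assms] by (simp add: mult.left_commute)

lemma distr_of_diff:
  assumes "1 < p" "u \<in> Lp p" "\<phi> \<in> schwartz" "\<psi> \<in> schwartz"
  shows "distr_of u (\<phi> - \<psi>) = distr_of u \<phi> - distr_of u \<psi>"
  using distr_of_add[OF assms(1-3) schwartz_cmult[OF assms(4), of "- 1"]] distr_of_cmult[OF assms(4), of u "- 1"]
  by (simp add: fun_diff_def)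

lemma distr_of_outside: "\<phi> \<notin> schwartz \<Longrightarrow> distr_of u \<phi> = 0"
  by (simp add: distr_of_def)

text \<open>Continuity at each Schwartz function is tested on the intersection of two subbasic
neighbourhoods, one for each seminorm in the bound.\<close>

theorem distr_of_tempered:
  fixes u :: "real^'n::finite \<Rightarrow> complex"
  assumes p: "1 < p" and u: "u \<in> Lp p"
  shows "distr_of u \<in> tempered"
proof -
  obtain M where M: "0 < M" "\<And>\<phi>. \<phi> \<in> schwartz \<Longrightarrow> 
    norm (distr_of u \<phi>) \<le> M * (schwartz_seminorm 0 [] \<phi> + schwartz_seminorm (2 * CARD('n)) [] \<phi>)"
    by (rule distr_of_bound[OF p u]) blast
  have "continuous_map schwartz_topology euclidean (distr_of u)"
    unfolding continuous_map_def topspace_schwartz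
  proof (intro conjI allI impI)
    fix U :: "complex set" assume "openin euclidean U"
    then have U: "open U" by (rule open_openin[THEN iffD2])
    show "openin schwartz_topology {\<phi> \<in> schwartz. distr_of u \<phi> \<in> U}"
    proof (subst openin_subopen, intro ballI)
      fix \<phi> assume "\<phi> \<in> {\<phi> \<in> schwartz. distr_of u \<phi> \<in> U}"
      then have \<phi>: "\<phi> \<in> schwartz" "distr_of u \<phi> \<in> U" by auto
      obtain e where e: "0 < e" "\<And>z. dist z (distr_of u \<phi>) < e \<Longrightarrow> z \<in> U" 
        using U \<phi>(2) unfolding open_dist by blast
      define d where "d = e / (2 * M)"
      have d: "0 < d" using e M(1) by (simp add: d_def)
      let ?V = "\<lambda>k. {\<psi> \<in> schwartz. schwartz_seminorm k [] (\<psi> - \<phi>) < d}"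
      have "schwartz_seminorm k [] (\<phi> - \<phi>) = 0" for k by (simp add: schwartz_seminorm_def)
      then have "\<phi> \<in> ?V 0 \<inter> ?V (2 * CARD('n))" using \<phi>(1) d by simp
      moreover have "openin schwartz_topology (?V 0 \<inter> ?V (2 * CARD('n)))"
        by (intro openin_Int openin_schwartz_ball \<phi>(1) d)
      moreover have "?V 0 \<inter> ?V (2 * CARD('n)) \<subseteq> {\<phi> \<in> schwartz. distr_of u \<phi> \<in> U}"
      proof
        fix \<psi> assume "\<psi> \<in> ?V 0 \<inter> ?V (2 * CARD('n))"
        then have \<psi>: "\<psi> \<in> schwartz" "schwartz_seminorm 0 [] (\<psi> - \<phi>) < d" "schwartz_seminorm (2 * CARD('n)) [] (\<psi> - \<phi>) < d" by auto
        have "dist (distr_of u \<psi>) (distr_of u \<phi>) = norm (distr_of u (\<psi> - \<phi>))"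
          by (simp add: dist_norm distr_of_diff[OF p u \<psi>(1) \<phi>(1)])
        also have "\<dots> \<le> M * (schwartz_seminorm 0 [] (\<psi> - \<phi>) + schwartz_seminorm (2 * CARD('n)) [] (\<psi> - \<phi>))"
          by (intro M(2) schwartz_diff \<psi>(1) \<phi>(1))
        also have "\<dots> < M * (d + d)" using \<psi>(2,3) M(1) by (intro mult_strict_left_mono add_strict_mono)
        also have "\<dots> = e" using M(1) by (simp add: d_def)
        finally show "\<psi> \<in> {\<phi> \<in> schwartz. distr_of u \<phi> \<in> U}" using e(2) \<psi>(1) by simp
      qed
      ultimately show "\<exists>V. openin schwartz_topology V \<and> \<phi> \<in> V \<and> V \<subseteq> {\<phi> \<in> schwartz. distr_of u \<phi> \<in> U}" by blast
    qed
  qed simp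
  then show ?thesis
    unfolding tempered_def using distr_of_add[OF p u] distr_of_cmult distr_of_outside by blast
qed

lemma distr_of_minus:
  assumes p: "1 < p" and u: "u \<in> Lp p" and v: "v \<in> Lp p"
  shows "distr_of u - distr_of v = distr_of (\<lambda>x. u x - v x)"
proof
  fix \<phi>
  show "(distr_of u - distr_of v) \<phi> = distr_of (\<lambda>x. u x - v x) \<phi>"
    unfolding distr_of_def
    by (simp add: left_diff_distrib Bochner_Integration.integral_diff[OF Lp_times_schwartz_integrable[OF p u] Lp_times_schwartz_integrable[OF p v]])
qed

text \<open>All the operators of the definition act on the test function; the case distinctions disappear
since each step stays inside the Schwartz space.\<close>

lemma bessel_potential_apply:
  assumes "\<phi> \<in> schwartz"
  shows "bessel_potential (- of_real s) T \<phi> = T (bessel_op (- s) \<phi>)"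
proof -
  let ?m = "\<lambda>\<xi>::real^'a. complex_of_real (1 + 4 * pi\<^sup>2 * (norm \<xi>)\<^sup>2) powr (- (- of_real s) / 2)"
  have m: "?m \<xi> = of_real (bracket_sq \<xi> powr (- (- s) / 2))" for \<xi>
  proof -
    have "?m \<xi> = complex_of_real (bracket_sq \<xi>) powr complex_of_real (s / 2)" unfolding bracket_sq_def by simp
    also have "\<dots> = of_real (bracket_sq \<xi> powr (s / 2))"
      using bracket_sq_pos[of \<xi>] by (intro powr_of_real) simp
    finally show ?thesis by simp
  qed
  have i: "inv_fourier_fun \<phi> \<in> schwartz"
    unfolding inv_fourier_fun_eq_ft by (intro schwartz_ft assms) simp
  have mi: "(\<lambda>\<xi>. of_real (bracket_sq \<xi> powr (- (- s) / 2)) * inv_fourier_fun \<phi> \<xi>) \<in> schwartz"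
    by (intro schwartz_bracket_sq_mult i)
  show ?thesis
    unfolding bessel_potential_def inv_fourier_def mult_distr_def fourier_def m
    using assms i mi by (simp add: bessel_op_def fourier_fun_eq_ft inv_fourier_fun_eq_ft)
qed

lemma bessel_potential_outside: "\<phi> \<notin> schwartz \<Longrightarrow> bessel_potential z T \<phi> = 0"
  by (simp add: bessel_potential_def inv_fourier_def)

lemma bessel_potential_diff: "bessel_potential z (S - T) = bessel_potential z S - bessel_potential z T"
  by (simp add: fun_eq_iff bessel_potential_def inv_fourier_def mult_distr_def fourier_def)

section \<open>Pairing a convolution with a Schwartz function\<close>

text \<open>The inner integral over \<open>x\<close> does not depend on \<open>h\<close>.\<close>

lemma integrable_pair_shift:
  fixes f :: "'a::euclidean_space \<Rightarrow> real"
  assumes K: "integrable lborel K" "\<And>h. 0 \<le> K h" and f: "integrable lborel f" "\<And>x. 0 \<le> f x"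
  shows "integrable (lborel \<Otimes>\<^sub>M lborel) (\<lambda>(x, h). K h * f (x + h))"
proof (rule integrableI_bounded)
  have [measurable]: "K \<in> borel_measurable borel" "f \<in> borel_measurable borel" using K f by auto
  show "(\<lambda>(x, h). K h * f (x + h)) \<in> borel_measurable (lborel \<Otimes>\<^sub>M lborel)" by measurable
  have "(\<integral>\<^sup>+z. ennreal (norm (case z of (x, h) \<Rightarrow> K h * f (x + h))) \<partial>(lborel \<Otimes>\<^sub>M lborel)) = (\<integral>\<^sup>+x. \<integral>\<^sup>+h. ennreal (K h * f (x + h)) \<partial>lborel \<partial>lborel)"
    using K(2) f(2) by (subst lborel.nn_integral_fst[symmetric]) auto
  also have "\<dots> = (\<integral>\<^sup>+h. \<integral>\<^sup>+x. ennreal (K h * f (x + h)) \<partial>lborel \<partial>lborel)"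
    by (rule lborel_pair.Fubini') measurable
  also have "\<dots> = (\<integral>\<^sup>+h. ennreal (K h) * ennreal (LINT x|lborel. f x) \<partial>lborel)"
  proof (rule nn_integral_cong)
    fix h
    have "(\<integral>\<^sup>+x. ennreal (K h * f (x + h)) \<partial>lborel) = ennreal (K h) * (\<integral>\<^sup>+x. ennreal (f (x + h)) \<partial>lborel)"
      unfolding ennreal_mult'[OF K(2)] by (rule nn_integral_cmult) measurable
    also have "(\<integral>\<^sup>+x. ennreal (f (x + h)) \<partial>lborel) = (\<integral>\<^sup>+x. ennreal (f x) \<partial>lborel)"
      by (rule nn_integral_shift[where f = "\<lambda>x. ennreal (f x)"]) measurable
    also have "\<dots> = ennreal (LINT x|lborel. f x)" by (rule nn_integral_eq_integral[OF f(1)]) (simp add: f(2))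
    finally show "(\<integral>\<^sup>+x. ennreal (K h * f (x + h)) \<partial>lborel) = ennreal (K h) * ennreal (LINT x|lborel. f x)" .
  qed
  also have "\<dots> = (\<integral>\<^sup>+h. ennreal (K h) \<partial>lborel) * ennreal (LINT x|lborel. f x)"
    by (rule nn_integral_multc) measurable
  also have "\<dots> < \<infinity>" using K by (simp add: nn_integral_eq_integral ennreal_mult_less_top)
  finally show "(\<integral>\<^sup>+z. ennreal (norm (case z of (x, h) \<Rightarrow> K h * f (x + h))) \<partial>(lborel \<Otimes>\<^sub>M lborel)) < \<infinity>" .
qed

lemma integrable_pair_Lp_times_bounded:
  fixes a b :: "'a::euclidean_space \<Rightarrow> 'a \<Rightarrow> complex"
  assumes p: "1 < p" and K: "integrable lborel K" "\<And>h. 0 \<le> K h" 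
    and [measurable]: "(\<lambda>(x, h). a x h) \<in> borel_measurable (lborel \<Otimes>\<^sub>M lborel)" "(\<lambda>(x, h). b x h) \<in> borel_measurable (lborel \<Otimes>\<^sub>M lborel)"
    and a: "integrable (lborel \<Otimes>\<^sub>M lborel) (\<lambda>(x, h). K h * norm (a x h) powr p)"
    and b: "integrable (lborel \<Otimes>\<^sub>M lborel) (\<lambda>(x, h). K h * norm (b x h))" "\<And>x h. norm (b x h) \<le> B"
  shows "integrable (lborel \<Otimes>\<^sub>M lborel) (\<lambda>(x, h). of_real (K h) * (a x h * b x h))"
proof (rule integrable_pair_dominated)
  have [measurable]: "K \<in> borel_measurable borel" using K by auto
  show "(\<lambda>(x, h). of_real (K h) * (a x h * b x h)) \<in> borel_measurable (lborel \<Otimes>\<^sub>M lborel)"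
    using assms(4,5) by measurable
  show "integrable (lborel \<Otimes>\<^sub>M lborel) (\<lambda>(x, h). K h * norm (b x h) + B * (K h * norm (a x h) powr p))"
    using Bochner_Integration.integrable_add[OF b(1) integrable_mult_right[OF a, of B]] by (simp add: case_prod_unfold)
  fix x h :: 'a
  have "norm (a x h) * norm (b x h) \<le> (1 + norm (a x h) powr p) * norm (b x h)"
    by (intro mult_right_mono le_one_plus_powr p) auto
  also have "\<dots> \<le> norm (b x h) + norm (a x h) powr p * B"
    unfolding distrib_right mult_1_left by (intro add_left_mono mult_left_mono b) auto
  finally have "K h * (norm (a x h) * norm (b x h)) \<le> K h * (norm (b x h) + norm (a x h) powr p * B)"
    by (rule mult_left_mono) (rule K)
  also have "\<dots> = K h * norm (b x h) + B * (K h * norm (a x h) powr p)" by (simp only: distrib_left mult_ac)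
  finally show "norm (of_real (K h) * (a x h * b x h)) \<le> K h * norm (b x h) + B * (K h * norm (a x h) powr p)"
    unfolding norm_mult norm_of_real abs_of_nonneg[OF K(2)] .
qed

text \<open>An even kernel gives a symmetric operator for the bilinear pairing.\<close>

lemma conv_pairing:
  fixes g :: "real^'n::finite \<Rightarrow> complex"
  assumes p: "1 < p" and K: "integrable lborel K" "\<And>h. 0 \<le> K h" "\<And>h. K (- h) = K h" and g: "g \<in> Lp p" and \<phi>: "\<phi> \<in> schwartz"
  shows "(LINT x|lborel. g x * conv K \<phi> x) = (LINT x|lborel. conv K g x * \<phi> x)"
proof -
  have [measurable]: "g \<in> borel_measurable borel" "\<phi> \<in> borel_measurable borel" "K \<in> borel_measurable borel"
    using g \<phi> K Lp_measurable schwartz_measurable by auto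
  obtain B where B: "\<And>x. norm (\<phi> x) \<le> B" using schwartz_bounded[OF \<phi>] by blast
  have gi: "integrable lborel (\<lambda>x. norm (g x) powr p)" using g unfolding Lp_def by auto
  have \<phi>i: "integrable lborel (\<lambda>x. norm (\<phi> x))" by (intro integrable_norm schwartz_integrable \<phi>)
  have noshift: "integrable (lborel \<Otimes>\<^sub>M lborel) (\<lambda>(x, h). K h * f x)" if f: "integrable lborel f" for f :: "real^'n \<Rightarrow> real"
    using integrable_pair_mult[OF f K(1)] by (simp only: mult.commute)
  have i1: "integrable (lborel \<Otimes>\<^sub>M lborel) (\<lambda>(x, h). of_real (K h) * (g x * \<phi> (x + h)))"
    by (rule integrable_pair_Lp_times_bounded[OF p K(1,2) _ _ noshift[OF gi] integrable_pair_shift[OF K(1,2) \<phi>i] B]) simp_all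
  have i2: "integrable (lborel \<Otimes>\<^sub>M lborel) (\<lambda>(x, h). of_real (K h) * (g (x + h) * \<phi> x))"
    by (rule integrable_pair_Lp_times_bounded[OF p K(1,2) _ _ integrable_pair_shift[OF K(1,2) gi] noshift[OF \<phi>i] B]) simp_all
  have "(LINT x|lborel. g x * conv K \<phi> x) = (LINT x|lborel. LINT h|lborel. of_real (K h) * (g x * \<phi> (x + h)))"
    unfolding conv_def integral_mult_right_zero[symmetric] by (simp only: mult.left_commute)
  also have "\<dots> = (LINT h|lborel. LINT x|lborel. of_real (K h) * (g x * \<phi> (x + h)))"
    by (rule lborel_pair.Fubini_integral[symmetric, OF i1])
  also have "\<dots> = (LINT h|lborel. LINT x|lborel. of_real (K (- h)) * (g x * \<phi> (x + - h)))"
    by (rule integral_reflect_euclidean[symmetric, where f = "\<lambda>h. LINT x|lborel. of_real (K h) * (g x * \<phi> (x + h))"]) measurable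
  also have "\<dots> = (LINT h|lborel. LINT x|lborel. of_real (K h) * (g (x + h) * \<phi> x))"
  proof (rule Bochner_Integration.integral_cong[OF refl])
    fix h
    have "(LINT x|lborel. of_real (K (- h)) * (g x * \<phi> (x + - h))) = (LINT x|lborel. of_real (K (- h)) * (g (x + h) * \<phi> (x + h + - h)))"
      by (rule integral_shift[symmetric, where f = "\<lambda>x. of_real (K (- h)) * (g x * \<phi> (x + - h))"]) measurable
    then show "(LINT x|lborel. of_real (K (- h)) * (g x * \<phi> (x + - h))) = (LINT x|lborel. of_real (K h) * (g (x + h) * \<phi> x))"
      by (simp add: K(3))
  qed
  also have "\<dots> = (LINT x|lborel. LINT h|lborel. of_real (K h) * (g (x + h) * \<phi> x))"
    by (rule lborel_pair.Fubini_integral[OF i2])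
  also have "\<dots> = (LINT x|lborel. conv K g x * \<phi> x)"
    unfolding conv_def integral_mult_left_zero[symmetric] by (simp only: mult.assoc)
  finally show ?thesis .
qed

lemma bessel_op_eq_conv:
  assumes "0 < s" "\<phi> \<in> schwartz"
  shows "bessel_op s \<phi> = conv (normalized_kernel s) \<phi>"
  by (rule ext) (simp add: bessel_op_positive[OF assms] conv_def normalized_kernel_def)

text \<open>A Schwartz function \<open>\<phi>\<close> is the potential of order \<open>-s\<close> of its own potential \<open>\<psi>\<close> of order \<open>s\<close>, so \<open>T\<close>
at \<open>\<phi>\<close> is the pairing of \<open>g\<close> with \<open>\<psi>\<close>, and \<open>\<psi>\<close> is a convolution with the kernel.\<close>

theorem bessel_potential_inverse_conv:
  fixes T :: "('n::finite) distr"
  assumes p: "1 < p" and s: "0 < s" and g: "g \<in> Lp p"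
    and T: "bessel_potential (- of_real s) T = distr_of g" "\<And>\<phi>. \<phi> \<notin> schwartz \<Longrightarrow> T \<phi> = 0"
  shows "T = distr_of (conv (normalized_kernel s) g)"
proof
  fix \<phi> :: "real^'n \<Rightarrow> complex"
  show "T \<phi> = distr_of (conv (normalized_kernel s) g) \<phi>"
  proof (cases "\<phi> \<in> schwartz")
    case False
    then show ?thesis using T(2) by (simp add: distr_of_def)
  next
    case True
    let ?\<psi> = "bessel_op s \<phi>"
    have \<psi>: "?\<psi> \<in> schwartz" by (rule schwartz_bessel_op[OF True])
    have "T \<phi> = T (bessel_op (- s) ?\<psi>)" by (simp add: bessel_op_inverse[OF True])
    also have "\<dots> = distr_of g ?\<psi>" unfolding T(1)[symmetric] by (rule bessel_potential_apply[OF \<psi>, symmetric])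
    also have "\<dots> = (LINT x|lborel. g x * conv (normalized_kernel s) \<phi> x)"
      using \<psi> by (simp add: distr_of_def bessel_op_eq_conv[OF s True])
    also have "\<dots> = (LINT x|lborel. conv (normalized_kernel s) g x * \<phi> x)"
    proof (rule conv_pairing[OF p normalized_kernel_integrable[OF s] _ _ g True])
      have "0 < Gamma (s / 2)" using s by (intro Gamma_real_pos) simp
      then show "0 \<le> normalized_kernel s h" for h :: "real^'n" unfolding normalized_kernel_def
        by (intro divide_nonneg_nonneg) auto
      show "normalized_kernel s (- h) = normalized_kernel s h" for h :: "real^'n"
        by (simp add: normalized_kernel_def)
    qed
    finally show ?thesis using True by (simp add: distr_of_def)
  qed
qed

lemma schwartz_Lp:
  assumes q: "1 < q" and \<phi>: "\<phi> \<in> schwartz" shows "\<phi> \<in> Lp q"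
proof -
  have [measurable]: "\<phi> \<in> borel_measurable borel" using \<phi> by (rule schwartz_measurable)
  obtain B where B: "0 \<le> B" "\<And>x. norm (\<phi> x) \<le> B" using schwartz_bounded[OF \<phi>] by blast
  have "integrable lborel (\<lambda>x. norm (\<phi> x) powr q)"
  proof (rule integrable_dominated[OF integrable_mult_right[OF integrable_norm[OF schwartz_integrable[OF \<phi>]], of "B powr (q - 1)"]])
    fix x
    have "norm (\<phi> x) powr q = norm (\<phi> x) powr (q - 1) * norm (\<phi> x)"
      by (cases "\<phi> x = 0") (simp_all add: powr_diff)
    also have "\<dots> \<le> B powr (q - 1) * norm (\<phi> x)"
      using q B by (intro mult_right_mono powr_mono2) auto
    finally show "norm (norm (\<phi> x) powr q) \<le> B powr (q - 1) * norm (\<phi> x)" by simp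
  qed measurable
  then show ?thesis unfolding Lp_def by simp
qed

text \<open>A Schwartz function is the Bessel potential, of any order, of another one, so the first
inclusion applies to it.\<close>

lemma schwartz_gagliardo:
  fixes \<phi> :: "real^'n::finite \<Rightarrow> complex"
  assumes q: "1 < q" and s: "0 < s" "s < 1" and \<phi>: "\<phi> \<in> schwartz"
  shows "gagliardo_integral s q \<phi> < \<infinity>"
proof -
  define s1 where "s1 = (s + 1) / 2"
  have s1: "0 < s1" "s < s1" "s1 < 1" using s by (auto simp: s1_def)
  let ?\<psi> = "bessel_op (- s1) \<phi>"
  have \<psi>: "?\<psi> \<in> schwartz" by (rule schwartz_bessel_op[OF \<phi>])
  obtain C where C: "0 \<le> C" "\<And>g :: real^'n \<Rightarrow> complex. g \<in> Lp q \<Longrightarrow> gagliardo_integral s q (conv (normalized_kernel s1) g) \<le> ennreal C * Lp_int q g"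
    by (rule bessel_potential_gagliardo[OF q s(1) s1(2,3), where 'n = 'n]) blast
  have "\<phi> = conv (normalized_kernel s1) ?\<psi>"
    using bessel_op_inverse[OF \<phi>, of "- s1"] bessel_op_eq_conv[OF s1(1) \<psi>] by simp
  then have "gagliardo_integral s q \<phi> \<le> ennreal C * Lp_int q ?\<psi>"
    using C(2)[OF schwartz_Lp[OF q \<psi>]] by simp
  also have "\<dots> < \<infinity>" using schwartz_Lp[OF q \<psi>] by (simp add: Lp_iff ennreal_mult_less_top)
  finally show ?thesis .
qed

text \<open>The Schwartz test function has finite Gagliardo integral for the conjugate exponent, so the
hypersingular integral may be moved to \<open>u\<close>.\<close>

theorem bessel_potential_gagliardo_function:
  fixes u :: "real^'n::finite \<Rightarrow> complex"
  assumes p: "1 < p" and s: "0 < s0" "s0 < s" "s < 1" and u: "u \<in> Lp p" "gagliardo_integral s p u < \<infinity>"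
  defines "C \<equiv> (s0 / 2) / Gamma (1 - s0 / 2)"
  shows "bessel_potential (- of_real s0) (distr_of u) = distr_of (\<lambda>x. u x + of_real C * hypersingular s0 u x)"
proof
  fix \<phi> :: "real^'n \<Rightarrow> complex"
  show "bessel_potential (- of_real s0) (distr_of u) \<phi> = distr_of (\<lambda>x. u x + of_real C * hypersingular s0 u x) \<phi>"
  proof (cases "\<phi> \<in> schwartz")
    case False
    then show ?thesis by (simp add: bessel_potential_outside distr_of_def)
  next
    case True
    define q where "q = p / (p - 1)"
    have q: "1 < q" "1 / p + 1 / q = 1" using p by (simp_all add: q_def field_simps)
    obtain B where B: "\<And>x. norm (\<phi> x) \<le> B" using schwartz_bounded[OF True] by blast
    note uv = Lp_times_schwartz_integrable[OF p u(1) True]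
    have uvh: "integrable lborel (\<lambda>x. u x * \<phi> (x + h))" for h
      by (rule Lp_times_bounded_integrable[OF p u(1) integrable_shift[OF schwartz_integrable[OF True]] B])
    have s1: "s0 < 1" "0 < s" using s by auto
    note hyp = hypersingular_symmetric[OF p q(1,2) s u schwartz_Lp[OF q(1) True] schwartz_gagliardo[OF q(1) s1(2) s(3) True] uv uvh]
    have "bessel_op (- s0) \<phi> x = \<phi> x + of_real C * hypersingular s0 \<phi> x" for x
      unfolding C_def hypersingular_def by (rule bessel_op_negative[OF s(1) s1(1) True])
    then have "bessel_potential (- of_real s0) (distr_of u) \<phi> = (LINT x|lborel. u x * (\<phi> x + of_real C * hypersingular s0 \<phi> x))"
      unfolding bessel_potential_apply[OF True] distr_of_def using schwartz_bessel_op[OF True, of "- s0"] by simp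
    also have "\<dots> = (LINT x|lborel. u x * \<phi> x + of_real C * (u x * hypersingular s0 \<phi> x))"
      by (simp only: distrib_left mult.left_commute)
    also have "\<dots> = (LINT x|lborel. u x * \<phi> x) + of_real C * (LINT x|lborel. u x * hypersingular s0 \<phi> x)"
      by (simp only: Bochner_Integration.integral_add[OF uv integrable_mult_right[OF hyp(3)]] integral_mult_right_zero)
    also have "\<dots> = (LINT x|lborel. u x * \<phi> x) + of_real C * (LINT x|lborel. hypersingular s0 u x * \<phi> x)"
      unfolding hyp(1) ..
    also have "\<dots> = (LINT x|lborel. u x * \<phi> x + of_real C * (hypersingular s0 u x * \<phi> x))"
      by (simp only: Bochner_Integration.integral_add[OF uv integrable_mult_right[OF hyp(2)]] integral_mult_right_zero)
    also have "\<dots> = distr_of (\<lambda>x. u x + of_real C * hypersingular s0 u x) \<phi>"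
      using True by (simp add: distr_of_def distrib_right mult.assoc)
    finally show ?thesis .
  qed
qed

section \<open>Continuity of the inclusions\<close>

lemma powr_add_le:
  fixes a b p :: real
  assumes "0 \<le> a" "0 \<le> b" "0 < p"
  shows "(a + b) powr p \<le> 2 powr p * (a powr p + b powr p)"
proof -
  have "(a + b) powr p \<le> (2 * max a b) powr p" using assms by (intro powr_mono2) auto
  also have "\<dots> = 2 powr p * max a b powr p" using assms by (intro powr_mult)
  also have "max a b powr p \<le> a powr p + b powr p" by (auto simp: max_def)
  finally show ?thesis by simp
qed

lemma Lp_int_add_le:
  fixes u v :: "real^'n::finite \<Rightarrow> complex"
  assumes p: "1 < p" and [measurable]: "u \<in> borel_measurable borel" "v \<in> borel_measurable borel"
  shows "Lp_int p (\<lambda>x. u x + c * v x) \<le> ennreal (2 powr p) * (Lp_int p u + ennreal (norm c powr p) * Lp_int p v)"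
proof -
  have "Lp_int p (\<lambda>x. u x + c * v x) \<le> (\<integral>\<^sup>+x. ennreal (2 powr p) * (ennreal (norm (u x) powr p) + ennreal (norm c powr p) * ennreal (norm (v x) powr p)) \<partial>lborel)"
    unfolding Lp_int_def
  proof (rule nn_integral_mono)
    fix x
    have "norm (u x + c * v x) powr p \<le> (norm (u x) + norm (c * v x)) powr p"
      using p by (intro powr_mono2 norm_triangle_ineq) auto
    also have "\<dots> \<le> 2 powr p * (norm (u x) powr p + norm (c * v x) powr p)"
      using p by (intro powr_add_le) auto
    also have "norm (c * v x) powr p = norm c powr p * norm (v x) powr p" by (simp add: norm_mult powr_mult)
    finally show "ennreal (norm (u x + c * v x) powr p) \<le> ennreal (2 powr p) * (ennreal (norm (u x) powr p) + ennreal (norm c powr p) * ennreal (norm (v x) powr p))"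
      by (simp add: ennreal_mult'[symmetric] ennreal_plus[symmetric] ennreal_leI del: ennreal_plus)
  qed
  also have "\<dots> = ennreal (2 powr p) * (Lp_int p u + ennreal (norm c powr p) * Lp_int p v)"
    unfolding Lp_int_def by (simp add: nn_integral_cmult nn_integral_add)
  finally show ?thesis .
qed

lemma Lp_minus:
  assumes p: "1 < p" and u: "u \<in> Lp p" and v: "v \<in> Lp p"
  shows "(\<lambda>x. u x - v x) \<in> Lp p"
proof -
  have [measurable]: "u \<in> borel_measurable borel" "v \<in> borel_measurable borel" using u v by (auto dest: Lp_measurable)
  have "Lp_int p (\<lambda>x. u x + (- 1) * v x) \<le> ennreal (2 powr p) * (Lp_int p u + ennreal (norm (- 1 :: complex) powr p) * Lp_int p v)"
    by (rule Lp_int_add_le[OF p]) measurable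
  also have "\<dots> < \<infinity>" using u v by (simp add: Lp_iff ennreal_mult_less_top)
  finally show ?thesis by (simp add: Lp_iff)
qed

lemma gagliardo_integral_minus:
  fixes u v :: "real^'n::finite \<Rightarrow> complex"
  assumes p: "1 < p" and [measurable]: "u \<in> borel_measurable borel" "v \<in> borel_measurable borel" 
    and u: "gagliardo_integral s p u < \<infinity>" and v: "gagliardo_integral s p v < \<infinity>"
  shows "gagliardo_integral s p (\<lambda>x. u x - v x) < \<infinity>"
proof -
  let ?w = "\<lambda>h::real^'n. ennreal (norm h powr (- real CARD('n) - s * p))"
  have d: "diff_int p (\<lambda>x. u x - v x) h \<le> ennreal (2 powr p) * (diff_int p u h + diff_int p v h)" for h
  proof -
    have "diff_int p (\<lambda>x. u x - v x) h = Lp_int p (\<lambda>x. (u (x + h) - u x) + (- 1) * (v (x + h) - v x))"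
      unfolding diff_int_def by (simp add: algebra_simps)
    also have "\<dots> \<le> ennreal (2 powr p) * (Lp_int p (\<lambda>x. u (x + h) - u x) + ennreal (norm (- 1 :: complex) powr p) * Lp_int p (\<lambda>x. v (x + h) - v x))"
      by (rule Lp_int_add_le[OF p]) measurable
    finally show ?thesis by (simp add: diff_int_def)
  qed
  have "gagliardo_integral s p (\<lambda>x. u x - v x) = (\<integral>\<^sup>+h. ?w h * diff_int p (\<lambda>x. u x - v x) h \<partial>lborel)"
    by (rule gagliardo_integral_eq) measurable
  also have "\<dots> \<le> (\<integral>\<^sup>+h. ennreal (2 powr p) * (?w h * diff_int p u h + ?w h * diff_int p v h) \<partial>lborel)"
  proof (rule nn_integral_mono)
    fix h
    have "?w h * diff_int p (\<lambda>x. u x - v x) h \<le> ?w h * (ennreal (2 powr p) * (diff_int p u h + diff_int p v h))"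
      by (intro mult_left_mono d) simp
    then show "?w h * diff_int p (\<lambda>x. u x - v x) h \<le> ennreal (2 powr p) * (?w h * diff_int p u h + ?w h * diff_int p v h)"
      by (simp only: distrib_left mult.left_commute)
  qed
  also have "\<dots> = ennreal (2 powr p) * (gagliardo_integral s p u + gagliardo_integral s p v)"
    by (simp add: gagliardo_integral_eq nn_integral_cmult nn_integral_add)
  also have "\<dots> < \<infinity>" using u v by (simp add: ennreal_mult_less_top)
  finally show ?thesis .
qed

lemma enn2real_root_le:
  assumes "A \<le> ennreal C * B" "B < \<infinity>" "0 \<le> C" "1 < p"
  shows "enn2real A powr (1 / p) \<le> C powr (1 / p) * enn2real B powr (1 / p)"
proof -
  have "enn2real A \<le> enn2real (ennreal C * B)"
    using assms by (intro enn2real_mono) (auto simp: ennreal_mult_less_top)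
  also have "\<dots> = C * enn2real B" using assms(3) by (simp add: enn2real_mult)
  finally have "enn2real A powr (1 / p) \<le> (C * enn2real B) powr (1 / p)"
    using assms by (intro powr_mono2) auto
  also have "\<dots> = C powr (1 / p) * enn2real B powr (1 / p)" by (rule powr_mult)
  finally show ?thesis .
qed

lemma Lp_conv:
  assumes p: "1 < p" and s: "0 < s" and g: "g \<in> Lp p"
  shows "conv (normalized_kernel s) g \<in> Lp p"
proof -
  have [measurable]: "g \<in> borel_measurable borel" using g by (rule Lp_measurable)
  have "Lp_int p (conv (normalized_kernel s) g) < \<infinity>"
    by (rule le_less_trans[OF Lp_int_conv_le[OF p normalized_kernel_integrable[OF s]]])
       (use g in \<open>auto simp: Lp_iff ennreal_mult_less_top\<close>)
  then show ?thesis by (simp add: Lp_iff)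
qed

text \<open>Continuity is stated through differences of two elements, so a uniform bound on these gives a
linear modulus.\<close>

lemma continuously_includedI:
  assumes "X \<subseteq> Y" "0 < C" and bound: "\<And>f g. f \<in> X \<Longrightarrow> g \<in> X \<Longrightarrow> NY (g - f) \<le> C * NX (g - f)"
  shows "continuously_included X NX Y NY"
  unfolding continuously_included_def
proof (intro conjI ballI allI impI)
  fix f :: "'a distr" and \<epsilon> :: real assume f: "f \<in> X" and \<epsilon>: "0 < \<epsilon>"
  have "NY (g - f) < \<epsilon>" if g: "g \<in> X" and "NX (g - f) < \<epsilon> / C" for g
  proof -
    have "C * NX (g - f) < \<epsilon>" using that assms(2) by (simp add: pos_less_divide_eq mult.commute)
    then show ?thesis using bound[OF f g] by linarith
  qed
  then show "\<exists>\<delta>>0. \<forall>g\<in>X. NX (g - f) < \<delta> \<longrightarrow> NY (g - f) < \<epsilon>"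
    using \<epsilon> assms(2) by (intro exI[of _ "\<epsilon> / C"]) auto
qed (rule assms(1))

text \<open>The difference of two elements is again the convolution of the kernel with a function in \<open>L\<^sup>p\<close>.
Whatever representatives the norms select, they agree almost everywhere with this convolution
and with that function.\<close>

theorem bessel_into_gagliardo:
  assumes p: "1 < p" and s: "0 < s" "s < s1" "s1 < 1"
  shows "continuously_included (bessel_space s1 p :: ('n::finite) distr set) (bessel_norm s1 p)
           (gagliardo_space s p) (gagliardo_norm s p)"
proof -
  let ?K = "normalized_kernel s1 :: real^'n \<Rightarrow> real"
  have s1: "0 < s1" using s by simp
  obtain C1 where C1: "0 \<le> C1" "\<And>g :: real^'n \<Rightarrow> complex. g \<in> Lp p \<Longrightarrow> gagliardo_integral s p (conv ?K g) \<le> ennreal C1 * Lp_int p g"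
    by (rule bessel_potential_gagliardo[OF p s, where 'n = 'n]) blast
  define C0 where "C0 = (LINT y|lborel. \<bar>?K y\<bar>) powr p"
  have C0: "0 \<le> C0" "\<And>g. g \<in> Lp p \<Longrightarrow> Lp_int p (conv ?K g) \<le> ennreal C0 * Lp_int p g"
    unfolding C0_def using Lp_int_conv_le[OF p normalized_kernel_integrable[OF s1]] by (auto dest: Lp_measurable)
  have sub: "T \<in> gagliardo_space s p" if T: "T \<in> bessel_space s1 p" for T :: "'n distr"
  proof -
    obtain g where g: "g \<in> Lp p" "bessel_potential (- of_real s1) T = distr_of g" using T unfolding bessel_space_def by blast
    have "T = distr_of (conv ?K g)"
      using T by (intro bessel_potential_inverse_conv[OF p s1 g]) (auto simp: bessel_space_def tempered_def)
    moreover have "gagliardo_integral s p (conv ?K g) < \<infinity>"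
      by (rule le_less_trans[OF C1(2)[OF g(1)]]) (use g(1) in \<open>auto simp: Lp_iff ennreal_mult_less_top\<close>)
    ultimately show ?thesis unfolding gagliardo_space_def using Lp_conv[OF p s1 g(1)] by blast
  qed
  define C where "C = C0 powr (1 / p) + C1 powr (1 / p) + 1"
  have C: "0 < C" unfolding C_def by (simp add: add_nonneg_pos)
  have bound: "gagliardo_norm s p (T - S) \<le> C * bessel_norm s1 p (T - S)" 
    if T: "T \<in> bessel_space s1 p" and S: "S \<in> bessel_space s1 p" for T S :: "'n distr"
  proof -
    obtain g where g: "g \<in> Lp p" "bessel_potential (- of_real s1) T = distr_of g" using T unfolding bessel_space_def by blast
    obtain f where f: "f \<in> Lp p" "bessel_potential (- of_real s1) S = distr_of f" using S unfolding bessel_space_def by blast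
    define r where "r = (\<lambda>x. g x - f x)"
    have r: "r \<in> Lp p" unfolding r_def by (rule Lp_minus[OF p g(1) f(1)])
    have rD: "bessel_potential (- of_real s1) (T - S) = distr_of r"
      unfolding bessel_potential_diff g f r_def by (rule distr_of_minus[OF p g(1) f(1)])
    have D: "T - S = distr_of (conv ?K r)"
      using T S by (intro bessel_potential_inverse_conv[OF p s1 r rD]) (auto simp: bessel_space_def tempered_def)
    note cr = Lp_conv[OF p s1 r]
    have m: "conv ?K r \<in> borel_measurable borel" "r \<in> borel_measurable borel" using cr r by (auto dest: Lp_measurable)
    note R1 = Lp_rep_distr_of[OF p cr] and R2 = Lp_rep_distr_of[OF p r]
    have n1: "bessel_norm s1 p (T - S) = enn2real (Lp_int p r) powr (1 / p)"
      unfolding bessel_norm_def rD Lp_norm_eq[OF Lp_measurable[OF R2(1)]] Lp_int_cong_AE[OF R2(2)] ..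
    have n2: "gagliardo_norm s p (T - S) = enn2real (Lp_int p (conv ?K r)) powr (1 / p) + enn2real (gagliardo_integral s p (conv ?K r)) powr (1 / p)"
      unfolding gagliardo_norm_def gagliardo_seminorm_def D Lp_norm_eq[OF Lp_measurable[OF R1(1)]] Lp_int_cong_AE[OF R1(2)]
        gagliardo_integral_cong_AE[OF R1(2) Lp_measurable[OF R1(1)] m(1)] ..
    have fin: "Lp_int p r < \<infinity>" using r by (simp add: Lp_iff)
    have "gagliardo_norm s p (T - S) \<le> C0 powr (1 / p) * enn2real (Lp_int p r) powr (1 / p) + C1 powr (1 / p) * enn2real (Lp_int p r) powr (1 / p)"
      unfolding n2 by (intro add_mono enn2real_root_le C0 C1 r fin p)
    also have "\<dots> \<le> C * enn2real (Lp_int p r) powr (1 / p)"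
      unfolding C_def by (simp add: distrib_right)
    finally show ?thesis unfolding n1 .
  qed
  show ?thesis
    by (rule continuously_includedI[OF _ C]) (use sub in blast, rule bound)
qed

text \<open>The Bessel norm is the \<open>L\<^sup>p\<close> norm of \<open>u + c\<close> times the hypersingular integral of \<open>u\<close>, whose \<open>p\<close>-th power is
bounded, up to a constant, by the sum of the \<open>p\<close>-th powers of the two parts of the Gagliardo norm.\<close>

theorem gagliardo_into_bessel:
  assumes p: "1 < p" and s: "0 < s0" "s0 < s" "s < 1"
  shows "continuously_included (gagliardo_space s p :: ('n::finite) distr set) (gagliardo_norm s p)
           (bessel_space s0 p) (bessel_norm s0 p)"
proof -
  obtain C1 where C1: "0 \<le> C1" "\<And>u :: real^'n \<Rightarrow> complex. u \<in> borel_measurable borel \<Longrightarrow> Lp_int p (hypersingular s0 u) \<le> ennreal C1 * gagliardo_integral s p u"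
    by (rule Lp_int_hypersingular_le[OF p s, where 'n = 'n]) blast
  define c where "c = complex_of_real ((s0 / 2) / Gamma (1 - s0 / 2))"
  define B where "B = 1 + norm c powr p * C1"
  define A where "A = 2 powr p * B"
  have B: "1 \<le> B" unfolding B_def using C1(1) by simp
  then have A: "0 \<le> A" unfolding A_def by simp
  let ?f = "\<lambda>u x. u x + c * hypersingular s0 u x"
  have est: "Lp_int p (?f u) \<le> ennreal A * (Lp_int p u + gagliardo_integral s p u)" if [measurable]: "u \<in> borel_measurable borel" for u :: "real^'n \<Rightarrow> complex"
  proof -
    have "Lp_int p (?f u) \<le> ennreal (2 powr p) * (Lp_int p u + ennreal (norm c powr p) * Lp_int p (hypersingular s0 u))"
      by (rule Lp_int_add_le[OF p]) measurable
    also have "\<dots> \<le> ennreal (2 powr p) * (Lp_int p u + ennreal (norm c powr p) * (ennreal C1 * gagliardo_integral s p u))"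
      by (intro mult_left_mono add_left_mono C1 that) auto
    also have "\<dots> \<le> ennreal (2 powr p) * (ennreal B * Lp_int p u + ennreal B * gagliardo_integral s p u)"
    proof (intro mult_left_mono add_mono)
      have "1 * Lp_int p u \<le> ennreal B * Lp_int p u"
        using B by (intro mult_right_mono) auto
      then show "Lp_int p u \<le> ennreal B * Lp_int p u" by simp
      show "ennreal (norm c powr p) * (ennreal C1 * gagliardo_integral s p u) \<le> ennreal B * gagliardo_integral s p u"
        unfolding mult.assoc[symmetric] ennreal_mult'[OF powr_ge_zero, symmetric] B_def by (intro mult_right_mono ennreal_leI) auto
    qed auto
    also have "\<dots> = ennreal A * (Lp_int p u + gagliardo_integral s p u)"
      unfolding A_def ennreal_mult'[OF powr_ge_zero] distrib_left by (simp only: mult.assoc)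
    finally show ?thesis .
  qed
  have fLp: "?f u \<in> Lp p" if u: "u \<in> Lp p" "gagliardo_integral s p u < \<infinity>" for u :: "real^'n \<Rightarrow> complex"
  proof -
    have [measurable]: "u \<in> borel_measurable borel" using u by (auto dest: Lp_measurable)
    have "Lp_int p (?f u) < \<infinity>"
      by (rule le_less_trans[OF est]) (use u in \<open>auto simp: Lp_iff ennreal_mult_less_top\<close>)
    then show ?thesis by (simp add: Lp_iff)
  qed
  have pot: "bessel_potential (- of_real s0) (distr_of u) = distr_of (?f u)" if "u \<in> Lp p" "gagliardo_integral s p u < \<infinity>" for u :: "real^'n \<Rightarrow> complex"
    unfolding c_def by (rule bessel_potential_gagliardo_function[OF p s that])
  have sub: "T \<in> bessel_space s0 p" if T: "T \<in> gagliardo_space s p" for T :: "'n distr"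
  proof -
    obtain u where u: "T = distr_of u" "u \<in> Lp p" "gagliardo_integral s p u < \<infinity>" using T unfolding gagliardo_space_def by blast
    show ?thesis unfolding bessel_space_def u(1) using distr_of_tempered[OF p u(2)] pot[OF u(2,3)] fLp[OF u(2,3)] by blast
  qed
  define C where "C = (2 * A) powr (1 / p) + 1"
  have C: "0 < C" unfolding C_def by (simp add: add_nonneg_pos)
  have bound: "bessel_norm s0 p (T - S) \<le> C * gagliardo_norm s p (T - S)" 
    if T: "T \<in> gagliardo_space s p" and S: "S \<in> gagliardo_space s p" for T S :: "'n distr"
  proof -
    obtain u1 where u1: "T = distr_of u1" "u1 \<in> Lp p" "gagliardo_integral s p u1 < \<infinity>" using T unfolding gagliardo_space_def by blast
    obtain u2 where u2: "S = distr_of u2" "u2 \<in> Lp p" "gagliardo_integral s p u2 < \<infinity>" using S unfolding gagliardo_space_def by blast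
    define u where "u = (\<lambda>x. u1 x - u2 x)"
    have u: "u \<in> Lp p" unfolding u_def by (rule Lp_minus[OF p u1(2) u2(2)])
    have ug: "gagliardo_integral s p u < \<infinity>" unfolding u_def
      by (intro gagliardo_integral_minus p Lp_measurable[OF u1(2)] Lp_measurable[OF u2(2)] u1 u2)
    have D: "T - S = distr_of u" unfolding u1(1) u2(1) u_def by (rule distr_of_minus[OF p u1(2) u2(2)])
    note R1 = Lp_rep_distr_of[OF p u] and R2 = Lp_rep_distr_of[OF p fLp[OF u ug]]
    have n1: "bessel_norm s0 p (T - S) = enn2real (Lp_int p (?f u)) powr (1 / p)"
      unfolding bessel_norm_def D pot[OF u ug] Lp_norm_eq[OF Lp_measurable[OF R2(1)]] Lp_int_cong_AE[OF R2(2)] ..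
    define N where "N = gagliardo_norm s p (T - S)"
    have n2: "N = enn2real (Lp_int p u) powr (1 / p) + enn2real (gagliardo_integral s p u) powr (1 / p)"
      unfolding N_def gagliardo_norm_def gagliardo_seminorm_def D Lp_norm_eq[OF Lp_measurable[OF R1(1)]] Lp_int_cong_AE[OF R1(2)]
        gagliardo_integral_cong_AE[OF R1(2) Lp_measurable[OF R1(1)] Lp_measurable[OF u]] ..
    have N0: "0 \<le> N" unfolding n2 by simp
    have le_N: "a \<le> N powr p" if "a powr (1 / p) \<le> N" "0 \<le> a" for a
    proof -
      have "(a powr (1 / p)) powr p \<le> N powr p" using that p by (intro powr_mono2) auto
      then show ?thesis unfolding powr_powr using that p by simp
    qed
    have a: "ennreal (enn2real (Lp_int p u)) = Lp_int p u" "ennreal (enn2real (gagliardo_integral s p u)) = gagliardo_integral s p u"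
      using u ug by (simp_all add: Lp_iff)
    have "ennreal (enn2real (Lp_int p u)) \<le> ennreal (N powr p)"
      by (intro ennreal_leI le_N) (simp_all add: n2)
    moreover have "ennreal (enn2real (gagliardo_integral s p u)) \<le> ennreal (N powr p)"
      by (intro ennreal_leI le_N) (simp_all add: n2)
    ultimately have "Lp_int p u + gagliardo_integral s p u \<le> ennreal (N powr p) + ennreal (N powr p)"
      unfolding a by (rule add_mono)
    also have "\<dots> = ennreal (2 * N powr p)" by (simp add: ennreal_plus[symmetric] del: ennreal_plus)
    finally have "Lp_int p (?f u) \<le> ennreal A * ennreal (2 * N powr p)"
      using est[OF Lp_measurable[OF u]] by (meson mult_left_mono order_trans zero_le)
    also have "\<dots> = ennreal (2 * A) * ennreal (N powr p)" using A by (simp add: ennreal_mult[symmetric])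
    finally have "enn2real (Lp_int p (?f u)) powr (1 / p) \<le> (2 * A) powr (1 / p) * enn2real (ennreal (N powr p)) powr (1 / p)"
      using A by (intro enn2real_root_le p) auto
    also have "enn2real (ennreal (N powr p)) powr (1 / p) = N"
      using N0 p by (simp add: powr_powr)
    also have "(2 * A) powr (1 / p) * N \<le> C * N" unfolding C_def using N0 by (simp add: distrib_right)
    finally show ?thesis unfolding n1 N_def .
  qed
  show ?thesis
    by (rule continuously_includedI[OF _ C]) (use sub in blast, rule bound)
qed

theorem theorem3p29:
  fixes s0 s s1 p :: real
  assumes "0 < s0" and "s0 < s" and "s < s1" and "s1 < 1" and "1 < p"
  shows "continuously_included (bessel_space s1 p :: ('n::finite) distr set) (bessel_norm s1 p)
           (gagliardo_space s p) (gagliardo_norm s p)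
       \<and> continuously_included (gagliardo_space s p :: 'n distr set) (gagliardo_norm s p)
           (bessel_space s0 p) (bessel_norm s0 p)"
  using bessel_into_gagliardo[of p s s1] gagliardo_into_bessel[of p s0 s] assms by auto

end
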